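(* Let $R$ be a commutative ring with unit, let $F(z,w)\in R[[z,w]]$ be a formal group law, and let $(V,\mathbb{1},\mathcal{S},Y)$ be a vertex $F$-algebra over $R$. Then the formula $$[a,b]=\operatorname{Res}^F_{z=0} Y(a,z)b\,dz$$ defines a Lie bracket on the quotient $V/\sum_{n\geqslant 1}\mathcal{S}^{(n)}(V)$.
   Context: All rings are commutative with unit. A formal group law over $R$ is $F(z,w)\in R[[z,w]]$ with $F(z,w)=F(w,z)$, $F(z,w)-z-w\in zw\,R[[z,w]]$, and $F(z,F(w,v))=F(F(z,w),v)$. Its inverse $\iota(z)\in R[[z]]$, $\iota(z)=-z+O(z^2)$, is the unique series with $F(z,\iota z)=0$. For an $R$-module $V$: $V((z))$ is the module of series $\sum_{n}a_nz^n$, $a_n\in V$, with $a_n=0$ for $n\ll0$; $V((z))((w))$ is the iterated version (powers of $w$ bounded below, each coefficient of a power of $w$ lying in $V((z))$); all of these are viewed inside the bilateral series $V[[z^{\pm1},w^{\pm1}]]$. Expansions: $i_{z,w}F(z,w)^m\in R((z))((w))$, $m\in\mathbb{Z}$, is the $m$-th power of $F(z,w)$ computed in the ring $R((z))((w))$, where $F(z,w)=z+O(w)$ is invertible. For $g(v,w)=\sum c_{m,n}v^mw^n\in V((v))((w))$ (in particular for $g\in V((v))$), the substitution $v\mapsto F(z,w)$ is $i_{z,w}\,g(F(z,w),w)=\sum c_{m,n}\,(i_{z,w}F(z,w)^m)\,w^n\in V((z))((w))$ (the sum converges coefficientwise). A vertex $F$-algebra over $F(z,w)\in R[[z,w]]$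 is an $R$-module $V$ with a vector $\mathbb{1}\in V$, an $R$-linear map $\mathcal{S}(z):V\to V[[z]]$, $\mathcal{S}(z)a=\sum_{n\geqslant0}\mathcal{S}^{(n)}(a)z^n$, and an $R$-linear map $V\otimes_RV\to V((z))$, $a\otimes b\mapsto Y(a,z)b=\sum_{n\in\mathbb{Z}}a_{(n)}(b)z^{-n-1}$ (so $a_{(n)}(b)=0$ for $n\gg0$), such that (operators extended coefficientwise to series): 1. Vacuum and creation: $Y(a,z)\mathbb{1}\in V[[z]]$ and $Y(a,z)\mathbb{1}|_{z=0}=a$ for all $a$; $Y(\mathbb{1},z)=\mathrm{id}_V$. 2. $F$-translation covariance: $Y(\mathcal{S}(w)a,z)b=i_{z,w}Y(a,F(z,w))b$ for all $a,b$; $\mathcal{S}(z)\mathbb{1}=\mathbb{1}$; $\mathcal{S}(z)\circ\mathcal{S}(w)=\mathcal{S}(F(z,w))$; $\mathcal{S}(0)=\mathrm{id}_V$. 3. Weak $F$-associativity: for all $a,b,c\in V$ there is $N\geqslant0$ with $F(z,w)^N\,Y(Y(a,z)b,w)c=F(z,w)^N\,i_{z,w}Y(a,F(z,w))Y(b,w)c$, where on the right $v\mapsto F(z,w)$ is substituted into $Y(a,v)Y(b,w)c\in V((v))((w))$; the equality is in $V[[z^{\pm1},w^{\pm1}]]$. 4. Skew symmetry: $Y(a,z)b=\mathcal{S}(z)\circ Y(b,\iota(z))a$ for all $a,b$. $F$-residue: let $p_F(z)=\left(\frac{\partial F}{\partial w}(z,0)\right)^{-1}\in R[[z]]$ (so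 $p_F(z)\,dz$ is the invariant differential of $F$). For $f(z)\in V((z))$, $\operatorname{Res}^F_{z=0}f(z)\,dz$ is the coefficient of $z^{-1}$ in $p_F(z)f(z)$.
   Formalization: "Lie bracket" is taken to mean bilinear, skew-symmetric ([x,y] = -[y,x]) and Jacobi; the condition [x,x] = 0 is not claimed, since it fails over Z for the integral lattice vertex algebra with (α,α) = -2 and F = z+w. *)

theory Defs
  imports
    "HOL-Computational_Algebra.Formal_Laurent_Series"
    "HOL-Library.Groups_Big_Fun"
    "HOL-Library.Set_Algebras"
begin

text \<open>
  Conventions. \<open>R[[z]]\<close> and \<open>R((z))\<close> are \<^typ>\<open>'r fps\<close> and \<^typ>\<open>'r fls\<close>; \<open>V[[z]]\<close> and \<open>V((z))\<close> are
  \<^typ>\<open>'v fps\<close> and \<^typ>\<open>'v fls\<close> (only their additive structure and coefficients are used).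
  In the iterated types \<open>R[[z]][[w]]\<close>, \<open>R((z))((w))\<close> the \<^emph>\<open>outer\<close> variable is the last one, so
  \<open>F $ n $ m\<close> is the coefficient of \<open>z^m w^n\<close>. A bilateral series in \<open>V[[z^{\<plusminus>1},w^{\<plusminus>1}]]\<close> is a function
  \<^typ>\<open>int \<Rightarrow> int \<Rightarrow> 'v\<close> taking \<open>p\<close>, \<open>q\<close> to the coefficient of \<open>z^p w^q\<close>.

  \<^const>\<open>Sum_any\<close> is the sum over all indices with nonzero summand. It is used for sums that
  converge coefficientwise, i.e. where each coefficient receives only finitely many nonzero
  contributions (\<^const>\<open>Sum_any\<close> returns \<open>0\<close> on infinite support, which does not occur in the
  situations below).
\<close>

section \<open>Inverses and integer powers in a commutative ring\<close>

definition ring_inverse :: "'a::comm_ring_1 \<Rightarrow> 'a" where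
  "ring_inverse x = (THE y. x * y = 1)"

definition ring_zpow :: "'a::comm_ring_1 \<Rightarrow> int \<Rightarrow> 'a" where
  "ring_zpow x m = (if 0 \<le> m then x ^ nat m else ring_inverse x ^ nat (- m))"


section \<open>Formal group laws\<close>

text \<open>\<open>F(A,B)\<close> for \<open>A, B\<close> without constant term in \<open>R[[z]]\<close>, respectively in \<open>R[[z]][[w]][[v]]\<close>.\<close>

definition fps_subst1 :: "'r::comm_ring_1 fps fps \<Rightarrow> 'r fps \<Rightarrow> 'r fps \<Rightarrow> 'r fps" where
  "fps_subst1 F A B =
     Abs_fps (\<lambda>i. Sum_any (\<lambda>(m,n). F $ n $ m * (A ^ m * B ^ n) $ i))"

definition fps_subst3 ::
  "'r::comm_ring_1 fps fps \<Rightarrow> 'r fps fps fps \<Rightarrow> 'r fps fps fps \<Rightarrow> 'r fps fps fps" where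
  "fps_subst3 F A B =
     Abs_fps (\<lambda>k. Abs_fps (\<lambda>j. Abs_fps (\<lambda>i.
       Sum_any (\<lambda>(m,n). F $ n $ m * (A ^ m * B ^ n) $ k $ j $ i))))"

locale formal_group_law =
  fixes F :: "'r::comm_ring_1 fps fps"
  assumes fgl_commute: "\<And>m n. F $ n $ m = F $ m $ n"
    and fgl_unit: "fps_const fps_X * fps_X dvd F - fps_const fps_X - fps_X"
    and fgl_assoc:
      "let z = fps_const (fps_const fps_X); w = fps_const fps_X; v = fps_X in
       fps_subst3 F z (fps_subst3 F w v) = fps_subst3 F (fps_subst3 F z w) v"

definition fgl_inverse :: "'r::comm_ring_1 fps fps \<Rightarrow> 'r fps" where
  "fgl_inverse F = (THE g. g $ 0 = 0 \<and> g $ 1 = - 1 \<and> fps_subst1 F fps_X g = 0)"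

text \<open>\<open>p_F(z) = ((\<partial>F/\<partial>w)(z,0))\<^sup>-\<^sup>1\<close>; \<^const>\<open>fps_deriv\<close> differentiates in the outer variable \<open>w\<close>.\<close>

definition fgl_p :: "'r::comm_ring_1 fps fps \<Rightarrow> 'r fps" where
  "fgl_p F = ring_inverse (fps_deriv F $ 0)"


section \<open>Expansions and substitutions\<close>

text \<open>\<open>i_{z,w} F(z,w)^m\<close>, the \<open>m\<close>-th power in \<open>R((z))((w))\<close>\<close>

definition fgl_expand_pow :: "'r::comm_ring_1 fps fps \<Rightarrow> int \<Rightarrow> 'r fls fls" where
  "fgl_expand_pow F m = ring_zpow (fps_to_fls (Abs_fps (\<lambda>n. fps_to_fls (F $ n)))) m"

text \<open>\<open>i_{z,w} g(F(z,w),w)\<close> for \<open>g(v,w) = \<Sum> g m n v^m w^n\<close> in \<open>V((v))((w))\<close>\<close>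

definition subst_F ::
  "('r::comm_ring_1 \<Rightarrow> 'v::ab_group_add \<Rightarrow> 'v) \<Rightarrow> 'r fps fps \<Rightarrow>
   (int \<Rightarrow> int \<Rightarrow> 'v) \<Rightarrow> int \<Rightarrow> int \<Rightarrow> 'v" where
  "subst_F scale F g = (\<lambda>p q. Sum_any (\<lambda>(m,n).
     scale (fls_nth (fls_nth (fgl_expand_pow F m) (q - n)) p) (g m n)))"

text \<open>The product (where it exists) of \<open>P(z,w)\<close> in \<open>R[[z,w]]\<close> with a bilateral series\<close>

definition bilateral_mult ::
  "('r::comm_ring_1 \<Rightarrow> 'v::ab_group_add \<Rightarrow> 'v) \<Rightarrow> 'r fps fps \<Rightarrow>
   (int \<Rightarrow> int \<Rightarrow> 'v) \<Rightarrow> int \<Rightarrow> int \<Rightarrow> 'v" where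
  "bilateral_mult scale P h = (\<lambda>p q. Sum_any (\<lambda>(i,j).
     scale (P $ j $ i) (h (p - int i) (q - int j))))"

text \<open>\<open>f(\<iota>(z))\<close> for \<open>f\<close> in \<open>V((z))\<close>\<close>

definition subst_inverse ::
  "('r::comm_ring_1 \<Rightarrow> 'v::ab_group_add \<Rightarrow> 'v) \<Rightarrow> 'r fps fps \<Rightarrow> 'v fls \<Rightarrow> int \<Rightarrow> 'v" where
  "subst_inverse scale F f = (\<lambda>p. Sum_any (\<lambda>m.
     scale (fls_nth (ring_zpow (fps_to_fls (fgl_inverse F)) m) p) (fls_nth f m)))"

text \<open>The coefficient of \<open>z^{-1}\<close> in \<open>p_F(z) f(z)\<close>\<close>

definition F_residue ::
  "('r::comm_ring_1 \<Rightarrow> 'v::ab_group_add \<Rightarrow> 'v) \<Rightarrow> 'r fps fps \<Rightarrow> 'v fls \<Rightarrow> 'v" where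
  "F_residue scale F f = Sum_any (\<lambda>n. scale (fgl_p F $ n) (fls_nth f (- 1 - int n)))"


section \<open>Vertex \<open>F\<close>-algebras\<close>

text \<open>
  \<open>S a\<close> is the series \<open>S(z)a\<close>, so \<open>S a $ n\<close> is \<open>S\<^sup>(\<^sup>n\<^sup>)(a)\<close>. \<open>Y a b\<close> is the series \<open>Y(a,z)b\<close>, so
  \<open>fls_nth (Y a b) n\<close> is the coefficient of \<open>z^n\<close>, i.e. \<open>a_{(-n-1)}(b)\<close>.
\<close>

locale vertex_F_algebra = module scale + formal_group_law F
  for scale :: "'r::comm_ring_1 \<Rightarrow> 'v::ab_group_add \<Rightarrow> 'v" and F :: "'r fps fps" +
  fixes vac :: 'v and S :: "'v \<Rightarrow> 'v fps" and Y :: "'v \<Rightarrow> 'v \<Rightarrow> 'v fls"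
  assumes S_linear: "\<And>n. module_hom scale scale (\<lambda>a. S a $ n)"
    and Y_linear_left: "\<And>b n. module_hom scale scale (\<lambda>a. fls_nth (Y a b) n)"
    and Y_linear_right: "\<And>a n. module_hom scale scale (\<lambda>b. fls_nth (Y a b) n)"
    and creation_regular: "\<And>a n. n < 0 \<Longrightarrow> fls_nth (Y a vac) n = 0"
    and creation: "\<And>a. fls_nth (Y a vac) 0 = a"
    and vacuum: "\<And>b. Y vac b = fls_const b"
    and translation_covariance:
      "\<And>a b. (\<lambda>p q. fls_nth (Y (fls_nth (fps_to_fls (S a)) q) b) p) =
        subst_F scale F (\<lambda>m n. if n = 0 then fls_nth (Y a b) m else 0)"
    and S_vac: "S vac = fps_const vac"
    and S_comp: "\<And>a i j. S (S a $ j) $ i = Sum_any (\<lambda>n. scale ((F ^ n) $ j $ i) (S a $ n))"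
    and S_0: "\<And>a. S a $ 0 = a"
    and weak_associativity:
      "\<And>a b c. \<exists>N.
        bilateral_mult scale (F ^ N) (\<lambda>p q. fls_nth (Y (fls_nth (Y a b) p) c) q) =
        bilateral_mult scale (F ^ N)
          (subst_F scale F (\<lambda>m n. fls_nth (Y a (fls_nth (Y b c) n)) m))"
    and skew_symmetry:
      "\<And>a b p. fls_nth (Y a b) p =
        Sum_any (\<lambda>n. S (subst_inverse scale F (Y b a) (p - int n)) $ n)"

text \<open>The submodule \<open>\<Sum>n\<ge>1. S\<^sup>(\<^sup>n\<^sup>)(V)\<close>\<close>

definition translation_submodule ::
  "('r::comm_ring_1 \<Rightarrow> 'v::ab_group_add \<Rightarrow> 'v) \<Rightarrow> ('v \<Rightarrow> 'v fps) \<Rightarrow> 'v set" where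
  "translation_submodule scale S = module.span scale (\<Union>n\<in>{1..}. range (\<lambda>a. S a $ n))"


section \<open>Lie brackets on quotient modules\<close>

text \<open>
  A bilinear bracket that is skew-symmetric and satisfies the Jacobi identity, on a module with
  carrier \<open>Q\<close> and the given operations. Skew-symmetry is \<open>[x,y] = -[y,x]\<close>, as usual for vertex
  algebras, and not the condition \<open>[x,x] = 0\<close>, which is stronger if \<open>2\<close> is not invertible and can
  then fail for the bracket considered here: in the integral form of the lattice vertex algebra
  of \<open>\<int>\<alpha>\<close>, \<open>(\<alpha>,\<alpha>) = -2\<close> (with \<open>F = z + w\<close>), one has \<open>[e^\<alpha>,e^\<alpha>] = \<alpha>(-1)e^{2\<alpha>}\<close>, whereas the
  translation submodule in that degree is spanned by \<open>2\<alpha>(-1)e^{2\<alpha>}\<close>.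
\<close>

definition lie_bracket_on ::
  "'q set \<Rightarrow> ('q \<Rightarrow> 'q \<Rightarrow> 'q) \<Rightarrow> 'q \<Rightarrow> ('r::comm_ring_1 \<Rightarrow> 'q \<Rightarrow> 'q) \<Rightarrow> ('q \<Rightarrow> 'q \<Rightarrow> 'q) \<Rightarrow> bool" where
  "lie_bracket_on Q add zero scl br \<longleftrightarrow>
     (\<forall>x\<in>Q. \<forall>y\<in>Q. br x y \<in> Q) \<and>
     (\<forall>x\<in>Q. \<forall>y\<in>Q. \<forall>z\<in>Q. br (add x y) z = add (br x z) (br y z)) \<and>
     (\<forall>x\<in>Q. \<forall>y\<in>Q. \<forall>z\<in>Q. br x (add y z) = add (br x y) (br x z)) \<and>
     (\<forall>r. \<forall>x\<in>Q. \<forall>y\<in>Q. br (scl r x) y = scl r (br x y)) \<and>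
     (\<forall>r. \<forall>x\<in>Q. \<forall>y\<in>Q. br x (scl r y) = scl r (br x y)) \<and>
     (\<forall>x\<in>Q. \<forall>y\<in>Q. add (br x y) (br y x) = zero) \<and>
     (\<forall>x\<in>Q. \<forall>y\<in>Q. \<forall>z\<in>Q.
        add (br x (br y z)) (add (br y (br z x)) (br z (br x y))) = zero)"

text \<open>
  The quotient \<open>V/D\<close> has the cosets \<^term>\<open>a +o D\<close> as elements. Their sum is the elementwise sum
  \<^term>\<open>X + Y\<close> of sets, the zero element is \<open>D\<close>, and \<open>r(a + D) + D = ra + D\<close>.
\<close>

definition quotient_carrier :: "'v::ab_group_add set \<Rightarrow> 'v set set" where
  "quotient_carrier D = range (\<lambda>a. a +o D)"

definition quotient_smult :: "('r \<Rightarrow> 'v::ab_group_add \<Rightarrow> 'v) \<Rightarrow> 'v set \<Rightarrow> 'r \<Rightarrow> 'v set \<Rightarrow> 'v set" where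
  "quotient_smult scale D r X = scale r ` X + D"

definition lie_bracket_on_quotient ::
  "('r::comm_ring_1 \<Rightarrow> 'v::ab_group_add \<Rightarrow> 'v) \<Rightarrow> 'v set \<Rightarrow> ('v set \<Rightarrow> 'v set \<Rightarrow> 'v set) \<Rightarrow> bool" where
  "lie_bracket_on_quotient scale D br \<longleftrightarrow>
     lie_bracket_on (quotient_carrier D) (+) D (quotient_smult scale D) br"

end

theory Submission
  imports Defs
begin

text \<open>
  Everything takes place in \<open>R((z))((w))\<close> and in its module \<open>V((z))((w))\<close>. Since the invariant
  differential is preserved by translations and changes sign under \<open>\<iota>\<close>, the \<open>F\<close>-residue is
  unchanged by \<open>z \<mapsto> F(z,w)\<close> and changes sign under \<open>z \<mapsto> \<iota>(z)\<close>. The first fact and translation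
  covariance give \<open>[S\<^sup>(\<^sup>n\<^sup>)a, b] = 0\<close> for \<open>n \<ge> 1\<close>, the second one and skew symmetry give
  \<open>[a,b] \<equiv> -[b,a]\<close> modulo \<open>\<Sum>\<^bsub>n\<ge>1\<^esub> S\<^sup>(\<^sup>n\<^sup>)V\<close>.

  For the Jacobi identity, weak associativity says that \<open>Y(b,F(w,y))Y(c,y)a\<close> and \<open>Y(Y(b,w)c,y)a\<close> are
  expansions of one function with poles only at \<open>w = 0\<close>, \<open>y = 0\<close> and \<open>F(w,y) = 0\<close>. Modulo
  \<open>\<Sum>\<^bsub>n\<ge>1\<^esub> S\<^sup>(\<^sup>n\<^sup>)V\<close>, skew symmetry and weak associativity for \<open>a,b,c\<close> identify \<open>Y(Y(a,z)b,w)c\<close> with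
  its expansion at the third pole, where \<open>y = \<iota>(F(z,w))\<close>, and the Jacobi identity is the residue
  theorem for this function.
\<close>

text \<open>R is an arbitrary commutative ring, so a residue cannot be shown to vanish by an
  antiderivative or a logarithm. The change of variables formula rests instead on logarithmic
  derivatives: to any order in w, a series congruent to 1 modulo w is a product of factors whose
  logarithmic derivatives visibly have no residue. The "one function" is never an object of its own.
  Multiplication by w^M y^M F(w,y)^N turns it into a power series; its expansions are that power
  series times inverse powers, taken in V((w))((y)), V((y))((w)) and V((w))((z)). Elements of
  different modules are compared through their coefficients, with rows and columns exchanged.
  Negative powers of F(w,y) do not survive this exchange, and the residue theorem measures the
  failure. The coordinate at the third pole comes from F(\<iota>(F(z,w)), w) = \<iota>(z), which
  turns F(w,y) = 0 into z = 0.\<close>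

unbundle fps_syntax

section \<open>Laurent series with coefficients in a module\<close>

abbreviation coeff2 :: "'v::zero fls fls \<Rightarrow> int \<Rightarrow> int \<Rightarrow> 'v" where
  "coeff2 H p q \<equiv> H $$ q $$ p"

text \<open>The scalar operation is a parameter so that the construction can be iterated:
  \<open>fls_smult (fls_smult scale)\<close> is the action of R((z))((w)) on V((z))((w)). The
  subdegrees cut the convolution down to a finite sum.\<close>

definition fls_smult :: "('a::zero \<Rightarrow> 'm::ab_group_add \<Rightarrow> 'm) \<Rightarrow> 'a fls \<Rightarrow> 'm fls \<Rightarrow> 'm fls" where
  "fls_smult s f h =
     Abs_fls (\<lambda>n. \<Sum>i\<in>{fls_subdegree f..n - fls_subdegree h}. s (f $$ i) (h $$ (n - i)))"

lemma fls_smult_times: "fls_smult (*) = ((*) :: 'a::comm_ring_1 fls \<Rightarrow> _)"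
proof (intro ext fls_eqI)
  fix f g :: "'a fls" and n
  have "\<forall>n<fls_subdegree f + fls_subdegree g.
      (\<Sum>i\<in>{fls_subdegree f..n - fls_subdegree g}. f $$ i * g $$ (n - i)) = 0"
    by simp
  then show "fls_smult (*) f g $$ n = (f * g) $$ n"
    unfolding fls_smult_def by (subst nth_Abs_fls_lower_bound, assumption) (simp add: fls_times_nth(2))
qed

context module
begin

text \<open>Any range outside which the factors vanish will do. Sums belonging to different series
  can thus be written over a common range and compared term by term.\<close>

lemma fls_smult_nth:
  assumes "\<And>i. i < A \<Longrightarrow> f $$ i = 0" and "\<And>i. i > B \<Longrightarrow> h $$ (n - i) = 0"
  shows "fls_smult scale f h $$ n = (\<Sum>i\<in>{A..B}. scale (f $$ i) (h $$ (n - i)))"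
proof -
  have "\<forall>n<fls_subdegree f + fls_subdegree h.
      (\<Sum>i\<in>{fls_subdegree f..n - fls_subdegree h}. scale (f $$ i) (h $$ (n - i))) = 0"
    by simp
  then have "fls_smult scale f h $$ n =
      (\<Sum>i\<in>{fls_subdegree f..n - fls_subdegree h}. scale (f $$ i) (h $$ (n - i)))"
    unfolding fls_smult_def by (rule nth_Abs_fls_lower_bound)
  also have "\<dots> = (\<Sum>i\<in>{A..B} \<union> {fls_subdegree f..n - fls_subdegree h}.
      scale (f $$ i) (h $$ (n - i)))"
  proof (intro sum.mono_neutral_left ballI)
    fix i assume i: "i \<in> {A..B} \<union> {fls_subdegree f..n - fls_subdegree h} -
      {fls_subdegree f..n - fls_subdegree h}"
    then have "i < fls_subdegree f \<or> n - i < fls_subdegree h" by auto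
    then show "scale (f $$ i) (h $$ (n - i)) = 0" by auto
  qed auto
  also have "\<dots> = (\<Sum>i\<in>{A..B}. scale (f $$ i) (h $$ (n - i)))"
  proof (intro sum.mono_neutral_right ballI)
    fix i assume "i \<in> {A..B} \<union> {fls_subdegree f..n - fls_subdegree h} - {A..B}"
    then have "i < A \<or> i > B" by auto
    then show "scale (f $$ i) (h $$ (n - i)) = 0" using assms by auto
  qed auto
  finally show ?thesis .
qed

lemma fls_smult_nth_eq_0:
  assumes "\<And>i. scale (f $$ i) (h $$ (n - i)) = 0"
  shows "fls_smult scale f h $$ n = 0"
proof -
  have "fls_smult scale f h $$ n =
      (\<Sum>i\<in>{fls_subdegree f..n - fls_subdegree h}. scale (f $$ i) (h $$ (n - i)))"
    by (rule fls_smult_nth) auto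
  then show ?thesis by (simp add: assms)
qed

lemma fls_smult_assoc:
  "fls_smult scale f (fls_smult scale g h) = fls_smult scale (f * g) h"
proof (rule fls_eqI)
  fix n
  define a b c where abc: "a = fls_subdegree f" "b = fls_subdegree g" "c = fls_subdegree h"
  have fg: "(f * g) $$ k = (\<Sum>i\<in>{a..k - b}. f $$ i * g $$ (k - i))" for k
    by (simp add: fls_times_nth(2) abc)
  have gh: "fls_smult scale g h $$ k = (\<Sum>i\<in>{b..k - c}. scale (g $$ i) (h $$ (k - i)))" for k
    by (rule fls_smult_nth) (auto simp: abc)
  have "fls_smult scale f (fls_smult scale g h) $$ n =
     (\<Sum>i\<in>{a..n - (b + c)}. scale (f $$ i) (fls_smult scale g h $$ (n - i)))"
    by (rule fls_smult_nth) (auto simp: gh, auto simp: abc)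
  also have "\<dots> = (\<Sum>i\<in>{a..n - (b + c)}. \<Sum>j\<in>{b..n - i - c}.
      scale (f $$ i * g $$ j) (h $$ (n - i - j)))"
    by (simp add: gh scale_sum_right)
  also have "\<dots> = (\<Sum>(i,j)\<in>(SIGMA i:{a..n - (b + c)}. {b..n - i - c}).
      scale (f $$ i * g $$ j) (h $$ (n - i - j)))"
    by (rule sum.Sigma) auto
  also have "\<dots> = (\<Sum>(k,i)\<in>(SIGMA k:{a + b..n - c}. {a..k - b}).
      scale (f $$ i * g $$ (k - i)) (h $$ (n - k)))"
    by (rule sum.reindex_bij_witness[of _ "\<lambda>(k,i). (i, k - i)" "\<lambda>(i,j). (i + j, i)"])
      (auto simp: algebra_simps)
  also have "\<dots> = (\<Sum>k\<in>{a + b..n - c}. \<Sum>i\<in>{a..k - b}.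
      scale (f $$ i * g $$ (k - i)) (h $$ (n - k)))"
    by (rule sum.Sigma[symmetric]) auto
  also have "\<dots> = (\<Sum>k\<in>{a + b..n - c}. scale ((f * g) $$ k) (h $$ (n - k)))"
    by (simp add: fg scale_sum_left)
  also have "\<dots> = fls_smult scale (f * g) h $$ n"
    by (rule fls_smult_nth[symmetric]) (auto simp: fg, auto simp: abc)
  finally show "fls_smult scale f (fls_smult scale g h) $$ n = fls_smult scale (f * g) h $$ n" .
qed

lemma module_fls_smult: "module (fls_smult scale)"
proof
  fix f g :: "'a fls" and x y :: "'b fls"
  show "fls_smult scale f (x + y) = fls_smult scale f x + fls_smult scale f y"
  proof (rule fls_eqI)
    fix n
    have "fls_smult scale f z $$ n = (\<Sum>i\<in>{fls_subdegree f..n - min (fls_subdegree x) (fls_subdegree y)}.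
        scale (f $$ i) (z $$ (n - i)))" if "z \<in> {x, y, x + y}" for z
      by (rule fls_smult_nth) (use that in auto)
    then show "fls_smult scale f (x + y) $$ n = (fls_smult scale f x + fls_smult scale f y) $$ n"
      by (simp add: scale_right_distrib sum.distrib)
  qed
  show "fls_smult scale (f + g) x = fls_smult scale f x + fls_smult scale g x"
  proof (rule fls_eqI)
    fix n
    have "fls_smult scale z x $$ n = (\<Sum>i\<in>{min (fls_subdegree f) (fls_subdegree g)..n - fls_subdegree x}.
        scale (z $$ i) (x $$ (n - i)))" if "z \<in> {f, g, f + g}" for z
      by (rule fls_smult_nth) (use that in auto)
    then show "fls_smult scale (f + g) x $$ n = (fls_smult scale f x + fls_smult scale g x) $$ n"
      by (simp add: scale_left_distrib sum.distrib)
  qed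
  show "fls_smult scale f (fls_smult scale g x) = fls_smult scale (f * g) x"
    by (rule fls_smult_assoc)
  show "fls_smult scale 1 x = x"
  proof (rule fls_eqI)
    fix n
    have "fls_smult scale 1 x $$ n = (\<Sum>i\<in>{0..max 0 (n - fls_subdegree x)}. scale (1 $$ i) (x $$ (n - i)))"
      by (rule fls_smult_nth) auto
    also have "\<dots> = (\<Sum>i\<in>{0}. scale (1 $$ i) (x $$ (n - i)))"
      by (rule sum.mono_neutral_right) auto
    finally show "fls_smult scale 1 x $$ n = x $$ n" by simp
  qed
qed

end

text \<open>A separate name for \<open>module\<close>: attached to \<open>module\<close> itself, the
  interpretations below would generate V((z)), V((z))((w)), ... without end.\<close>

locale laurent_module = module

sublocale laurent_module \<subseteq> M1: module "fls_smult scale"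
  by (rule module_fls_smult)

sublocale laurent_module \<subseteq> M2: module "fls_smult (fls_smult scale)"
  by (rule M1.module_fls_smult)

lemma laurent_module_mult: "laurent_module ((*) :: 'a::comm_ring_1 \<Rightarrow> 'a \<Rightarrow> 'a)"
  by unfold_locales (simp_all add: algebra_simps)

definition fls_monom :: "'v::zero \<Rightarrow> int \<Rightarrow> int \<Rightarrow> 'v fls fls" where
  "fls_monom v m n = fls_shift (- n) (fls_const (fls_shift (- m) (fls_const v)))"

lemma coeff2_fls_monom [simp]: "coeff2 (fls_monom v m n) p q = (if p = m \<and> q = n then v else 0)"
  by (auto simp: fls_monom_def)

lemma fls_fls_eqI: "(\<And>p q. coeff2 f p q = coeff2 g p q) \<Longrightarrow> f = g"
  by (intro fls_eqI)

lemma fls_monom_1: "fls_monom 1 0 0 = 1"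
  by (rule fls_fls_eqI) auto

context laurent_module
begin

abbreviation smult2 :: "'a fls fls \<Rightarrow> 'b fls fls \<Rightarrow> 'b fls fls" (infixr "\<odot>" 75) where
  "f \<odot> H \<equiv> fls_smult (fls_smult scale) f H"

lemma coeff2_smult2_eq_0:
  assumes "\<And>i j. coeff2 f i j = 0 \<or> coeff2 H (p - i) (q - j) = 0"
  shows "coeff2 (f \<odot> H) p q = 0"
proof -
  define L where "L = fls_subdegree f"
  define L' where "L' = fls_subdegree H"
  have "(f \<odot> H) $$ q = (\<Sum>j\<in>{L..q - L'}. fls_smult scale (f $$ j) (H $$ (q - j)))"
    by (rule M1.fls_smult_nth) (auto simp: L_def L'_def)
  moreover have "fls_smult scale (f $$ j) (H $$ (q - j)) $$ p = 0" for j
    by (rule fls_smult_nth_eq_0) (metis assms scale_zero_left scale_zero_right)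
  ultimately show ?thesis by (simp add: fls_nth_sum)
qed

lemma coeff2_smult2:
  assumes "\<And>j. j < L \<Longrightarrow> f $$ j = 0" and "\<And>j. j < L' \<Longrightarrow> H $$ j = 0"
    and "\<And>i j. j \<le> q - L' \<Longrightarrow> i < K \<Longrightarrow> coeff2 f i j = 0" and "\<And>i j. j \<le> q - L \<Longrightarrow> i < K' \<Longrightarrow> coeff2 H i j = 0"
  shows "coeff2 (f \<odot> H) p q =
    (\<Sum>j\<in>{L..q - L'}. \<Sum>i\<in>{K..p - K'}. scale (coeff2 f i j) (coeff2 H (p - i) (q - j)))"
proof -
  have "(f \<odot> H) $$ q = (\<Sum>j\<in>{L..q - L'}. fls_smult scale (f $$ j) (H $$ (q - j)))"
    by (rule M1.fls_smult_nth) (auto simp: assms)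
  moreover have "fls_smult scale (f $$ j) (H $$ (q - j)) $$ p =
      (\<Sum>i\<in>{K..p - K'}. scale (coeff2 f i j) (coeff2 H (p - i) (q - j)))" if "j \<in> {L..q - L'}" for j
    by (rule fls_smult_nth) (use that assms in auto)
  ultimately show ?thesis by (simp add: fls_nth_sum)
qed

lemma coeff2_monom_smult2: "coeff2 (fls_monom r m n \<odot> H) p q = scale r (coeff2 H (p - m) (q - n))"
proof -
  have "(fls_monom r m n \<odot> H) $$ q = (\<Sum>j\<in>{min n (q - fls_subdegree H)..max n (q - fls_subdegree H)}.
      fls_smult scale (fls_monom r m n $$ j) (H $$ (q - j)))"
    by (rule M1.fls_smult_nth) (auto simp: fls_monom_def)
  also have "\<dots> = (\<Sum>j\<in>{n}. fls_smult scale (fls_monom r m n $$ j) (H $$ (q - j)))"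
    by (rule sum.mono_neutral_right) (auto simp: fls_monom_def)
  finally have 1: "(fls_monom r m n \<odot> H) $$ q = fls_smult scale (fls_monom r m n $$ n) (H $$ (q - n))"
    by simp
  define h where "h = H $$ (q - n)"
  have "fls_smult scale (fls_monom r m n $$ n) h $$ p =
      (\<Sum>i\<in>{min m (p - fls_subdegree h)..max m (p - fls_subdegree h)}.
        scale (fls_monom r m n $$ n $$ i) (h $$ (p - i)))"
    by (rule fls_smult_nth) auto
  also have "\<dots> = (\<Sum>i\<in>{m}. scale (fls_monom r m n $$ n $$ i) (h $$ (p - i)))"
    by (rule sum.mono_neutral_right) auto
  finally show ?thesis using 1 by (simp add: h_def)
qed

lemma monom_smult2_monom:
  "fls_monom r m n \<odot> fls_monom v m' n' = fls_monom (scale r v) (m + m') (n + n')"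
  by (rule fls_fls_eqI) (auto simp: coeff2_monom_smult2)

end

lemma fls_monom_mult_monom:
  "fls_monom r m n * fls_monom s m' n' = fls_monom (r * s :: 'a::comm_ring_1) (m + m') (n + n')"
  by (rule laurent_module.monom_smult2_monom[OF laurent_module_mult, unfolded fls_smult_times])

lemma coeff2_monom_mult: "coeff2 (fls_monom r m n * H) p q = r * coeff2 H (p - m) (q - n :: int)"
  for H :: "'a::comm_ring_1 fls fls"
  by (rule laurent_module.coeff2_monom_smult2[OF laurent_module_mult, unfolded fls_smult_times])

lemma coeff2_mult_eq_0:
  fixes f H :: "'a::comm_ring_1 fls fls"
  assumes "\<And>i j. coeff2 f i j = 0 \<or> coeff2 H (p - i) (q - j) = 0"
  shows "coeff2 (f * H) p q = 0"
  using assms laurent_module.coeff2_smult2_eq_0[OF laurent_module_mult, of f H q p] by (simp add: fls_smult_times)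

section \<open>The topology of iterated Laurent series: monomials determine continuous additive
  maps\<close>

definition outer_ge :: "int \<Rightarrow> 'v::zero fls fls \<Rightarrow> bool" where
  "outer_ge L H \<longleftrightarrow> (\<forall>q<L. H $$ q = 0)"

text \<open>Together with \<open>outer_ge L\<close> this describes a neighbourhood of 0: the rows
  below L are zero, and the remaining rows up to Q start only after the exponent T.\<close>

definition vanish :: "int \<Rightarrow> int \<Rightarrow> 'v::zero fls fls \<Rightarrow> bool" where
  "vanish Q T H \<longleftrightarrow> (\<forall>q\<le>Q. \<forall>p\<le>T. coeff2 H p q = 0)"

lemma outer_geE: obtains L where "outer_ge L H"
  using fls_eq0_below_subdegree unfolding outer_ge_def by blast

lemma fls_rows_bounded: obtains K where "\<And>p q. q \<le> Q \<Longrightarrow> p < K \<Longrightarrow> coeff2 H p q = 0"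
proof -
  define L where "L = fls_subdegree H"
  define K where "K = Min (insert 0 ((\<lambda>q. fls_subdegree (H $$ q)) ` {L..Q}))"
  show thesis
  proof
    fix p q assume "q \<le> Q" "p < K"
    show "coeff2 H p q = 0"
    proof (cases "q < L")
      case False
      then have "K \<le> fls_subdegree (H $$ q)" using \<open>q \<le> Q\<close> unfolding K_def by (intro Min_le) auto
      then show ?thesis using \<open>p < K\<close> by simp
    qed (simp add: L_def)
  qed
qed

lemma coeff2_sum: "coeff2 (\<Sum>x\<in>A. f x) p q = (\<Sum>x\<in>A. coeff2 (f x) p q)"
  by (simp add: fls_nth_sum)

text \<open>Finite sums of monomials are dense. The rows of H up to Q have a common lower bound, so
  removing finitely many terms brings H into the neighbourhood given by Q and T, on which \<Phi> and
  \<Psi> agree by assumption.\<close>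

lemma fls_fls_ext:
  fixes \<Phi> \<Psi> :: "'v::ab_group_add fls fls \<Rightarrow> 'w::ab_group_add"
  assumes add: "\<And>x y. \<Phi> (x + y) = \<Phi> x + \<Phi> y" "\<And>x y. \<Psi> (x + y) = \<Psi> x + \<Psi> y"
    and tail: "\<And>L. \<exists>Q T. \<forall>H. outer_ge L H \<and> vanish Q T H \<longrightarrow> \<Phi> H = \<Psi> H"
    and monom: "\<And>v m n. \<Phi> (fls_monom v m n) = \<Psi> (fls_monom v m n)"
  shows "\<Phi> H = \<Psi> H"
proof -
  interpret P: additive \<Phi> by unfold_locales (rule add)
  interpret Q: additive \<Psi> by unfold_locales (rule add)
  obtain L where L: "outer_ge L H" by (rule outer_geE)
  obtain Q T where QT: "\<And>H. outer_ge L H \<Longrightarrow> vanish Q T H \<Longrightarrow> \<Phi> H = \<Psi> H" using tail[of L] by blast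
  obtain K where K: "\<And>p q. q \<le> Q \<Longrightarrow> p < K \<Longrightarrow> coeff2 H p q = 0" using fls_rows_bounded[of Q H] by blast
  define B where "B = {K..T} \<times> {L..Q}"
  define H' where "H' = (\<Sum>(p,q)\<in>B. fls_monom (coeff2 H p q) p q)"
  have [simp]: "finite B" by (simp add: B_def)
  have cfH': "coeff2 H' p q = (if (p,q) \<in> B then coeff2 H p q else 0)" for p q
  proof -
    have "coeff2 H' p q = (\<Sum>x\<in>B. if x = (p,q) then coeff2 H p q else 0)"
      unfolding H'_def coeff2_sum by (rule sum.cong) (auto split: if_splits)
    then show ?thesis by simp
  qed
  have "outer_ge L (H - H')" using L by (auto simp: outer_ge_def cfH' B_def intro!: fls_eqI)
  moreover have "vanish Q T (H - H')"
  proof -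
    have "coeff2 H p q = 0" if "q < L" for p q using L that by (simp add: outer_ge_def)
    then show ?thesis using K by (auto simp: vanish_def cfH' B_def not_le)
  qed
  ultimately have "\<Phi> (H - H') = \<Psi> (H - H')" by (rule QT)
  moreover have "\<Phi> H' = \<Psi> H'"
    unfolding H'_def P.sum Q.sum by (rule sum.cong) (auto simp: monom)
  ultimately show ?thesis by (simp add: P.diff Q.diff)
qed

text \<open>Continuity at 0, which is enough for additive maps. The first conjunct bounds the
  w-order of the image uniformly; without it the second conjunct could not be applied to a
  composition.\<close>

definition fls_fls_cont :: "('v::zero fls fls \<Rightarrow> 'w::zero fls fls) \<Rightarrow> bool" where
  "fls_fls_cont \<Phi> \<longleftrightarrow>
     (\<forall>L. \<exists>L'. \<forall>H. outer_ge L H \<longrightarrow> outer_ge L' (\<Phi> H)) \<and>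
     (\<forall>L Q T. \<exists>Q' T'. \<forall>H. outer_ge L H \<and> vanish Q' T' H \<longrightarrow> vanish Q T (\<Phi> H))"

lemma fls_fls_cont_compose:
  assumes "fls_fls_cont \<Phi>" "fls_fls_cont \<Psi>"
  shows "fls_fls_cont (\<lambda>H. \<Phi> (\<Psi> H))"
  unfolding fls_fls_cont_def
proof (intro conjI allI)
  fix L
  show "\<exists>L'. \<forall>H. outer_ge L H \<longrightarrow> outer_ge L' (\<Phi> (\<Psi> H))"
    using assms unfolding fls_fls_cont_def by metis
next
  fix L Q T
  obtain L' where L': "\<And>H. outer_ge L H \<Longrightarrow> outer_ge L' (\<Psi> H)"
    using assms(2) unfolding fls_fls_cont_def by metis
  obtain Q' T' where "\<And>H. outer_ge L' H \<Longrightarrow> vanish Q' T' H \<Longrightarrow> vanish Q T (\<Phi> H)"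
    using assms(1) unfolding fls_fls_cont_def by metis
  moreover obtain Q'' T'' where "\<And>H. outer_ge L H \<Longrightarrow> vanish Q'' T'' H \<Longrightarrow> vanish Q' T' (\<Psi> H)"
    using assms(2) unfolding fls_fls_cont_def by metis
  ultimately show "\<exists>Q' T'. \<forall>H. outer_ge L H \<and> vanish Q' T' H \<longrightarrow> vanish Q T (\<Phi> (\<Psi> H))"
    using L' by metis
qed

lemma fls_fls_cont_ext:
  fixes \<Phi> \<Psi> :: "'v::ab_group_add fls fls \<Rightarrow> 'w::ab_group_add fls fls"
  assumes add: "\<And>x y. \<Phi> (x + y) = \<Phi> x + \<Phi> y" "\<And>x y. \<Psi> (x + y) = \<Psi> x + \<Psi> y"
    and cont: "fls_fls_cont \<Phi>" "fls_fls_cont \<Psi>"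
    and monom: "\<And>v m n. \<Phi> (fls_monom v m n) = \<Psi> (fls_monom v m n)"
  shows "\<Phi> H = \<Psi> H"
proof (rule fls_fls_eqI)
  fix p q
  show "coeff2 (\<Phi> H) p q = coeff2 (\<Psi> H) p q"
  proof (rule fls_fls_ext[where \<Phi> = "\<lambda>H. coeff2 (\<Phi> H) p q" and \<Psi> = "\<lambda>H. coeff2 (\<Psi> H) p q"])
    fix L
    obtain Q T where 1: "\<And>H. outer_ge L H \<Longrightarrow> vanish Q T H \<Longrightarrow> vanish q p (\<Phi> H)"
      using cont(1) unfolding fls_fls_cont_def by metis
    obtain Q' T' where 2: "\<And>H. outer_ge L H \<Longrightarrow> vanish Q' T' H \<Longrightarrow> vanish q p (\<Psi> H)"
      using cont(2) unfolding fls_fls_cont_def by metis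
    have "coeff2 (\<Phi> H) p q = coeff2 (\<Psi> H) p q" if "outer_ge L H" "vanish (max Q Q') (max T T') H" for H
    proof -
      have "vanish Q T H" "vanish Q' T' H" using that(2) by (auto simp: vanish_def)
      then show ?thesis using 1[of H] 2[of H] that(1) by (auto simp: vanish_def)
    qed
    then show "\<exists>Q T. \<forall>H. outer_ge L H \<and> vanish Q T H \<longrightarrow> coeff2 (\<Phi> H) p q = coeff2 (\<Psi> H) p q" by blast
  qed (simp_all add: add monom)
qed

context laurent_module
begin

lemma outer_ge_smult2: "outer_ge L f \<Longrightarrow> outer_ge L' H \<Longrightarrow> outer_ge (L + L') (f \<odot> H)"
  unfolding outer_ge_def by (intro allI impI fls_eqI, simp, intro coeff2_smult2_eq_0)
    (metis add.commute add_less_cancel_left diff_less_eq fls_zero_nth less_trans not_less_iff_gr_or_eq)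

text \<open>K bounds from below the z-exponents in all rows of f that can contribute to rows up to
  Q, so only coefficients of H with exponents at most T - K and Q - L are met.\<close>

lemma vanish_smult2:
  assumes f: "outer_ge L f" "\<And>i j. j \<le> Q - L' \<Longrightarrow> i < K \<Longrightarrow> coeff2 f i j = 0"
    and H: "outer_ge L' H" "vanish (Q - L) (T - K) H"
  shows "vanish Q T (f \<odot> H)"
  unfolding vanish_def
proof (intro allI impI coeff2_smult2_eq_0)
  fix q p i j assume qp: "q \<le> Q" "p \<le> T"
  consider "j < L" | "q - j < L'" | "L \<le> j" "j \<le> Q - L'" using qp by linarith
  then show "coeff2 f i j = 0 \<or> coeff2 H (p - i) (q - j) = 0"
  proof cases
    case 3
    show ?thesis
    proof (cases "i < K")
      case False
      then have "q - j \<le> Q - L" "p - i \<le> T - K" using 3 qp by auto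
      then show ?thesis using H(2) by (simp add: vanish_def)
    qed (use f(2) 3 in auto)
  qed (use f(1) H(1) in \<open>auto simp: outer_ge_def\<close>)
qed

lemma vanish_smult2_left:
  assumes f: "outer_ge L f" "vanish (Q - L') (T - K) f"
    and H: "outer_ge L' H" "\<And>i j. j \<le> Q - L \<Longrightarrow> i < K \<Longrightarrow> coeff2 H i j = 0"
  shows "vanish Q T (f \<odot> H)"
  unfolding vanish_def
proof (intro allI impI coeff2_smult2_eq_0)
  fix q p i j assume qp: "q \<le> Q" "p \<le> T"
  consider "j < L" | "q - j < L'" | "L \<le> j" "j \<le> Q - L'" "q - j \<le> Q - L" using qp by linarith
  then show "coeff2 f i j = 0 \<or> coeff2 H (p - i) (q - j) = 0"
  proof cases
    case 3
    show ?thesis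
    proof (cases "p - i < K")
      case False
      then have "i \<le> T - K" using 3 qp by auto
      then show ?thesis using f(2) 3 by (simp add: vanish_def)
    qed (use H(2) 3 in auto)
  qed (use f(1) H(1) in \<open>auto simp: outer_ge_def\<close>)
qed

lemma cont_smult2_right: "fls_fls_cont (\<lambda>H. f \<odot> H)"
  unfolding fls_fls_cont_def
proof (intro conjI allI)
  obtain L where L: "outer_ge L f" by (rule outer_geE)
  show "\<exists>L'. \<forall>H. outer_ge M H \<longrightarrow> outer_ge L' (f \<odot> H)" for M
    using outer_ge_smult2[OF L] by blast
  show "\<exists>Q' T'. \<forall>H. outer_ge M H \<and> vanish Q' T' H \<longrightarrow> vanish Q T (f \<odot> H)" for M Q T
    using vanish_smult2[OF L] fls_rows_bounded[of "Q - M" f] by metis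
qed

lemma cont_smult2_left: "fls_fls_cont (\<lambda>f. f \<odot> H)"
  unfolding fls_fls_cont_def
proof (intro conjI allI)
  obtain L where L: "outer_ge L H" by (rule outer_geE)
  show "\<exists>L'. \<forall>f. outer_ge M f \<longrightarrow> outer_ge L' (f \<odot> H)" for M
    using outer_ge_smult2 L by blast
  show "\<exists>Q' T'. \<forall>f. outer_ge M f \<and> vanish Q' T' f \<longrightarrow> vanish Q T (f \<odot> H)" for M Q T
    using vanish_smult2_left[OF _ _ L] fls_rows_bounded[of "Q - M" H] by metis
qed

end

section \<open>Changes of variable in iterated Laurent series\<close>

lemma ring_inverse_eqI: "x * y = 1 \<Longrightarrow> ring_inverse x = y"
  unfolding ring_inverse_def
  by (rule the_equality) (auto, metis mult.assoc mult.commute mult.right_neutral)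

lemma ring_zpow_0 [simp]: "ring_zpow x 0 = 1"
  by (simp add: ring_zpow_def)

lemma ring_zpow_1 [simp]: "ring_zpow x 1 = x"
  by (simp add: ring_zpow_def)

lemma ring_zpow_of_nat [simp]: "ring_zpow x (int n) = x ^ n"
  by (simp add: ring_zpow_def)

lemma ring_zpow_nonneg: "0 \<le> m \<Longrightarrow> ring_zpow x m = x ^ nat m"
  by (simp add: ring_zpow_def)

lemma ring_zpow_neg: "x * y = 1 \<Longrightarrow> m \<le> 0 \<Longrightarrow> ring_zpow x m = y ^ nat (- m)"
  by (auto simp: ring_zpow_def ring_inverse_eqI)

lemma ring_zpow_Suc:
  assumes "x * y = 1"
  shows "ring_zpow x (m + 1) = x * ring_zpow x m"
proof (cases "0 \<le> m")
  case True
  then show ?thesis by (simp add: ring_zpow_nonneg nat_add_distrib)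
next
  case False
  then have "nat (- m) = Suc (nat (- (m + 1)))" by simp
  then have "ring_zpow x m = y * ring_zpow x (m + 1)"
    using False assms by (simp add: ring_zpow_neg)
  then show ?thesis by (simp add: assms flip: mult.assoc)
qed

lemma ring_zpow_add:
  assumes "x * y = 1"
  shows "ring_zpow x (m + n) = ring_zpow x m * ring_zpow x n"
proof (induction m rule: int_induct[where k = 0])
  case (step1 i)
  have "ring_zpow x (i + 1 + n) = x * ring_zpow x (i + n)"
    using ring_zpow_Suc[OF assms, of "i + n"] by (simp add: algebra_simps)
  also have "\<dots> = ring_zpow x (i + 1) * ring_zpow x n"
    by (simp only: step1.IH ring_zpow_Suc[OF assms, of i] mult.assoc)
  finally show ?case .
next
  case (step2 i)
  have "x * ring_zpow x (i - 1 + n) = ring_zpow x (i + n)"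
    using ring_zpow_Suc[OF assms, of "i - 1 + n"] by (simp add: algebra_simps)
  also have "\<dots> = x * (ring_zpow x (i - 1) * ring_zpow x n)"
  proof -
    have "ring_zpow x i = x * ring_zpow x (i - 1)" using ring_zpow_Suc[OF assms, of "i - 1"] by simp
    then show ?thesis by (simp only: step2.IH mult.assoc)
  qed
  finally have eq: "x * ring_zpow x (i - 1 + n) = x * (ring_zpow x (i - 1) * ring_zpow x n)" .
  have cancel: "a = b" if "x * a = x * b" for a b
  proof -
    have "y * x = 1" using assms by (simp add: mult.commute)
    moreover have "y * x * a = y * x * b" using that by (simp only: mult.assoc)
    ultimately show ?thesis by simp
  qed
  show ?case by (rule cancel[OF eq])
qed simp

text \<open>The inclusion of R[[z]][[w]] is split at R((z))[[w]], because the inverse of F(z,w) and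
  all logarithmic derivatives already live there.\<close>

definition fps_fls :: "'v::zero fps fps \<Rightarrow> 'v fls fps" where
  "fps_fls P = Abs_fps (\<lambda>n. fps_to_fls (P $ n))"

abbreviation emb :: "'v::zero fps fps \<Rightarrow> 'v fls fls" where
  "emb P \<equiv> fps_to_fls (fps_fls P)"

lemma fps_fls_nth [simp]: "fps_fls P $ n = fps_to_fls (P $ n)"
  by (simp add: fps_fls_def)

lemma fps_to_fls_sum: "fps_to_fls (\<Sum>x\<in>A. f x) = (\<Sum>x\<in>A. fps_to_fls (f x))"
  by (induction A rule: infinite_finite_induct) simp_all

lemma fps_fls_add: "fps_fls (P + Q) = fps_fls P + fps_fls (Q :: 'v::monoid_add fps fps)"
  by (rule fps_ext) simp

lemma fps_fls_mult: "fps_fls (P * Q) = fps_fls P * fps_fls (Q :: 'a::comm_ring_1 fps fps)"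
  by (rule fps_ext) (simp add: fps_mult_nth fps_to_fls_sum fls_times_fps_to_fls)

lemma fps_fls_1 [simp]: "fps_fls 1 = 1"
  by (rule fps_ext) simp

lemma emb_add: "emb (P + Q) = emb P + emb (Q :: 'v::monoid_add fps fps)"
  by (simp add: fps_fls_add)

lemma emb_mult: "emb (P * Q) = emb P * emb (Q :: 'a::comm_ring_1 fps fps)"
  by (simp add: fps_fls_mult fls_times_fps_to_fls)

lemma fps_to_fls_power: "fps_to_fls (f ^ n) = fps_to_fls f ^ n" for f :: "'a::comm_ring_1 fps"
  by (induction n) (simp_all add: fls_times_fps_to_fls)

lemma fps_fls_power: "fps_fls (P ^ n) = fps_fls P ^ n" for P :: "'a::comm_ring_1 fps fps"
  by (induction n) (simp_all add: fps_fls_mult)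

lemma emb_power: "emb (P ^ n) = emb P ^ n" for P :: "'a::comm_ring_1 fps fps"
  by (simp add: fps_fls_power fps_to_fls_power)

lemma emb_eq_iff [simp]: "emb P = emb Q \<longleftrightarrow> P = Q"
  by (metis fps_ext fps_fls_nth fps_to_fls_eq_iff)

definition fls_nonneg :: "'v::zero fls fls \<Rightarrow> bool" where
  "fls_nonneg H \<longleftrightarrow> (\<forall>p q. p < 0 \<or> q < 0 \<longrightarrow> coeff2 H p q = 0)"

lemma fls_nonneg_emb [simp]: "fls_nonneg (emb P)"
  by (auto simp: fls_nonneg_def)

lemma fls_nonneg_imp_emb:
  assumes "fls_nonneg H" obtains P where "H = emb P"
proof
  show "H = emb (Abs_fps (\<lambda>n. Abs_fps (\<lambda>m. coeff2 H (int m) (int n))))"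
    using assms by (intro fls_fls_eqI) (auto simp: fls_nonneg_def)
qed

text \<open>Unlike the order in z alone, a bound on the total degree survives inversion: higher
  powers of w in 1/F(z,w) may come with ever more negative powers of z, but the total degree stays
  at least -1.\<close>

definition tdeg_ge :: "int \<Rightarrow> 'v::zero fls fls \<Rightarrow> bool" where
  "tdeg_ge d H \<longleftrightarrow> (\<forall>p q. p + q < d \<longrightarrow> coeff2 H p q = 0)"

lemma tdeg_ge_mult: "tdeg_ge d f \<Longrightarrow> tdeg_ge e g \<Longrightarrow> tdeg_ge (d + e) (f * g)"
  for f g :: "'a::comm_ring_1 fls fls"
  unfolding tdeg_ge_def
proof (intro allI impI coeff2_mult_eq_0)
  fix p q i j assume *: "\<forall>p q. p + q < d \<longrightarrow> coeff2 f p q = 0" "\<forall>p q. p + q < e \<longrightarrow> coeff2 g p q = 0"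
    "p + q < d + e"
  show "coeff2 f i j = 0 \<or> coeff2 g (p - i) (q - j) = 0" using * by (cases "i + j < d") auto
qed

lemma tdeg_ge_power: "tdeg_ge d f \<Longrightarrow> tdeg_ge (d * int n) (f ^ n)"
  for f :: "'a::comm_ring_1 fls fls"
proof (induction n)
  case 0
  then show ?case by (auto simp: tdeg_ge_def)
next
  case (Suc n)
  then show ?case using tdeg_ge_mult[of d f "d * int n" "f ^ n"] by (simp add: algebra_simps)
qed

lemma outer_ge_0_mult: "outer_ge 0 f \<Longrightarrow> outer_ge 0 g \<Longrightarrow> outer_ge 0 (f * g)"
  for f g :: "'a::comm_ring_1 fls fls"
  using laurent_module.outer_ge_smult2[OF laurent_module_mult, of 0 f 0 g] by (simp add: fls_smult_times)

lemma outer_ge_0_power: "outer_ge 0 f \<Longrightarrow> outer_ge 0 (f ^ n)" for f :: "'a::comm_ring_1 fls fls"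
  by (induction n) (simp add: outer_ge_def, simp add: outer_ge_0_mult)

lemma fls_mult_nth_eq_0:
  fixes f g :: "'a::comm_ring_1 fls"
  assumes "\<And>i. i < a \<Longrightarrow> f $$ i = 0" "\<And>i. i < b \<Longrightarrow> g $$ i = 0" "n < a + b"
  shows "(f * g) $$ n = 0"
proof -
  have "f $$ i * g $$ (n - i) = 0" for i using assms by (cases "i < a") auto
  then show ?thesis
    using module.fls_smult_nth_eq_0[OF laurent_module.axioms[OF laurent_module_mult], of f g n]
    by (simp add: fls_smult_times)
qed

text \<open>P(z,0) is z times a unit, so z can be replaced by P(z,w) with w as a parameter. The
  instances are F(z,w), \<iota>(z) and \<iota>(F(z,w)).\<close>

locale fps_change =
  fixes P :: "'a::comm_ring_1 fps fps"
  assumes P_00: "P $ 0 $ 0 = 0" and P_01: "P $ 0 $ 1 dvd 1"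
begin

lemma inverse_row_0: "\<exists>v. fps_to_fls (P $ 0) * (fls_X_inv * fps_to_fls v) = 1 \<and> fps_shift 1 (P $ 0) * v = 1"
proof -
  define u where "u = fps_shift 1 (P $ 0)"
  obtain y where "u $ 0 * y = 1" using P_01 by (auto simp: u_def elim!: dvdE)
  then have uv: "u * fps_right_inverse u y = 1" by (rule fps_right_inverse)
  have "P $ 0 = fps_X * u" by (rule fps_ext) (auto simp: u_def P_00)
  then have "fps_to_fls (P $ 0) = fls_X * fps_to_fls u" by (simp add: fls_times_fps_to_fls)
  moreover have "fls_X * a * (fls_X_inv * b) = (a * b :: 'a fls)" for a b
  proof -
    have "fls_X * a * (fls_X_inv * b) = (fls_X * fls_X_inv) * (a * b)" by (simp only: mult_ac)
    also have "fls_X * (fls_X_inv :: 'a fls) = 1"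
      by (simp add: fls_X_times_conv_shift fls_X_inv_conv_shift_1)
    finally show ?thesis by simp
  qed
  ultimately have "fps_to_fls (P $ 0) * (fls_X_inv * fps_to_fls (fps_right_inverse u y)) = 1"
    using uv by (simp flip: fls_times_fps_to_fls)
  then show ?thesis using uv unfolding u_def by blast
qed

lemma inverse_exists:
  obtains \<psi> where "fps_fls P * \<psi> = 1" and "\<And>n p. p + int n < - 1 \<Longrightarrow> \<psi> $ n $$ p = 0"
proof -
  obtain v where v: "fps_to_fls (P $ 0) * (fls_X_inv * fps_to_fls v) = 1" using inverse_row_0 by blast
  define y where "y = fls_X_inv * fps_to_fls v"
  define \<psi> where "\<psi> = fps_right_inverse (fps_fls P) y"
  have y: "y $$ p = 0" if "p < - 1" for p
    unfolding y_def by (rule fls_mult_nth_eq_0[of "-1" _ 0]) (use that in auto)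
  have "\<psi> $ n $$ p = 0" if "p + int n < - 1" for n p using that
  proof (induction n arbitrary: p rule: less_induct)
    case (less n)
    show ?case
    proof (cases n)
      case 0
      then show ?thesis using less.prems by (simp add: \<psi>_def y)
    next
      case (Suc k)
      have "\<psi> $ n = - y * (\<Sum>i\<in>{1..n}. fps_fls P $ i * \<psi> $ (n - i))"
        unfolding \<psi>_def fps_nth_Abs_fps by (rule fps_right_inverse_constructor_rec) (simp add: Suc)
      moreover have "(y * (\<Sum>i\<in>{1..n}. fps_fls P $ i * \<psi> $ (n - i))) $$ p = 0"
      \<comment> \<open>In the recursion for the inverse, i >= 1: the term with
        \<open>\<psi> $ (n - i)\<close> starts at exponent -1 - (n - i) >= -n, and the factor y
        lowers this by 1 only.\<close>
      proof (rule fls_mult_nth_eq_0[of "-1" _ "- int n"])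
        fix r assume r: "r < - int n"
        have "(fps_fls P $ i * \<psi> $ (n - i)) $$ r = 0" if i: "i \<in> {1..n}" for i
        proof (rule fls_mult_nth_eq_0[of 0 _ "- 1 - int (n - i)"])
          fix s assume "s < - 1 - int (n - i)"
          then show "\<psi> $ (n - i) $$ s = 0" using i by (intro less.IH) auto
        qed (use r i in auto)
        then show "(\<Sum>i\<in>{1..n}. fps_fls P $ i * \<psi> $ (n - i)) $$ r = 0"
          by (simp add: fls_nth_sum)
      qed (use y less.prems in auto)
      ultimately show ?thesis by simp
    qed
  qed
  moreover have "fps_fls P * \<psi> = 1"
    unfolding \<psi>_def by (rule fps_right_inverse) (use v in \<open>simp add: y_def\<close>)
  ultimately show thesis using that by blast
qed

definition emb_zpow :: "int \<Rightarrow> 'a fls fls" where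
  "emb_zpow m = ring_zpow (emb P) m"

lemma emb_inverse:
  obtains \<psi> where "emb P * \<psi> = 1" "outer_ge 0 \<psi>" "tdeg_ge (- 1) \<psi>"
proof -
  obtain \<psi> where \<psi>: "fps_fls P * \<psi> = 1" "\<And>n p. p + int n < - 1 \<Longrightarrow> \<psi> $ n $$ p = 0"
    by (rule inverse_exists) blast
  show thesis
  proof
    show "emb P * fps_to_fls \<psi> = 1" by (simp add: \<psi> flip: fls_times_fps_to_fls)
    show "outer_ge 0 (fps_to_fls \<psi>)" by (simp add: outer_ge_def)
    show "tdeg_ge (- 1) (fps_to_fls \<psi>)" using \<psi>(2) by (auto simp: tdeg_ge_def)
  qed
qed

lemma emb_zpow_0 [simp]: "emb_zpow 0 = 1" and emb_zpow_1 [simp]: "emb_zpow 1 = emb P"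
  by (simp_all add: emb_zpow_def)

lemma emb_zpow_of_nat: "emb_zpow (int n) = emb P ^ n"
  by (simp add: emb_zpow_def)

lemma emb_zpow_add: "emb_zpow (m + n) = emb_zpow m * emb_zpow n"
  using emb_inverse ring_zpow_add unfolding emb_zpow_def by metis

lemma outer_ge_emb_zpow: "outer_ge 0 (emb_zpow m)" and tdeg_ge_emb_zpow: "tdeg_ge m (emb_zpow m)"
proof -
  obtain \<psi> where \<psi>: "emb P * \<psi> = 1" "outer_ge 0 \<psi>" "tdeg_ge (- 1) \<psi>" by (rule emb_inverse)
  have P: "outer_ge 0 (emb P)" "tdeg_ge 1 (emb P)"
    using P_00 by (auto simp: outer_ge_def tdeg_ge_def)
  have "outer_ge 0 (emb_zpow m) \<and> tdeg_ge m (emb_zpow m)"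
  proof (cases "0 \<le> m")
    case True
    then show ?thesis unfolding emb_zpow_def ring_zpow_nonneg[OF True]
      using outer_ge_0_power[OF P(1)] tdeg_ge_power[OF P(2)] by (metis int_nat_eq mult_1)
  next
    case False
    then have "m \<le> 0" by simp
    then show ?thesis unfolding emb_zpow_def ring_zpow_neg[OF \<psi>(1) \<open>m \<le> 0\<close>]
      using outer_ge_0_power[OF \<psi>(2)] tdeg_ge_power[OF \<psi>(3), of "nat (- m)"] by simp
  qed
  then show "outer_ge 0 (emb_zpow m)" "tdeg_ge m (emb_zpow m)" by auto
qed

lemma coeff2_emb_zpow_eq_0: "q < 0 \<or> p + q < m \<Longrightarrow> coeff2 (emb_zpow m) p q = 0"
  using outer_ge_emb_zpow[of m] tdeg_ge_emb_zpow[of m] by (auto simp: outer_ge_def tdeg_ge_def)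

lemma fls_nonneg_emb_zpow: "0 \<le> m \<Longrightarrow> fls_nonneg (emb_zpow m)"
  by (simp add: emb_zpow_def ring_zpow_nonneg flip: emb_power)

end

text \<open>Substitution of P(z,w) for v in V((v))((w)), with a Laurent series as its value and not
  only a coefficient function; \<open>subst_F\<close> is the case of F, see
  \<open>subst_F_coeff2\<close>.\<close>

definition fls_subst :: "('r::comm_ring_1 \<Rightarrow> 'v::ab_group_add \<Rightarrow> 'v) \<Rightarrow> 'r fps fps \<Rightarrow> 'v fls fls \<Rightarrow> 'v fls fls" where
  "fls_subst scale P H = Abs_fls (\<lambda>q. Abs_fls (\<lambda>p. Sum_any (\<lambda>(m,n).
     scale (coeff2 (ring_zpow (emb P) m) p (q - n)) (coeff2 H m n))))"

locale fls_substitution = laurent_module scale + fps_change P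
  for scale :: "'a::comm_ring_1 \<Rightarrow> 'b::ab_group_add \<Rightarrow> 'b" and P :: "'a fps fps"
begin

abbreviation sub :: "'b fls fls \<Rightarrow> 'b fls fls" where
  "sub \<equiv> fls_subst scale P"

text \<open>The m-th power of P has no negative powers of w and total degree at least m. This bounds
  n and m from above; L and K bound them from below.\<close>

lemma sub_support:
  assumes "outer_ge L H" "\<And>m n. n \<le> q \<Longrightarrow> m < K \<Longrightarrow> coeff2 H m n = 0"
  shows "{(m,n). scale (coeff2 (emb_zpow m) p (q - n)) (coeff2 H m n) \<noteq> 0} \<subseteq> {K..p + q - L} \<times> {L..q}"
proof (rule subsetI)
  fix x assume "x \<in> {(m,n). scale (coeff2 (emb_zpow m) p (q - n)) (coeff2 H m n) \<noteq> 0}"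
  then obtain m n where x: "x = (m, n)" and nz: "scale (coeff2 (emb_zpow m) p (q - n)) (coeff2 H m n) \<noteq> 0" by auto
  then have "coeff2 (emb_zpow m) p (q - n) \<noteq> 0" "coeff2 H m n \<noteq> 0" by auto
  then have "\<not> (q - n < 0 \<or> p + (q - n) < m)" "L \<le> n" "m \<ge> K \<or> n > q"
    using coeff2_emb_zpow_eq_0[of "q - n" p m] assms by (auto simp: outer_ge_def not_less[symmetric])
  then show "x \<in> {K..p + q - L} \<times> {L..q}" by (auto simp: x)
qed

lemma coeff2_sub: "coeff2 (sub H) p q = Sum_any (\<lambda>(m,n). scale (coeff2 (emb_zpow m) p (q - n)) (coeff2 H m n))"
proof -
  define c where "c p q = Sum_any (\<lambda>(m,n). scale (coeff2 (emb_zpow m) p (q - n)) (coeff2 H m n))" for p q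
  obtain L where L: "outer_ge L H" by (rule outer_geE)
  \<comment> \<open>Coefficients of \<open>Abs_fls\<close> are available only for families that
    vanish far below, so this is established first, within each row and then for the rows
    themselves.\<close>
  have c0: "c p q = 0" if "\<And>m n. n \<le> q \<Longrightarrow> m < K \<Longrightarrow> coeff2 H m n = 0" "q < L \<or> p + q - L < K" for p q K
  proof -
    have "{(m,n). scale (coeff2 (emb_zpow m) p (q - n)) (coeff2 H m n) \<noteq> 0} = {}"
      using sub_support[OF L that(1), where p = p] that(2) by fastforce
    then show ?thesis unfolding c_def by (simp add: case_prod_unfold Sum_any.expand_set)
  qed
  have 1: "Abs_fls (\<lambda>p. c p q) $$ p = c p q" for p q
  proof -
    obtain K where "\<And>m n. n \<le> q \<Longrightarrow> m < K \<Longrightarrow> coeff2 H m n = 0" using fls_rows_bounded[of q H] by blast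
    then have "\<forall>p<K + L - q. c p q = 0" using c0[of q K] by simp
    then show ?thesis by (rule nth_Abs_fls_lower_bound)
  qed
  have "\<forall>q<L. Abs_fls (\<lambda>p. c p q) = 0"
  proof (intro allI impI fls_eqI)
    fix q p assume "q < L"
    obtain K where "\<And>m n. n \<le> q \<Longrightarrow> m < K \<Longrightarrow> coeff2 H m n = 0" using fls_rows_bounded[of q H] by blast
    then show "Abs_fls (\<lambda>p. c p q) $$ p = 0 $$ p" using c0[of q K] \<open>q < L\<close> by (simp add: 1)
  qed
  then have "Abs_fls (\<lambda>q. Abs_fls (\<lambda>p. c p q)) $$ q = Abs_fls (\<lambda>p. c p q)"
    by (rule nth_Abs_fls_lower_bound)
  then have "coeff2 (Abs_fls (\<lambda>q. Abs_fls (\<lambda>p. c p q))) p q = c p q" by (simp add: 1)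
  then show ?thesis by (simp add: fls_subst_def c_def emb_zpow_def)
qed

lemma coeff2_sub_sum:
  assumes "outer_ge L H" "\<And>m n. n \<le> q \<Longrightarrow> m < K \<Longrightarrow> coeff2 H m n = 0"
  shows "coeff2 (sub H) p q =
    (\<Sum>(m,n)\<in>{K..p + q - L} \<times> {L..q}. scale (coeff2 (emb_zpow m) p (q - n)) (coeff2 H m n))"
proof -
  have "{(m,n). scale (coeff2 (emb_zpow m) p (q - n)) (coeff2 H m n) \<noteq> 0} \<subseteq> {K..p + q - L} \<times> {L..q}"
    using assms by (rule sub_support)
  then show ?thesis unfolding coeff2_sub by (intro Sum_any.expand_superset) (auto simp: case_prod_unfold)
qed

lemma coeff2_sub_eq_0:
  assumes "\<And>m n. coeff2 (emb_zpow m) p (q - n) = 0 \<or> coeff2 H m n = 0"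
  shows "coeff2 (sub H) p q = 0"
proof -
  have "(\<lambda>(m,n). scale (coeff2 (emb_zpow m) p (q - n)) (coeff2 H m n)) = (\<lambda>_. 0)"
    using assms by (intro ext) (auto split: prod.splits, metis scale_zero_left scale_zero_right)
  then show ?thesis unfolding coeff2_sub by simp
qed

lemma sub_add: "sub (H + H') = sub H + sub H'"
proof (rule fls_fls_eqI)
  fix p q
  obtain L1 L2 where L: "outer_ge L1 H" "outer_ge L2 H'" by (meson outer_geE)
  obtain K1 where K1: "\<And>m n. n \<le> q \<Longrightarrow> m < K1 \<Longrightarrow> coeff2 H m n = 0" using fls_rows_bounded[of q H] by blast
  obtain K2 where K2: "\<And>m n. n \<le> q \<Longrightarrow> m < K2 \<Longrightarrow> coeff2 H' m n = 0" using fls_rows_bounded[of q H'] by blast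
  have "coeff2 (sub G) p q = (\<Sum>(m,n)\<in>{min K1 K2..p + q - min L1 L2} \<times> {min L1 L2..q}.
      scale (coeff2 (emb_zpow m) p (q - n)) (coeff2 G m n))" if "G \<in> {H, H', H + H'}" for G
    by (rule coeff2_sub_sum) (use that L K1 K2 in \<open>auto simp: outer_ge_def\<close>)
  then show "coeff2 (sub (H + H')) p q = coeff2 (sub H + sub H') p q"
    by (simp add: scale_right_distrib case_prod_unfold sum.distrib)
qed

lemma cont_sub: "fls_fls_cont sub"
  unfolding fls_fls_cont_def
proof (intro conjI allI)
  fix L
  have "outer_ge L (sub H)" if "outer_ge L H" for H
    unfolding outer_ge_def
  proof (intro allI impI fls_eqI)
    fix p q assume "q < L"
    have "coeff2 (sub H) p q = 0"
    proof (rule coeff2_sub_eq_0)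
      fix m n
      show "coeff2 (emb_zpow m) p (q - n) = 0 \<or> coeff2 H m n = 0"
        using that coeff2_emb_zpow_eq_0[of "q - n" p m] \<open>q < L\<close> by (cases "n < L") (auto simp: outer_ge_def)
    qed
    then show "sub H $$ q $$ p = 0 $$ p" by simp
  qed
  then show "\<exists>L'. \<forall>H. outer_ge L H \<longrightarrow> outer_ge L' (sub H)" by blast
next
  fix L Q T
  have "vanish Q T (sub H)" if H: "outer_ge L H" "vanish Q (T + Q - L) H" for H
    unfolding vanish_def
  proof (intro allI impI coeff2_sub_eq_0)
    fix q p m n assume "q \<le> Q" "p \<le> T"
    then consider "n < L" | "q < n" | "m > p + (q - n)" | "n \<le> Q" "m \<le> T + Q - L" by linarith
    then show "coeff2 (emb_zpow m) p (q - n) = 0 \<or> coeff2 H m n = 0"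
      by cases (use H coeff2_emb_zpow_eq_0 in \<open>auto simp: outer_ge_def vanish_def\<close>)
  qed
  then show "\<exists>Q' T'. \<forall>H. outer_ge L H \<and> vanish Q' T' H \<longrightarrow> vanish Q T (sub H)" by blast
qed

end

context laurent_module
begin

lemma coeff2_smult2_monom: "coeff2 (f \<odot> fls_monom v m n) p q = scale (coeff2 f (p - m) (q - n)) v"
proof (rule fls_fls_ext[where \<Phi> = "\<lambda>f. coeff2 (f \<odot> fls_monom v m n) p q"
        and \<Psi> = "\<lambda>f. scale (coeff2 f (p - m) (q - n)) v"])
  fix L
  have "coeff2 (f \<odot> fls_monom v m n) p q = 0" if "vanish (q - n) (p - m) f" for f
    by (rule coeff2_smult2_eq_0) (use that in \<open>auto simp: vanish_def\<close>)
  then show "\<exists>Q T. \<forall>H. outer_ge L H \<and> vanish Q T H \<longrightarrow>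
      coeff2 (H \<odot> fls_monom v m n) p q = scale (coeff2 H (p - m) (q - n)) v"
    by (intro exI[of _ "q - n"] exI[of _ "p - m"]) (auto simp: vanish_def)
qed (auto simp: M2.scale_left_distrib scale_left_distrib monom_smult2_monom)

end

context fls_substitution
begin

text \<open>The vector v is kept apart as a constant series, so that computations with monomials
  take place in the ring R((z))((w)).\<close>

lemma sub_monom: "sub (fls_monom v m n) = (emb_zpow m * fls_monom 1 0 n) \<odot> fls_monom v 0 0"
proof (rule fls_fls_eqI)
  fix p q
  have "(\<lambda>(i, j). scale (coeff2 (emb_zpow i) p (q - j)) (coeff2 (fls_monom v m n) i j)) =
      (\<lambda>x. if x = (m, n) then scale (coeff2 (emb_zpow m) p (q - n)) v else 0)"
    by auto
  then have "coeff2 (sub (fls_monom v m n)) p q = scale (coeff2 (emb_zpow m) p (q - n)) v"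
    unfolding coeff2_sub by simp
  then show "coeff2 (sub (fls_monom v m n)) p q = coeff2 ((emb_zpow m * fls_monom 1 0 n) \<odot> fls_monom v 0 0) p q"
    by (simp add: coeff2_smult2_monom mult.commute[of "emb_zpow m"] coeff2_monom_mult)
qed

text \<open>On monomials this is additivity of exponents for powers of P. Continuity in each
  argument separately extends it to all f and then to all H.\<close>

lemma sub_smult2: "sub (f \<odot> H) = fls_subst (*) P f \<odot> sub H"
proof -
  interpret R: fls_substitution "(*)" P
    rewrites "fls_smult (*) = ((*) :: 'a fls \<Rightarrow> _)" and "fls_smult (*) = ((*) :: 'a fls fls \<Rightarrow> _)"
    by (intro fls_substitution.intro laurent_module_mult fps_change_axioms) (simp_all add: fls_smult_times)
  have 1: "sub (fls_monom r i j \<odot> fls_monom v m n) = R.sub (fls_monom r i j) \<odot> sub (fls_monom v m n)"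
    for r v i j m n
  proof -
    have "emb_zpow i * fls_monom 1 0 j * fls_monom r 0 0 * (emb_zpow m * fls_monom 1 0 n) =
        emb_zpow (i + m) * (fls_monom 1 0 j * fls_monom 1 0 n) * fls_monom r 0 0"
      unfolding emb_zpow_add by (simp only: mult_ac)
    then have "R.sub (fls_monom r i j) \<odot> sub (fls_monom v m n) =
       (emb_zpow (i + m) * (fls_monom 1 0 j * fls_monom 1 0 n) * fls_monom r 0 0) \<odot> fls_monom v 0 0"
      unfolding R.sub_monom sub_monom M2.scale_scale by (simp only: )
    also have "\<dots> = (emb_zpow (i + m) * fls_monom 1 0 (j + n)) \<odot> fls_monom (scale r v) 0 0"
      unfolding fls_monom_mult_monom M2.scale_scale[symmetric] monom_smult2_monom by simp
    finally show ?thesis unfolding monom_smult2_monom sub_monom by (rule sym)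
  qed
  have 2: "sub (f \<odot> fls_monom v m n) = R.sub f \<odot> sub (fls_monom v m n)" for f v m n
  proof (rule fls_fls_cont_ext[where \<Phi> = "\<lambda>f. sub (f \<odot> fls_monom v m n)" and
        \<Psi> = "\<lambda>f. R.sub f \<odot> sub (fls_monom v m n)"])
    show "fls_fls_cont (\<lambda>f. sub (f \<odot> fls_monom v m n))"
      by (rule fls_fls_cont_compose[OF cont_sub cont_smult2_left])
    show "fls_fls_cont (\<lambda>f. R.sub f \<odot> sub (fls_monom v m n))"
      by (rule fls_fls_cont_compose[OF cont_smult2_left R.cont_sub])
  qed (simp_all add: 1 R.sub_add sub_add M2.scale_left_distrib)
  show ?thesis
  proof (rule fls_fls_cont_ext[where \<Phi> = "\<lambda>H. sub (f \<odot> H)" and \<Psi> = "\<lambda>H. R.sub f \<odot> sub H"])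
    show "fls_fls_cont (\<lambda>H. sub (f \<odot> H))"
      by (rule fls_fls_cont_compose[OF cont_sub cont_smult2_right])
    show "fls_fls_cont (\<lambda>H. R.sub f \<odot> sub H)"
      by (rule fls_fls_cont_compose[OF cont_smult2_right cont_sub])
  qed (simp_all add: 2 sub_add M2.scale_right_distrib)
qed

lemma fls_nonneg_sub:
  assumes "fls_nonneg H" shows "fls_nonneg (sub H)"
  unfolding fls_nonneg_def
proof (intro allI impI coeff2_sub_eq_0)
  fix p q m n :: int assume pq: "p < 0 \<or> q < 0"
  show "coeff2 (emb_zpow m) p (q - n) = 0 \<or> coeff2 H m n = 0"
  proof (cases "m < 0 \<or> n < 0")
    case True
    then show ?thesis using assms by (auto simp: fls_nonneg_def)
  next
    case False
    then show ?thesis using fls_nonneg_emb_zpow[of m] pq by (auto simp: fls_nonneg_def)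
  qed
qed

end

section \<open>Invariance of the residue\<close>

text \<open>The derivative in the inner variable z; \<open>fps_deriv\<close> would differentiate in
  w.\<close>

definition fls_fps_deriv :: "'a::comm_ring_1 fls fps \<Rightarrow> 'a fls fps" where
  "fls_fps_deriv u = Abs_fps (\<lambda>n. fls_deriv (u $ n))"

lemma fls_fps_deriv_nth [simp]: "fls_fps_deriv u $ n = fls_deriv (u $ n)"
  by (simp add: fls_fps_deriv_def)

lemma fls_fps_deriv_add: "fls_fps_deriv (u + v) = fls_fps_deriv u + fls_fps_deriv v"
  by (rule fps_ext) simp

lemma fls_fps_deriv_minus: "fls_fps_deriv (- u) = - fls_fps_deriv u"
  by (rule fps_ext) simp

lemma fls_fps_deriv_mult:
  "fls_fps_deriv (u * v) = fls_fps_deriv u * v + u * fls_fps_deriv v"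
  by (rule fps_ext)
    (simp add: fps_mult_nth fls_deriv_sum sum.distrib add.commute)

lemma fls_fps_deriv_1 [simp]: "fls_fps_deriv 1 = 0"
  by (rule fps_ext) simp

lemma fls_fps_deriv_X_power [simp]: "fls_fps_deriv (fps_X ^ j) = 0"
  by (rule fps_ext) simp

lemma fls_fps_deriv_const: "fls_fps_deriv (fps_const f) = fps_const (fls_deriv f)"
  by (rule fps_ext) simp

section \<open>Logarithmic derivatives of series congruent to 1 modulo w\<close>

definition dlog_residue_free :: "'a::comm_ring_1 fls fps \<Rightarrow> bool" where
  "dlog_residue_free u \<longleftrightarrow> (\<exists>v. u * v = 1 \<and> (\<forall>n. (fls_fps_deriv u * v) $ n $$ (- 1) = 0))"

lemma dlog_residue_free_mult:
  assumes "dlog_residue_free u" "dlog_residue_free u'"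
  shows "dlog_residue_free (u * u')"
proof -
  obtain v v' where v: "u * v = 1" "\<And>n. (fls_fps_deriv u * v) $ n $$ (- 1) = 0"
    and v': "u' * v' = 1" "\<And>n. (fls_fps_deriv u' * v') $ n $$ (- 1) = 0"
    using assms unfolding dlog_residue_free_def by blast
  have "fls_fps_deriv (u * u') * (v * v') =
      (u' * v') * (fls_fps_deriv u * v) + (u * v) * (fls_fps_deriv u' * v')"
    unfolding fls_fps_deriv_mult by (simp only: algebra_simps)
  also have "\<dots> = fls_fps_deriv u * v + fls_fps_deriv u' * v'" by (simp add: v v')
  finally have "\<forall>n. (fls_fps_deriv (u * u') * (v * v')) $ n $$ (- 1) = 0"
    using v(2) v'(2) by simp
  moreover have "u * u' * (v * v') = 1"
  proof -
    have "u * u' * (v * v') = (u * v) * (u' * v')" by (simp only: mult_ac)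
    then show ?thesis by (simp add: v v')
  qed
  ultimately show ?thesis unfolding dlog_residue_free_def by blast
qed

lemma one_plus_X_power_inverse:
  fixes c :: "'a::comm_ring_1 fls"
  assumes "j \<ge> 1"
  obtains v where "(1 + fps_X ^ j * fps_const c) * v = 1"
    and "\<And>n. v $ n = (if n = 0 then 1 else 0) - (if n < j then 0 else c * v $ (n - j))"
    and "\<And>n. (fls_fps_deriv (1 + fps_X ^ j * fps_const c) * v) $ n =
           (if n < j then 0 else fls_deriv c * v $ (n - j))"
proof -
  define u where "u = 1 + fps_X ^ j * fps_const c"
  have "u $ 0 * 1 = 1" using assms by (simp add: u_def fps_X_power_mult_nth)
  then obtain v where v: "u * v = 1" using fps_right_inverse by blast
  then have "v + fps_X ^ j * (fps_const c * v) = 1" by (simp only: u_def distrib_right mult.assoc mult_1)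
  then have v_eq: "v = 1 - fps_X ^ j * (fps_const c * v)" by (simp only: eq_diff_eq)
  have 1: "v $ n = (if n = 0 then 1 else 0) - (if n < j then 0 else c * v $ (n - j))" for n
    by (rule trans[OF arg_cong[OF v_eq, of "\<lambda>x. x $ n"]]) (simp add: fps_X_power_mult_nth)
  have "fls_fps_deriv u * v = fps_X ^ j * (fps_const (fls_deriv c) * v)"
    by (simp add: u_def fls_fps_deriv_add fls_fps_deriv_mult fls_fps_deriv_const mult.assoc)
  then have "(fls_fps_deriv u * v) $ n = (if n < j then 0 else fls_deriv c * v $ (n - j))" for n
    by (simp add: fps_X_power_mult_nth)
  then show thesis using that[of v] v 1 unfolding u_def by blast
qed

definition fls_single :: "'a::zero \<Rightarrow> int \<Rightarrow> 'a fls" where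
  "fls_single a i = fls_shift (- i) (fls_const a)"

lemma fls_single_nth [simp]: "fls_single a i $$ n = (if n = i then a else 0)"
  by (simp add: fls_single_def)

lemma fls_single_mult_nth: "(fls_single a i * f) $$ p = a * f $$ (p - i)"
  for a :: "'a::comm_ring_1"
  by (simp add: fls_single_def fls_shifted_times_simps)

lemma fls_deriv_single: "fls_deriv (fls_single a i) = fls_single (of_int i * a) (i - 1)"
  by (rule fls_eqI) auto

text \<open>For u = 1 + t with t = a z^i w^j, the form du/u is i dz/z times a power series in t
  without constant term. A term t^k with k >= 1 has a residue only if i k = 0, that is i = 0, and
  then the factor i vanishes.\<close>

lemma dlog_residue_free_monomial:
  fixes a :: "'a::comm_ring_1"
  assumes j: "j \<ge> 1"
  shows "dlog_residue_free (1 + fps_X ^ j * fps_const (fls_single a i))"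
proof -
  obtain v where uv: "(1 + fps_X ^ j * fps_const (fls_single a i)) * v = 1"
    and v: "\<And>n. v $ n = (if n = 0 then 1 else 0) - (if n < j then 0 else fls_single a i * v $ (n - j))"
    and d: "\<And>n. (fls_fps_deriv (1 + fps_X ^ j * fps_const (fls_single a i)) * v) $ n =
           (if n < j then 0 else fls_deriv (fls_single a i) * v $ (n - j))"
    by (rule one_plus_X_power_inverse[OF j]) blast
  \<comment> \<open>\<open>v\<close> is a power series in \<open>z\<^sup>i w\<^sup>j\<close>\<close>
  have supp: "int j * p = i * int n" if "v $ n $$ p \<noteq> 0" for n p
    using that
  proof (induction n arbitrary: p rule: less_induct)
    case (less n)
    show ?case
    proof (cases "n < j")
      case True
      then show ?thesis using less.prems by (subst (asm) v) (auto split: if_splits)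
    next
      case False
      then have "v $ (n - j) $$ (p - i) \<noteq> 0"
        using less.prems j by (subst (asm) v) (auto simp: fls_single_mult_nth)
      then have "int j * (p - i) = i * int (n - j)" using less.IH[of "n - j"] j False by simp
      then show ?thesis using False by (simp add: of_nat_diff algebra_simps)
    qed
  qed
  have "(fls_fps_deriv (1 + fps_X ^ j * fps_const (fls_single a i)) * v) $ n $$ (- 1) = 0" for n
  proof (cases "n < j")
    case False
    have "of_int i * a * v $ (n - j) $$ (- i) = 0"
    proof (rule ccontr)
      assume nz: "of_int i * a * v $ (n - j) $$ (- i) \<noteq> 0"
      then have "v $ (n - j) $$ (- i) \<noteq> 0" by auto
      then have "int j * (- i) = i * int (n - j)" by (rule supp)
      then have "i * int n = 0" using False by (simp add: of_nat_diff algebra_simps)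
      then have "i = 0" using j False by simp
      then show False using nz by simp
    qed
    then show ?thesis using False by (simp add: d fls_deriv_single fls_single_mult_nth)
  qed (simp add: d)
  then show ?thesis using uv unfolding dlog_residue_free_def by blast
qed

lemma dlog_residue_free_regular:
  fixes b :: "'a::comm_ring_1 fls"
  assumes j: "j \<ge> 1" and b: "\<And>p. p < 0 \<Longrightarrow> b $$ p = 0"
  shows "dlog_residue_free (1 + fps_X ^ j * fps_const b)"
proof -
  obtain v where uv: "(1 + fps_X ^ j * fps_const b) * v = 1"
    and v: "\<And>n. v $ n = (if n = 0 then 1 else 0) - (if n < j then 0 else b * v $ (n - j))"
    and d: "\<And>n. (fls_fps_deriv (1 + fps_X ^ j * fps_const b) * v) $ n =
           (if n < j then 0 else fls_deriv b * v $ (n - j))"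
    by (rule one_plus_X_power_inverse[OF j]) blast
  have v0: "v $ n $$ p = 0" if "p < 0" for n p using that
  proof (induction n arbitrary: p rule: less_induct)
    case (less n)
    have "(b * v $ (n - j)) $$ p = 0" if "\<not> n < j"
      by (rule fls_mult_nth_eq_0[of 0 _ 0]) (use less j b that in auto)
    then show ?case using less.prems by (subst v) auto
  qed
  have "fls_deriv b $$ p = 0" if "p < 0" for p using b[of "p + 1"] that by (cases "p = - 1") auto
  then have "(fls_deriv b * v $ n) $$ (- 1) = 0" for n
    by (intro fls_mult_nth_eq_0[of 0 _ 0]) (use v0 in auto)
  then have "(fls_fps_deriv (1 + fps_X ^ j * fps_const b) * v) $ n $$ (- 1) = 0" for n
    by (simp only: d) simp
  then show ?thesis using uv unfolding dlog_residue_free_def by blast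
qed

text \<open>The set of possible b is closed under addition, as (1 + w^j f)(1 + w^j g) = 1 + w^j (f +
  g + w^j f g). It contains all monomials and all power series, and b is a finite polar part plus a
  power series.\<close>

lemma dlog_residue_free_leading_term:
  fixes b :: "'a::comm_ring_1 fls"
  assumes j: "j \<ge> 1"
  shows "\<exists>f. dlog_residue_free (1 + fps_X ^ j * f) \<and> f $ 0 = b"
proof -
  define G where "G b \<longleftrightarrow> (\<exists>f. dlog_residue_free (1 + fps_X ^ j * f) \<and> f $ 0 = b)" for b :: "'a fls"
  have add: "G (b + c)" if bc: "G b" "G c" for b c
  proof -
    obtain f g where fg: "dlog_residue_free (1 + fps_X ^ j * f)" "f $ 0 = b"
      "dlog_residue_free (1 + fps_X ^ j * g)" "g $ 0 = c"
      using bc unfolding G_def by blast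
    have "(1 + x * f) * (1 + x * g) = 1 + x * (f + g + x * (f * g))" for x
      by (simp add: algebra_simps)
    then have "(1 + fps_X ^ j * f) * (1 + fps_X ^ j * g) = 1 + fps_X ^ j * (f + g + fps_X ^ j * (f * g))" .
    moreover have "(f + g + fps_X ^ j * (f * g)) $ 0 = b + c"
      using j by (simp add: fg fps_X_power_mult_nth)
    ultimately show ?thesis using dlog_residue_free_mult[OF fg(1,3)] unfolding G_def by metis
  qed
  have reg: "G c" if "\<And>p. p < 0 \<Longrightarrow> c $$ p = 0" for c
    using dlog_residue_free_regular[OF j that] unfolding G_def by (metis fps_nth_fps_const)
  have mon: "G (fls_single a i)" for a i
    using dlog_residue_free_monomial[OF j] unfolding G_def by (metis fps_nth_fps_const)
  have "G (\<Sum>i\<in>A. fls_single (b $$ i) i)" if "finite A" for A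
    using that by induction (auto intro: add mon reg)
  then have "G (\<Sum>i\<in>{fls_subdegree b..-1}. fls_single (b $$ i) i)" by simp
  moreover have "G (b - (\<Sum>i\<in>{fls_subdegree b..-1}. fls_single (b $$ i) i))"
  proof (rule reg)
    fix p :: int assume "p < 0"
    have "(\<Sum>i\<in>{fls_subdegree b..-1}. fls_single (b $$ i) i $$ p) =
        (\<Sum>i\<in>{fls_subdegree b..-1}. if i = p then b $$ p else 0)"
      by (rule sum.cong) auto
    then show "(b - (\<Sum>i\<in>{fls_subdegree b..-1}. fls_single (b $$ i) i)) $$ p = 0"
      using \<open>p < 0\<close> by (simp add: fls_nth_sum)
  qed
  ultimately have "G b" using add by fastforce
  then show ?thesis unfolding G_def .
qed

text \<open>Over the rationals du/u = d(log u) would settle this. In general, divide u by a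
  residue-free factor e with the same leading term: this raises j by 1 and leaves the residue
  unchanged. Once j > n the coefficient of w^n is 0.\<close>

lemma dlog_residue:
  fixes u v f :: "'a::comm_ring_1 fls fps"
  assumes "j \<ge> 1" and "u = 1 + fps_X ^ j * f" and "u * v = 1"
  shows "(fls_fps_deriv u * v) $ n $$ (- 1) = 0"
  using assms
proof (induction "n + 1 - j" arbitrary: u v f j)
  case 0
  have "fls_fps_deriv u * v = fps_X ^ j * (fls_fps_deriv f * v)"
    by (simp add: 0 fls_fps_deriv_add fls_fps_deriv_mult mult.assoc)
  then show ?case using 0 by (simp add: fps_X_power_mult_nth)
next
  case (Suc k)
  obtain g where g: "dlog_residue_free (1 + fps_X ^ j * g)" "g $ 0 = f $ 0"
    using dlog_residue_free_leading_term[OF Suc.prems(1)] by blast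
  define e where "e = 1 + fps_X ^ j * g"
  obtain e' where e': "e * e' = 1" "\<And>n. (fls_fps_deriv e * e') $ n $$ (- 1) = 0"
    using g(1) unfolding dlog_residue_free_def e_def by blast
  define w where "w = u * e'"
  define h where "h = fps_shift 1 (f - g)"
  have fg: "f - g = fps_X * h" by (rule fps_ext) (auto simp: g(2) h_def)
  have "w = e * e' + fps_X ^ j * (f - g) * e'"
  proof -
    have "u = e + fps_X ^ j * (f - g)" by (simp add: Suc.prems(2) e_def right_diff_distrib)
    then show ?thesis by (simp only: w_def distrib_right)
  qed
  then have w: "w = 1 + fps_X ^ Suc j * (h * e')"
    by (simp only: e' fg power_Suc2 mult.assoc)
  have wev: "w * (e * v) = 1"
  proof -
    have "w * (e * v) = (e * e') * (u * v)" unfolding w_def by (simp only: mult_ac)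
    then show ?thesis by (simp only: e' Suc.prems(3) mult_1)
  qed
  have u: "u = e * w"
  proof -
    have "e * w = (e * e') * u" unfolding w_def by (simp only: mult_ac)
    then show ?thesis by (simp add: e')
  qed
  have "w * v = e'"
  proof -
    have "w * v = (u * v) * e'" unfolding w_def by (simp only: mult_ac)
    then show ?thesis by (simp only: Suc.prems(3) mult_1)
  qed
  moreover have "fls_fps_deriv u * v = fls_fps_deriv e * (w * v) + fls_fps_deriv w * (e * v)"
    unfolding u fls_fps_deriv_mult by (simp only: algebra_simps)
  ultimately have "fls_fps_deriv u * v = fls_fps_deriv e * e' + fls_fps_deriv w * (e * v)"
    by simp
  moreover have "(fls_fps_deriv w * (e * v)) $ n $$ (- 1) = 0"
  proof (rule Suc.hyps(1)[OF _ _ w wev])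
    show "k = n + 1 - Suc j" using Suc.hyps(2) by simp
  qed simp
  ultimately show ?case by (simp add: e')
qed

lemma inverse_fps_conv_geometric:
  fixes t v :: "'a::comm_ring_1"
  assumes "(1 - t) * v = 1"
  shows "v = (\<Sum>i<N. t ^ i) + t ^ N * v"
proof -
  have "(1 - t ^ N) * v = (\<Sum>i<N. t ^ i) * ((1 - t) * v)"
    by (simp only: one_diff_power_eq mult_ac)
  then have "v - t ^ N * v = (\<Sum>i<N. t ^ i)" unfolding assms by (simp add: left_diff_distrib)
  then show ?thesis by (simp only: diff_eq_eq)
qed

section \<open>Residues of powers of P and the change of variables formula\<close>

context fps_change
begin

text \<open>P = a u with a = P(z,0) and u = 1 modulo w. The residue of du/u is 0 and that of da/a is
  1, as a is z times a unit.\<close>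

lemma residue_log_derivative:
  assumes "fps_fls P * \<psi> = 1"
  shows "(fls_fps_deriv (fps_fls P) * \<psi>) $ n $$ (- 1) = (if n = 0 then 1 else 0)"
proof -
  define \<phi> where "\<phi> = fps_fls P"
  define a where "a = fps_to_fls (P $ 0)"
  obtain v where v: "a * (fls_X_inv * fps_to_fls v) = 1" "fps_shift 1 (P $ 0) * v = 1"
    using inverse_row_0 unfolding a_def by blast
  define y where "y = fls_X_inv * fps_to_fls v"
  define u where "u = fps_const y * \<phi>"
  have ay: "a * y = 1" using v(1) by (simp add: y_def)
  have \<phi>: "\<phi> = fps_const a * u" using ay by (simp add: u_def flip: mult.assoc)
  have inv: "u * (fps_const a * \<psi>) = 1"
  proof -
    have "u * (fps_const a * \<psi>) = fps_const (a * y) * (\<phi> * \<psi>)"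
      by (simp add: u_def mult_ac flip: fps_const_mult)
    then show ?thesis using assms by (simp add: ay \<phi>_def)
  qed
  have u\<psi>: "u * \<psi> = fps_const y" using assms by (simp add: u_def \<phi>_def mult.assoc)
  have "fls_fps_deriv \<phi> * \<psi> = fps_const (fls_deriv a) * (u * \<psi>) + fls_fps_deriv u * (fps_const a * \<psi>)"
    unfolding \<phi> fls_fps_deriv_mult fls_fps_deriv_const by (simp only: algebra_simps)
  also have "\<dots> = fps_const (fls_deriv a * y) + fls_fps_deriv u * (fps_const a * \<psi>)"
    by (simp add: u\<psi>)
  finally have eq: "fls_fps_deriv \<phi> * \<psi> = fps_const (fls_deriv a * y) + fls_fps_deriv u * (fps_const a * \<psi>)" .
  have u0: "u = 1 + fps_X ^ 1 * fps_shift 1 (u - 1)"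
  proof (rule fps_ext)
    fix n
    have "u $ 0 = 1" using ay by (simp add: u_def \<phi>_def a_def mult.commute)
    then show "u $ n = (1 + fps_X ^ 1 * fps_shift 1 (u - 1)) $ n" by (cases n) auto
  qed
  have "(fls_fps_deriv u * (fps_const a * \<psi>)) $ n $$ (- 1) = 0"
    by (rule dlog_residue[OF _ u0 inv]) simp
  moreover have "(fls_deriv a * y) $$ (- 1) = 1"
  proof -
    define r where "r = fps_shift 1 (P $ 0)"
    have "P $ 0 = fps_X * r" by (rule fps_ext) (auto simp: r_def P_00)
    then have "a = fls_X * fps_to_fls r" by (simp add: a_def fls_times_fps_to_fls)
    then have "fls_deriv a * y = (fls_X * fls_X_inv) * (fls_deriv (fps_to_fls r) * fps_to_fls v) +
       fls_X_inv * (fps_to_fls r * fps_to_fls v)"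
      by (simp add: y_def algebra_simps)
    also have "fls_X * fls_X_inv = (1 :: 'a fls)"
      by (simp add: fls_X_times_conv_shift fls_X_inv_conv_shift_1)
    also have "fps_to_fls r * fps_to_fls v = 1" using v(2) by (simp add: r_def flip: fls_times_fps_to_fls)
    finally show ?thesis
      by (simp add: fls_deriv_fps_to_fls flip: fls_times_fps_to_fls)
  qed
  ultimately show ?thesis using eq by (simp add: \<phi>_def)
qed

text \<open>Comparing coefficients in \<open>Res dlog (1 - w\<^sup>j/\<phi>) = 0\<close> for large \<open>j\<close> avoids dividing by \<open>k - 1\<close>.\<close>

lemma residue_negative_power:
  assumes "fps_fls P * \<psi> = 1" and "k \<ge> 2"
  shows "(fls_fps_deriv (fps_fls P) * \<psi> ^ k) $ n $$ (- 1) = 0"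
  using assms(2)
proof (induction k arbitrary: n rule: less_induct)
  case (less k)
  define \<phi> where "\<phi> = fps_fls P"
  \<comment> \<open>Expanding du/u geometrically gives the terms w^(j(i+1)) \<phi>' \<psi>^(i+2). In
    the coefficient of w^(n+jN) the index i = k - 2 yields the wanted residue and smaller i vanish
    by induction; j > n keeps out the remainder, which starts at w^(j(N+1)).\<close>
  define j where "j = n + 1"
  define N where "N = k - 1"
  define t where "t = fps_X ^ j * \<psi>"
  define u where "u = 1 + fps_X ^ j * (- \<psi>)"
  have u: "u = 1 - t" by (simp add: u_def t_def)
  have "u $ 0 * 1 = 1" by (simp add: u_def j_def fps_X_power_mult_nth)
  then obtain v where v: "u * v = 1" using fps_right_inverse by blast
  have "fls_fps_deriv (\<phi> * \<psi>) = 0" using assms(1) by (simp add: \<phi>_def)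
  then have "(\<phi> * \<psi>) * fls_fps_deriv \<psi> = - (fls_fps_deriv \<phi> * \<psi> ^ 2)"
    unfolding fls_fps_deriv_mult
    by (metis (no_types, lifting) add.commute add_eq_0_iff mult.assoc mult.commute mult_minus_left power2_eq_square)
  then have d\<psi>: "fls_fps_deriv \<psi> = - (fls_fps_deriv \<phi> * \<psi> ^ 2)"
    using assms(1) by (simp add: \<phi>_def)
  have du: "fls_fps_deriv u = fps_X ^ j * (fls_fps_deriv \<phi> * \<psi> ^ 2)"
    unfolding u_def fls_fps_deriv_add fls_fps_deriv_mult fls_fps_deriv_minus d\<psi> by simp
  have "fls_fps_deriv u * v = fls_fps_deriv u * ((\<Sum>i<N. t ^ i) + t ^ N * v)"
    using inverse_fps_conv_geometric[of t v N] v u by simp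
  also have "\<dots> = (\<Sum>i<N. fps_X ^ (j * (i + 1)) * (fls_fps_deriv \<phi> * \<psi> ^ (i + 2))) +
      fps_X ^ (j * (N + 1)) * (fls_fps_deriv \<phi> * \<psi> ^ (N + 2) * v)"
  proof -
    have "t ^ i = fps_X ^ (j * i) * \<psi> ^ i" for i by (simp add: t_def power_mult_distrib power_mult)
    then show ?thesis unfolding du distrib_left sum_distrib_left
      by (simp add: power_add power2_eq_square mult_ac)
  qed
  finally have "fls_fps_deriv u * v = \<dots>" .
  moreover have "(fls_fps_deriv u * v) $ (n + j * N) $$ (- 1) = 0"
    by (rule dlog_residue[OF _ u_def v]) (simp add: j_def)
  ultimately have "0 = (\<Sum>i<N. (fps_X ^ (j * (i + 1)) * (fls_fps_deriv \<phi> * \<psi> ^ (i + 2))) $ (n + j * N) $$ (- 1)) +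
      (fps_X ^ (j * (N + 1)) * (fls_fps_deriv \<phi> * \<psi> ^ (N + 2) * v)) $ (n + j * N) $$ (- 1)"
    by (simp add: fps_sum_nth fls_nth_sum)
  also have "(fps_X ^ (j * (N + 1)) * (fls_fps_deriv \<phi> * \<psi> ^ (N + 2) * v)) $ (n + j * N) $$ (- 1) = 0"
  proof -
    have "n + j * N < j * (N + 1)" by (simp add: j_def)
    then show ?thesis unfolding fps_X_power_mult_nth by simp
  qed
  also have "(\<Sum>i<N. (fps_X ^ (j * (i + 1)) * (fls_fps_deriv \<phi> * \<psi> ^ (i + 2))) $ (n + j * N) $$ (- 1)) =
     (\<Sum>i\<in>{k - 2}. (fps_X ^ (j * (i + 1)) * (fls_fps_deriv \<phi> * \<psi> ^ (i + 2))) $ (n + j * N) $$ (- 1))"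
  proof (rule sum.mono_neutral_right)
    show "{k - 2} \<subseteq> {..<N}" using less.prems by (auto simp: N_def)
    show "\<forall>i\<in>{..<N} - {k - 2}. (fps_X ^ (j * (i + 1)) * (fls_fps_deriv \<phi> * \<psi> ^ (i + 2))) $ (n + j * N) $$ (- 1) = 0"
    proof
      fix i assume "i \<in> {..<N} - {k - 2}"
      then have "(fls_fps_deriv \<phi> * \<psi> ^ (i + 2)) $ l $$ (- 1) = 0" for l
        unfolding \<phi>_def by (intro less.IH) (auto simp: N_def)
      then show "(fps_X ^ (j * (i + 1)) * (fls_fps_deriv \<phi> * \<psi> ^ (i + 2))) $ (n + j * N) $$ (- 1) = 0"
        unfolding fps_X_power_mult_nth by simp
    qed
  qed simp
  also have "\<dots> = (fls_fps_deriv \<phi> * \<psi> ^ k) $ n $$ (- 1)"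
  proof -
    have "k - 2 + 1 = N" "k - 2 + 2 = k" using less.prems by (auto simp: N_def)
    then show ?thesis by (simp add: fps_X_power_mult_nth)
  qed
  finally show ?case by (simp add: \<phi>_def)
qed

definition emb_deriv :: "'a fls fls" where
  "emb_deriv = emb (Abs_fps (\<lambda>n. fps_deriv (P $ n)))"

text \<open>A nonnegative power has no pole, and the power -1 gives the logarithmic derivative.
  Lower powers are those that one would integrate to P^(m+1)/(m+1) over the rationals.\<close>

lemma residue_emb_zpow: "coeff2 (emb_deriv * emb_zpow m) (- 1) q = (if m = - 1 \<and> q = 0 then 1 else 0)"
proof -
  obtain \<psi> where \<psi>: "fps_fls P * \<psi> = 1" using inverse_exists by blast
  have emb_deriv: "emb_deriv = fps_to_fls (fls_fps_deriv (fps_fls P))"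
    unfolding emb_deriv_def by (rule arg_cong[of _ _ fps_to_fls], rule fps_ext) (simp add: fls_deriv_fps_to_fls)
  show ?thesis
  proof (cases "0 \<le> m")
    case True
    then have "emb_zpow m = emb (P ^ nat m)" by (simp add: emb_zpow_def ring_zpow_nonneg emb_power)
    then have "fls_nonneg (emb_deriv * emb_zpow m)" unfolding emb_deriv_def by (simp flip: emb_mult)
    then show ?thesis using True by (simp add: fls_nonneg_def)
  next
    case False
    have "emb P * fps_to_fls \<psi> = 1" using \<psi> by (simp flip: fls_times_fps_to_fls)
    then have "emb_zpow m = fps_to_fls (\<psi> ^ nat (- m))"
      using False by (simp add: emb_zpow_def ring_zpow_neg fps_to_fls_power)
    then have *: "emb_deriv * emb_zpow m = fps_to_fls (fls_fps_deriv (fps_fls P) * \<psi> ^ nat (- m))"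
      by (simp add: emb_deriv fls_times_fps_to_fls)
    show ?thesis
    proof (cases "m = - 1")
      case True
      then show ?thesis unfolding * using residue_log_derivative[OF \<psi>, of "nat q"] by auto
    next
      case ne: False
      then have "nat (- m) \<ge> 2" using False by linarith
      then show ?thesis using residue_negative_power[OF \<psi>, of "nat (- m)" "nat q"] ne by (simp add: *)
    qed
  qed
qed

end

context fls_substitution
begin

text \<open>Both sides are additive and continuous in H, so monomials suffice; there v passes
  through and \<open>residue_emb_zpow\<close> applies.\<close>

lemma residue_sub: "coeff2 (emb_deriv \<odot> sub H) (- 1) n = coeff2 H (- 1) n"
proof (rule fls_fls_ext[where \<Phi> = "\<lambda>H. coeff2 (emb_deriv \<odot> sub H) (- 1) n" and \<Psi> = "\<lambda>H. coeff2 H (- 1) n"])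
  fix v i j
  have "emb_deriv \<odot> sub (fls_monom v i j) = (fls_monom 1 0 j * (emb_deriv * emb_zpow i)) \<odot> fls_monom v 0 0"
    by (simp add: sub_monom mult_ac)
  then have "coeff2 (emb_deriv \<odot> sub (fls_monom v i j)) (- 1) n = scale (coeff2 (emb_deriv * emb_zpow i) (- 1) (n - j)) v"
    by (simp add: coeff2_smult2_monom coeff2_monom_mult)
  then show "coeff2 (emb_deriv \<odot> sub (fls_monom v i j)) (- 1) n = coeff2 (fls_monom v i j) (- 1) n"
    by (auto simp: residue_emb_zpow)
next
  fix L
  have "fls_fls_cont (\<lambda>H. emb_deriv \<odot> sub H)" by (rule fls_fls_cont_compose[OF cont_smult2_right cont_sub])
  then obtain Q T where "\<And>H. outer_ge L H \<Longrightarrow> vanish Q T H \<Longrightarrow> vanish n (- 1) (emb_deriv \<odot> sub H)"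
    unfolding fls_fls_cont_def by metis
  then have "coeff2 (emb_deriv \<odot> sub H) (- 1) n = coeff2 H (- 1) n" if "outer_ge L H \<and> vanish (max Q n) (max T (- 1)) H" for H
    using that by (simp add: vanish_def)
  then show "\<exists>Q T. \<forall>H. outer_ge L H \<and> vanish Q T H \<longrightarrow> coeff2 (emb_deriv \<odot> sub H) (- 1) n = coeff2 H (- 1) n"
    by blast
qed (simp_all add: sub_add M2.scale_right_distrib)

text \<open>The assumption is invariance, up to the factor s, of the form f dz under the
  substitution of P(z,w) for z. It is used with f = p_F and s = 1 or -1.\<close>

lemma residue_sub_weighted:
  assumes "f = fls_monom s 0 0 * (emb_deriv * fls_subst (*) P f)"
  shows "coeff2 (f \<odot> sub H) (- 1) n = scale s (coeff2 (f \<odot> H) (- 1) n)"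
proof -
  have "f \<odot> sub H = fls_monom s 0 0 \<odot> (emb_deriv \<odot> sub (f \<odot> H))"
    by (subst assms) (simp add: sub_smult2 mult.assoc)
  then show ?thesis by (simp only: coeff2_monom_smult2 residue_sub diff_zero)
qed

end

section \<open>Substitution into power series in two variables\<close>

definition fps_tdeg_ge :: "nat \<Rightarrow> 'a::zero fps fps \<Rightarrow> bool" where
  "fps_tdeg_ge d f \<longleftrightarrow> (\<forall>i j. i + j < d \<longrightarrow> f $ j $ i = 0)"

lemma fps_tdeg_geD: "fps_tdeg_ge d f \<Longrightarrow> i + j < d \<Longrightarrow> f $ j $ i = 0"
  by (simp add: fps_tdeg_ge_def)

lemma fps_tdeg_ge_0 [simp]: "fps_tdeg_ge 0 f"
  by (simp add: fps_tdeg_ge_def)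

lemma fps_tdeg_ge_zero [simp]: "fps_tdeg_ge d 0"
  by (simp add: fps_tdeg_ge_def)

lemma fps_fps_mult_nth:
  "(f * g) $ j $ i = (\<Sum>l=0..j. \<Sum>k=0..i. f $ l $ k * g $ (j - l) $ (i - k))"
  for f g :: "'a::comm_ring_1 fps fps"
  by (simp add: fps_mult_nth fps_sum_nth)

lemma fps_tdeg_ge_mult:
  fixes f g :: "'a::comm_ring_1 fps fps"
  assumes "fps_tdeg_ge d f" "fps_tdeg_ge e g"
  shows "fps_tdeg_ge (d + e) (f * g)"
  unfolding fps_tdeg_ge_def fps_fps_mult_nth
proof (intro allI impI sum.neutral ballI)
  fix i j l k assume ij: "i + j < d + e" and lk: "l \<in> {0..j}" "k \<in> {0..i}"
  show "f $ l $ k * g $ (j - l) $ (i - k) = 0"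
  proof (cases "k + l < d")
    case True
    then show ?thesis using fps_tdeg_geD[OF assms(1)] by simp
  next
    case False
    then have "i - k + (j - l) < e" using ij lk by auto
    then show ?thesis using fps_tdeg_geD[OF assms(2)] by simp
  qed
qed

lemma fps_tdeg_ge_power:
  fixes f :: "'a::comm_ring_1 fps fps"
  assumes "fps_tdeg_ge 1 f" shows "fps_tdeg_ge n (f ^ n)"
  by (induction n) (use fps_tdeg_ge_mult[OF assms] in simp_all)

definition fps_monom :: "'a::comm_ring_1 \<Rightarrow> nat \<Rightarrow> nat \<Rightarrow> 'a fps fps" where
  "fps_monom r m n = fps_const (fps_const r * fps_X ^ m) * fps_X ^ n"

lemma fps_monom_nth [simp]: "fps_monom r m n $ j $ i = (if i = m \<and> j = n then r else 0)"
  by (simp add: fps_monom_def fps_X_power_mult_right_nth)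

text \<open>The counterpart of \<open>fls_fls_ext\<close> for power series: modulo total degree T, a
  power series is a finite sum of monomials.\<close>

lemma fps_fps_ext:
  fixes \<Phi> \<Psi> :: "'a::comm_ring_1 fps fps \<Rightarrow> 'w::ab_group_add"
  assumes add: "\<And>x y. \<Phi> (x + y) = \<Phi> x + \<Phi> y" "\<And>x y. \<Psi> (x + y) = \<Psi> x + \<Psi> y"
    and tail: "\<And>f. fps_tdeg_ge T f \<Longrightarrow> \<Phi> f = \<Psi> f"
    and monom: "\<And>r m n. \<Phi> (fps_monom r m n) = \<Psi> (fps_monom r m n)"
  shows "\<Phi> f = \<Psi> f"
proof -
  interpret P: additive \<Phi> by unfold_locales (rule add)
  interpret Q: additive \<Psi> by unfold_locales (rule add)
  define f' where "f' = (\<Sum>(m,n)\<in>{..T}\<times>{..T}. fps_monom (f $ n $ m) m n)"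
  have "f' $ j $ i = (\<Sum>x\<in>{..T}\<times>{..T}. if x = (i,j) then f $ j $ i else 0)" for i j
    unfolding f'_def fps_sum_nth by (rule sum.cong) (auto split: if_splits)
  then have "fps_tdeg_ge T (f - f')" by (auto simp: fps_tdeg_ge_def)
  then have "\<Phi> (f - f') = \<Psi> (f - f')" by (rule tail)
  moreover have "\<Phi> f' = \<Psi> f'"
    unfolding f'_def P.sum Q.sum by (rule sum.cong) (auto simp: monom)
  ultimately show ?thesis by (simp add: P.diff Q.diff)
qed

section \<open>Evaluation of a power series at two series without constant term\<close>

definition fps_fps_subst :: "'a::comm_ring_1 fps fps \<Rightarrow> 'a fps fps \<Rightarrow> 'a fps fps \<Rightarrow> 'a fps fps" where
  "fps_fps_subst a b f =
     Abs_fps (\<lambda>j. Abs_fps (\<lambda>i. Sum_any (\<lambda>(m,n). f $ n $ m * (a ^ m * b ^ n) $ j $ i)))"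

locale fps_fps_hom =
  fixes a b :: "'a::comm_ring_1 fps fps"
  assumes a: "fps_tdeg_ge 1 a" and b: "fps_tdeg_ge 1 b"
begin

abbreviation ev :: "'a fps fps \<Rightarrow> 'a fps fps" where
  "ev \<equiv> fps_fps_subst a b"

lemma power_mult_nth_eq_0: "i + j < m + n \<Longrightarrow> (a ^ m * b ^ n) $ j $ i = 0"
  using fps_tdeg_geD[OF fps_tdeg_ge_mult[OF fps_tdeg_ge_power[OF a] fps_tdeg_ge_power[OF b]]] .

lemma ev_nth:
  assumes "i + j \<le> T"
  shows "ev f $ j $ i = (\<Sum>(m,n)\<in>{..T}\<times>{..T}. f $ n $ m * (a ^ m * b ^ n) $ j $ i)"
  unfolding fps_fps_subst_def fps_nth_Abs_fps
proof (rule Sum_any.expand_superset)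
  show "{x. (case x of (m, n) \<Rightarrow> f $ n $ m * (a ^ m * b ^ n) $ j $ i) \<noteq> 0} \<subseteq> {..T} \<times> {..T}"
  proof
    fix x assume "x \<in> {x. (case x of (m, n) \<Rightarrow> f $ n $ m * (a ^ m * b ^ n) $ j $ i) \<noteq> 0}"
    then obtain m n where "x = (m, n)" "f $ n $ m * (a ^ m * b ^ n) $ j $ i \<noteq> 0"
      by (cases x) auto
    then have "x = (m, n)" "(a ^ m * b ^ n) $ j $ i \<noteq> 0" by auto
    then show "x \<in> {..T} \<times> {..T}" using power_mult_nth_eq_0[of i j m n] assms by fastforce
  qed
qed simp

lemma ev_add: "ev (f + g) = ev f + ev g"
  by (intro fps_ext) (simp add: ev_nth[OF order_refl] case_prod_unfold sum.distrib distrib_right)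

lemma ev_tdeg: "fps_tdeg_ge d f \<Longrightarrow> fps_tdeg_ge d (ev f)"
  unfolding fps_tdeg_ge_def[of d "ev f"]
proof (intro allI impI)
  fix i j assume *: "fps_tdeg_ge d f" "i + j < d"
  have "f $ n $ m * (a ^ m * b ^ n) $ j $ i = 0" for m n
    using fps_tdeg_geD[OF *(1), of m n] power_mult_nth_eq_0[of i j m n] *(2) by (cases "m + n < d") auto
  then show "ev f $ j $ i = 0" by (simp add: ev_nth[OF order_refl])
qed

lemma ev_monom: "ev (fps_monom r m n) = fps_const (fps_const r) * (a ^ m * b ^ n)"
proof (intro fps_ext)
  fix i j
  define B where "B = {..i + j + m + n}"
  have "ev (fps_monom r m n) $ j $ i =
     (\<Sum>(m',n')\<in>B\<times>B. fps_monom r m n $ n' $ m' * (a ^ m' * b ^ n') $ j $ i)"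
    unfolding B_def by (rule ev_nth) simp
  also have "\<dots> = (\<Sum>x\<in>B\<times>B. if x = (m, n) then r * (a ^ m * b ^ n) $ j $ i else 0)"
    by (rule sum.cong) (auto split: if_splits)
  also have "\<dots> = r * (a ^ m * b ^ n) $ j $ i" by (simp add: B_def)
  finally show "ev (fps_monom r m n) $ j $ i = (fps_const (fps_const r) * (a ^ m * b ^ n)) $ j $ i"
    by simp
qed

lemma ev_mult: "ev (f * g) = ev f * ev g"
proof (intro fps_ext)
  fix i j
  have tail: "ev (f * g) $ j $ i = (ev f * ev g) $ j $ i" if "fps_tdeg_ge (i + j + 1) f \<or> fps_tdeg_ge (i + j + 1) g" for f g
  proof -
    have "fps_tdeg_ge (i + j + 1) (f * g)" "fps_tdeg_ge (i + j + 1) (ev f * ev g)"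
      using that fps_tdeg_ge_mult[of "i + j + 1" _ 0] fps_tdeg_ge_mult[of 0 _ "i + j + 1"] ev_tdeg by fastforce+
    then show ?thesis using ev_tdeg[of "i + j + 1" "f * g"] by (simp add: fps_tdeg_ge_def)
  qed
  have 1: "ev (fps_monom r m n * fps_monom s k l) = ev (fps_monom r m n) * ev (fps_monom s k l)" for r s m n k l
  proof -
    have "fps_monom r m n * fps_monom s k l = fps_monom (r * s) (m + k) (n + l)"
      by (simp add: fps_monom_def power_add mult_ac flip: fps_const_mult)
    then show ?thesis by (simp add: ev_monom power_add mult_ac flip: fps_const_mult)
  qed
  have 2: "ev (f * fps_monom s k l) $ j $ i = (ev f * ev (fps_monom s k l)) $ j $ i" for f s k l
    by (rule fps_fps_ext[where \<Phi> = "\<lambda>f. ev (f * fps_monom s k l) $ j $ i" and T = "i + j + 1"])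
      (use tail 1 in \<open>simp_all add: ev_add distrib_right\<close>)
  show "ev (f * g) $ j $ i = (ev f * ev g) $ j $ i"
    by (rule fps_fps_ext[where \<Phi> = "\<lambda>g. ev (f * g) $ j $ i" and T = "i + j + 1"])
      (use tail 2 in \<open>simp_all add: ev_add distrib_left\<close>)
qed

lemma ev_const_const: "ev (fps_const (fps_const r)) = fps_const (fps_const r)"
  using ev_monom[of r 0 0] by (simp add: fps_monom_def)

lemma ev_1: "ev 1 = 1"
  using ev_const_const[of 1] by simp

lemma ev_0: "ev 0 = 0"
  using ev_const_const[of 0] by simp

lemma ev_power: "ev (f ^ n) = ev f ^ n"
  by (induction n) (simp_all add: ev_1 ev_mult)

lemma ev_z: "ev (fps_const fps_X) = a"
  using ev_monom[of 1 1 0] by (simp add: fps_monom_def)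

lemma ev_w: "ev fps_X = b"
  using ev_monom[of 1 0 1] by (simp add: fps_monom_def)

text \<open>With c a power of one series, this expands products such as A^m F(B,C)^n into powers of
  A, B and C, as needed for associativity of the group operation.\<close>

lemma mult_ev_nth:
  "(c * ev f) $ j $ i =
     (\<Sum>(m,n)\<in>{..i + j}\<times>{..i + j}. f $ n $ m * (c * (a ^ m * b ^ n)) $ j $ i)"
proof (rule fps_fps_ext[where T = "i + j + 1" and \<Phi> = "\<lambda>f. (c * ev f) $ j $ i" and
      \<Psi> = "\<lambda>f. \<Sum>(m,n)\<in>{..i + j}\<times>{..i + j}. f $ n $ m * (c * (a ^ m * b ^ n)) $ j $ i"])
  fix f :: "'a fps fps" assume f: "fps_tdeg_ge (i + j + 1) f"
  have "fps_tdeg_ge (i + j + 1) (c * ev f)"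
    using fps_tdeg_ge_mult[OF fps_tdeg_ge_0 ev_tdeg[OF f]] by simp
  then have "(c * ev f) $ j $ i = 0" by (simp add: fps_tdeg_ge_def)
  moreover have "f $ n $ m * (c * (a ^ m * b ^ n)) $ j $ i = 0" for m n
  proof (cases "m + n \<le> i + j")
    case True
    then show ?thesis using f by (simp add: fps_tdeg_ge_def)
  next
    case False
    have "fps_tdeg_ge (0 + (m + n)) (c * (a ^ m * b ^ n))"
      by (intro fps_tdeg_ge_mult fps_tdeg_ge_power a b fps_tdeg_ge_0)
    then show ?thesis using False by (simp add: fps_tdeg_ge_def)
  qed
  ultimately show "(c * ev f) $ j $ i =
     (\<Sum>(m,n)\<in>{..i + j}\<times>{..i + j}. f $ n $ m * (c * (a ^ m * b ^ n)) $ j $ i)" by simp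
next
  fix r m n
  have "(c * ev (fps_monom r m n)) $ j $ i = r * (c * (a ^ m * b ^ n)) $ j $ i"
  proof -
    have "c * ev (fps_monom r m n) = fps_const (fps_const r) * (c * (a ^ m * b ^ n))"
      by (simp add: ev_monom mult_ac)
    then show ?thesis by simp
  qed
  moreover have "(c * (a ^ m * b ^ n)) $ j $ i = 0" if "\<not> (m \<le> i + j \<and> n \<le> i + j)"
  proof -
    have "fps_tdeg_ge (0 + (m + n)) (c * (a ^ m * b ^ n))"
      by (intro fps_tdeg_ge_mult fps_tdeg_ge_power a b fps_tdeg_ge_0)
    then show ?thesis using that by (auto simp: fps_tdeg_ge_def)
  qed
  moreover have "(\<Sum>(m',n')\<in>{..i + j}\<times>{..i + j}. fps_monom r m n $ n' $ m' * (c * (a ^ m' * b ^ n')) $ j $ i)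
     = (\<Sum>x\<in>{..i + j}\<times>{..i + j}. if x = (m, n) then r * (c * (a ^ m * b ^ n)) $ j $ i else 0)"
    by (rule sum.cong) (auto split: if_splits)
  ultimately show "(c * ev (fps_monom r m n)) $ j $ i = (\<Sum>(m',n')\<in>{..i + j}\<times>{..i + j}.
      fps_monom r m n $ n' $ m' * (c * (a ^ m' * b ^ n')) $ j $ i)" by auto
qed (simp_all add: ev_add distrib_left distrib_right case_prod_unfold sum.distrib)

lemma ev_const_nth: "i + j \<le> T \<Longrightarrow> ev (fps_const f) $ j $ i = (\<Sum>m\<le>T. f $ m * (a ^ m) $ j $ i)"
proof -
  assume T: "i + j \<le> T"
  have "ev (fps_const f) $ j $ i = (\<Sum>m\<le>T. \<Sum>n\<le>T. if n = 0 then f $ m * (a ^ m) $ j $ i else 0)"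
    unfolding ev_nth[OF T] sum.cartesian_product[symmetric] by (intro sum.cong) auto
  then show ?thesis by simp
qed

lemma ev_comp:
  assumes "fps_tdeg_ge 1 c" "fps_tdeg_ge 1 d"
  shows "ev (fps_fps_subst c d f) = fps_fps_subst (ev c) (ev d) f"
proof (intro fps_ext)
  fix i j
  interpret CD: fps_fps_hom c d by unfold_locales (fact assms)+
  interpret E: fps_fps_hom "ev c" "ev d" by unfold_locales (intro ev_tdeg assms)+
  show "ev (CD.ev f) $ j $ i = E.ev f $ j $ i"
  proof (rule fps_fps_ext[where T = "i + j + 1" and \<Phi> = "\<lambda>f. ev (CD.ev f) $ j $ i" and
        \<Psi> = "\<lambda>f. E.ev f $ j $ i"])
    fix f :: "'a fps fps" assume f: "fps_tdeg_ge (i + j + 1) f"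
    show "ev (CD.ev f) $ j $ i = E.ev f $ j $ i"
      using ev_tdeg[OF CD.ev_tdeg[OF f]] E.ev_tdeg[OF f] by (simp add: fps_tdeg_ge_def)
  qed (simp_all add: ev_add CD.ev_add E.ev_add CD.ev_monom E.ev_monom ev_mult ev_power ev_const_const)
qed

end

definition fps_transpose :: "'a fps fps \<Rightarrow> 'a fps fps" where
  "fps_transpose f = Abs_fps (\<lambda>j. Abs_fps (\<lambda>i. f $ i $ j))"

lemma fps_transpose_nth [simp]: "fps_transpose f $ j $ i = f $ i $ j"
  by (simp add: fps_transpose_def)

lemma fps_transpose_mult: "fps_transpose (f * g) = fps_transpose f * fps_transpose g"
  for f :: "'a::comm_ring_1 fps fps"
  by (intro fps_ext, simp add: fps_fps_mult_nth) (subst sum.swap, rule refl)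

lemma fps_transpose_1 [simp]: "fps_transpose 1 = 1"
  by (intro fps_ext) simp

lemma fps_transpose_power: "fps_transpose (f ^ n) = fps_transpose f ^ n"
  for f :: "'a::comm_ring_1 fps fps"
  by (induction n) (simp_all add: fps_transpose_mult)

lemma (in fps_fps_hom) ev_z_w: "a = fps_const fps_X \<Longrightarrow> b = fps_X \<Longrightarrow> ev f = f"
proof (intro fps_ext)
  fix i j assume ab: "a = fps_const fps_X" "b = fps_X"
  have monom: "ev (fps_monom r m n) = fps_monom r m n" for r m n
    unfolding ev_monom unfolding ab fps_monom_def
    by (simp only: fps_const_mult[symmetric] fps_const_power[symmetric] mult.assoc)
  have tail: "ev f $ j $ i = f $ j $ i" if "fps_tdeg_ge (i + j + 1) f" for f
    using that ev_tdeg[OF that] by (simp add: fps_tdeg_ge_def)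
  show "ev f $ j $ i = f $ j $ i"
    by (rule fps_fps_ext[where \<Phi> = "\<lambda>f. ev f $ j $ i" and \<Psi> = "\<lambda>f. f $ j $ i", OF _ _ tail])
      (simp_all add: ev_add monom)
qed

lemma (in fps_change) tdeg_P: "fps_tdeg_ge 1 P"
  by (auto simp: fps_tdeg_ge_def P_00)

lemma fps_tdeg_ge_z: "fps_tdeg_ge 1 (fps_const fps_X)"
  and fps_tdeg_ge_w: "fps_tdeg_ge 1 fps_X"
  by (auto simp: fps_tdeg_ge_def)

lemmas [simp] = fps_tdeg_ge_z[unfolded One_nat_def] fps_tdeg_ge_w[unfolded One_nat_def]

lemma emb_monom: "emb (fps_monom r m n) = fls_monom r (int m) (int n)"
  by (rule fls_fls_eqI) auto

text \<open>On power series the two notions of substitution agree, so identities for the formal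
  group law carry over to iterated Laurent series.\<close>

lemma (in fps_change) subst_emb: "fls_subst (*) P (emb f) = emb (fps_fps_subst P fps_X f)"
proof (rule fls_fls_eqI)
  fix p q
  interpret fls_substitution "(*)" P
    rewrites "fls_smult (*) = ((*) :: 'a fls \<Rightarrow> _)" and "fls_smult (*) = ((*) :: 'a fls fls \<Rightarrow> _)"
    by (intro fls_substitution.intro laurent_module_mult fps_change_axioms) (simp_all add: fls_smult_times)
  interpret E: fps_fps_hom P fps_X by unfold_locales (rule tdeg_P fps_tdeg_ge_w)+
  show "coeff2 (sub (emb f)) p q = coeff2 (emb (E.ev f)) p q"
  proof (rule fps_fps_ext[where T = "nat p + nat q + 1" and \<Phi> = "\<lambda>f. coeff2 (sub (emb f)) p q" and
        \<Psi> = "\<lambda>f. coeff2 (emb (E.ev f)) p q"])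
    fix f :: "'a fps fps" assume f: "fps_tdeg_ge (nat p + nat q + 1) f"
    have "coeff2 (sub (emb f)) p q = 0"
    proof (rule coeff2_sub_eq_0)
      fix m n
      show "coeff2 (emb_zpow m) p (q - n) = 0 \<or> coeff2 (emb f) m n = 0"
      proof (cases "p + (q - n) < m")
        case False
        then have "m \<ge> 0 \<and> n \<ge> 0 \<longrightarrow> nat m + nat n < nat p + nat q + 1" by linarith
        then show ?thesis using f by (auto simp: fps_tdeg_ge_def)
      qed (simp add: coeff2_emb_zpow_eq_0)
    qed
    then show "coeff2 (sub (emb f)) p q = coeff2 (emb (E.ev f)) p q"
      using E.ev_tdeg[OF f] by (simp add: fps_tdeg_ge_def)
  next
    fix r m n
    have "sub (emb (fps_monom r m n)) = emb P ^ m * fls_monom 1 0 (int n) * fls_monom r 0 0"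
      by (simp add: emb_monom sub_monom emb_zpow_of_nat)
    also have "\<dots> = emb (P ^ m * fps_monom 1 0 n * fps_monom r 0 0)"
      by (simp add: emb_mult emb_power emb_monom)
    also have "P ^ m * fps_monom 1 0 n * fps_monom r 0 0 = E.ev (fps_monom r m n)"
      unfolding E.ev_monom by (simp add: fps_monom_def mult_ac)
    finally show "coeff2 (sub (emb (fps_monom r m n))) p q = coeff2 (emb (E.ev (fps_monom r m n))) p q" by simp
  qed (simp_all add: emb_add sub_add E.ev_add)
qed

section \<open>Formal group laws\<close>

text \<open>Series in z alone are treated as series in z and w, so that only one evaluation map has
  to be studied.\<close>

lemma fps_subst1_const:
  "fps_fps_subst (fps_const a) (fps_const b) f = fps_const (fps_subst1 f a b)"
proof (intro fps_ext)
  fix j i :: nat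
  show "fps_fps_subst (fps_const a) (fps_const b) f $ j $ i = fps_const (fps_subst1 f a b) $ j $ i"
    by (cases j) (simp_all add: fps_fps_subst_def fps_subst1_def case_prod_unfold)
qed

lemma fps_power_nth_0: "(f ^ n) $ 0 = (f $ 0) ^ n" for f :: "'a::comm_ring_1 fps"
  by (induction n) simp_all

definition fps_agree :: "nat \<Rightarrow> 'a::zero fps \<Rightarrow> 'a fps \<Rightarrow> bool" where
  "fps_agree k g h \<longleftrightarrow> (\<forall>i<k. g $ i = h $ i)"

lemma fps_agree_mult: "fps_agree k g h \<Longrightarrow> fps_agree k g' h' \<Longrightarrow> fps_agree k (g * g') (h * h')"
  for g :: "'a::comm_ring_1 fps"
  by (auto simp: fps_agree_def fps_mult_nth intro!: sum.cong)

lemma fps_agree_power: "fps_agree k g h \<Longrightarrow> fps_agree k (g ^ n) (h ^ n)"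
  for g :: "'a::comm_ring_1 fps"
  by (induction n) (simp add: fps_agree_def, simp add: fps_agree_mult)

lemma fps_agree_subst1: "fps_agree k g h \<Longrightarrow> fps_agree k (fps_subst1 f a g) (fps_subst1 f a h)"
proof -
  assume gh: "fps_agree k g h"
  have "(a ^ m * g ^ n) $ i = (a ^ m * h ^ n) $ i" if "i < k" for m n i
    using fps_agree_mult[OF _ fps_agree_power[OF gh], of "a ^ m" "a ^ m" n] that
    by (simp add: fps_agree_def)
  then show ?thesis by (simp add: fps_agree_def fps_subst1_def case_prod_unfold)
qed

text \<open>The iterates of a z-adic contraction stabilise coefficient by coefficient; g is their
  diagonal.\<close>

lemma fps_contraction_fixpoint:
  assumes contr: "\<And>k g h. fps_agree k g h \<Longrightarrow> fps_agree (Suc k) (\<Phi> g) (\<Phi> h)"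
  obtains g :: "'a::zero fps" where "\<Phi> g = g"
proof
  define it where "it k = (\<Phi> ^^ k) 0" for k
  define g where "g = Abs_fps (\<lambda>n. it (Suc n) $ n)"
  have step: "fps_agree k (it k) (it (Suc k))" for k
    by (induction k) (simp add: fps_agree_def, use contr in \<open>simp add: it_def\<close>)
  have stable: "it (Suc i + d) $ i = it (Suc i) $ i" for i d
  proof (induction d)
    case (Suc d)
    have "it (Suc i + d) $ i = it (Suc (Suc i + d)) $ i"
      using step[of "Suc i + d"] unfolding fps_agree_def by simp
    then show ?case using Suc by simp
  qed simp
  have diag: "g $ i = it k $ i" if "i < k" for i k
  proof -
    from that obtain d where "k = Suc i + d" by (metis add_Suc less_imp_Suc_add)
    then show ?thesis by (simp only: stable g_def fps_nth_Abs_fps)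
  qed
  have g: "fps_agree k g (it k)" for k using diag unfolding fps_agree_def by blast
  show "\<Phi> g = g"
  proof (rule fps_ext)
    fix n
    have "fps_agree (Suc (Suc n)) (\<Phi> g) (it (Suc (Suc n)))" using contr[OF g[of "Suc n"]] by (simp add: it_def)
    then show "\<Phi> g $ n = g $ n" using g[of "Suc (Suc n)"] by (simp add: fps_agree_def)
  qed
qed

text \<open>L regards a series in two variables as one in the last two of three variables; it turns
  F into F(w,v).\<close>

lemma fps_fps_lift_mult:
  defines "L \<equiv> \<lambda>f :: 'a::comm_ring_1 fps fps. Abs_fps (\<lambda>k. Abs_fps (\<lambda>j. fps_const (f $ k $ j)))"
  shows "L (f * g) = L f * L g"
proof -
  have sum: "fps_const (sum h A) = (\<Sum>x\<in>A. fps_const (h x))" for h :: "nat \<Rightarrow> 'a" and A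
    by (induction A rule: infinite_finite_induct) (simp_all flip: fps_const_add)
  show ?thesis
    by (intro fps_ext, unfold fps_fps_mult_nth) (simp add: L_def fps_fps_mult_nth fps_sum_nth sum)
qed

context formal_group_law
begin

lemma F_decomp: obtains G where "F = fps_const fps_X + fps_X + fps_const fps_X * fps_X * G"
proof -
  obtain G where "F - fps_const fps_X - fps_X = fps_const fps_X * fps_X * G"
    using fgl_unit by (auto elim: dvdE)
  then have "F = fps_const fps_X + fps_X + fps_const fps_X * fps_X * G"
    by (simp add: algebra_simps)
  then show thesis by (rule that)
qed

lemma F_0: "F $ 0 = fps_X"
proof -
  obtain G where G: "F = fps_const fps_X + fps_X + fps_const fps_X * fps_X * G" by (rule F_decomp)
  show ?thesis by (subst G) simp
qed

lemma F_n_0: "F $ n $ 0 = (if n = 1 then 1 else 0)"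
  using fgl_commute[of n 0] by (simp add: F_0)

lemma tdeg_F: "fps_tdeg_ge 1 F"
  by (simp add: fps_tdeg_ge_def F_0)

lemma F_power_nth_eq_0: "i + j < n \<Longrightarrow> (F ^ n) $ j $ i = 0"
  by (rule fps_tdeg_geD[OF fps_tdeg_ge_power[OF tdeg_F]])

lemma transpose_F: "fps_transpose F = F"
  by (intro fps_ext) (simp add: fgl_commute)

lemma F_power_commute: "(F ^ n) $ j $ i = (F ^ n) $ i $ j"
proof -
  have "(F ^ n) $ j $ i = fps_transpose (F ^ n) $ i $ j" by simp
  then show ?thesis by (simp only: fps_transpose_power transpose_F)
qed

text \<open>The coefficient of z^i w^j v^k in the associativity law. The power of z fixes one
  summation index on the left, the power of v one on the right. As F has no constant term, the
  exponent n of F is at most j + k and i + j respectively.\<close>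

lemma assoc_coeffs:
  assumes "j + k \<le> T" "i + j \<le> T"
  shows "(\<Sum>n\<le>T. F $ n $ i * (F ^ n) $ k $ j) = (\<Sum>n\<le>T. F $ k $ n * (F ^ n) $ j $ i)"
proof -
  define L where "L = (\<lambda>f :: 'r fps fps. Abs_fps (\<lambda>k. Abs_fps (\<lambda>j. fps_const (f $ k $ j))))"
  have L_mult: "L (f * g) = L f * L g" for f g unfolding L_def by (rule fps_fps_lift_mult)
  have "L 1 = 1" by (intro fps_ext) (simp add: L_def)
  then have L_power: "L F ^ n = L (F ^ n)" for n by (induction n) (simp_all add: L_mult)
  have wv: "fps_subst3 F (fps_const fps_X) fps_X = L F"
  proof (intro fps_ext)
    fix k j i :: nat
    have "(\<lambda>(m, n). F $ n $ m * (fps_const fps_X ^ m * fps_X ^ n) $ k $ j $ i) =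
      (\<lambda>x. if x = (j, k) then F $ k $ j * (if i = 0 then 1 else 0) else 0)"
      by (auto simp: fps_X_power_mult_right_nth)
    then show "fps_subst3 F (fps_const fps_X) fps_X $ k $ j $ i = L F $ k $ j $ i"
      by (simp add: fps_subst3_def L_def)
  qed
  have zw: "fps_subst3 F (fps_const (fps_const fps_X)) (fps_const fps_X) = fps_const F"
  proof (intro fps_ext)
    fix k j i :: nat
    have "(\<lambda>(m, n). F $ n $ m * (fps_const (fps_const fps_X) ^ m * fps_const fps_X ^ n) $ k $ j $ i) =
      (\<lambda>x. if x = (i, j) then F $ j $ i * (if k = 0 then 1 else 0) else 0)"
      by (auto simp: fps_X_power_mult_right_nth)
    then show "fps_subst3 F (fps_const (fps_const fps_X)) (fps_const fps_X) $ k $ j $ i = fps_const F $ k $ j $ i"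
      by (simp add: fps_subst3_def)
  qed
  have "fps_subst3 F (fps_const (fps_const fps_X)) (L F) = fps_subst3 F (fps_const F) fps_X"
    using fgl_assoc by (simp add: Let_def wv zw)
  then have "fps_subst3 F (fps_const (fps_const fps_X)) (L F) $ k $ j $ i =
      fps_subst3 F (fps_const F) fps_X $ k $ j $ i" by simp
  moreover have "fps_subst3 F (fps_const (fps_const fps_X)) (L F) $ k $ j $ i =
      (\<Sum>n\<le>T. F $ n $ i * (F ^ n) $ k $ j)"
  proof -
    have c: "(fps_const (fps_const fps_X) ^ m * L F ^ n) $ k $ j $ i = (if i = m then (F ^ n) $ k $ j else 0)"
      for m n unfolding L_power by (auto simp: L_def fps_X_power_mult_nth fps_X_power_mult_right_nth)
    have "Sum_any (\<lambda>(m, n). F $ n $ m * (fps_const (fps_const fps_X) ^ m * L F ^ n) $ k $ j $ i) =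
       (\<Sum>(m,n)\<in>{i}\<times>{..T}. F $ n $ m * (fps_const (fps_const fps_X) ^ m * L F ^ n) $ k $ j $ i)"
    proof (rule Sum_any.expand_superset)
      show "{x. (case x of (m, n) \<Rightarrow> F $ n $ m * (fps_const (fps_const fps_X) ^ m * L F ^ n) $ k $ j $ i) \<noteq> 0}
         \<subseteq> {i} \<times> {..T}"
      proof (rule subsetI)
        fix x assume "x \<in> {x. (case x of (m, n) \<Rightarrow>
          F $ n $ m * (fps_const (fps_const fps_X) ^ m * L F ^ n) $ k $ j $ i) \<noteq> 0}"
        then obtain m n where x: "x = (m, n)"
          and "F $ n $ m * (fps_const (fps_const fps_X) ^ m * L F ^ n) $ k $ j $ i \<noteq> 0"
          by (cases x) simp
        then have "i = m" "(F ^ n) $ k $ j \<noteq> 0" unfolding c by (auto split: if_splits)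
        then show "x \<in> {i} \<times> {..T}" using F_power_nth_eq_0[of j k n] assms x by force
      qed
    qed simp
    also have "\<dots> = (\<Sum>n\<le>T. F $ n $ i * (F ^ n) $ k $ j)"
      unfolding sum.cartesian_product' c by simp
    finally show ?thesis by (simp add: fps_subst3_def)
  qed
  moreover have "fps_subst3 F (fps_const F) fps_X $ k $ j $ i = (\<Sum>n\<le>T. F $ k $ n * (F ^ n) $ j $ i)"
  proof -
    have c: "(fps_const F ^ m * fps_X ^ n) $ k $ j $ i = (if k = n then (F ^ m) $ j $ i else 0)"
      for m n by (auto simp: fps_X_power_mult_right_nth)
    have "Sum_any (\<lambda>(m, n). F $ n $ m * (fps_const F ^ m * fps_X ^ n) $ k $ j $ i) =
       (\<Sum>(m,n)\<in>{..T}\<times>{k}. F $ n $ m * (fps_const F ^ m * fps_X ^ n) $ k $ j $ i)"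
    proof (rule Sum_any.expand_superset)
      show "{x. (case x of (m, n) \<Rightarrow> F $ n $ m * (fps_const F ^ m * fps_X ^ n) $ k $ j $ i) \<noteq> 0}
         \<subseteq> {..T} \<times> {k}"
      proof (rule subsetI)
        fix x assume "x \<in> {x. (case x of (m, n) \<Rightarrow>
          F $ n $ m * (fps_const F ^ m * fps_X ^ n) $ k $ j $ i) \<noteq> 0}"
        then obtain m n where x: "x = (m, n)"
          and "F $ n $ m * (fps_const F ^ m * fps_X ^ n) $ k $ j $ i \<noteq> 0"
          by (cases x) simp
        then have "k = n" "(F ^ m) $ j $ i \<noteq> 0" unfolding c by (auto split: if_splits)
        then show "x \<in> {..T} \<times> {k}" using F_power_nth_eq_0[of i j m] assms x by force
      qed
    qed simp
    also have "\<dots> = (\<Sum>n\<le>T. F $ k $ n * (F ^ n) $ j $ i)"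
      unfolding sum.cartesian_product' by (simp add: c)
    finally show ?thesis by (simp add: fps_subst3_def)
  qed
  ultimately show ?thesis by simp
qed

section \<open>The group of power series without constant term under F\<close>

abbreviation gplus :: "'r fps fps \<Rightarrow> 'r fps fps \<Rightarrow> 'r fps fps" (infixl "\<boxplus>" 65) where
  "A \<boxplus> B \<equiv> fps_fps_subst A B F"

lemma gplus_tdeg: "fps_tdeg_ge 1 A \<Longrightarrow> fps_tdeg_ge 1 B \<Longrightarrow> fps_tdeg_ge 1 (A \<boxplus> B)"
  by (intro fps_fps_hom.ev_tdeg fps_fps_hom.intro tdeg_F)

lemma gplus_0_left:
  assumes "fps_tdeg_ge 1 A" shows "0 \<boxplus> A = A"
proof -
  interpret E: fps_fps_hom 0 A by unfold_locales (use assms in simp_all)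
  obtain G where G: "F = fps_const fps_X + fps_X + fps_const fps_X * fps_X * G" by (rule F_decomp)
  show ?thesis by (subst G) (simp add: E.ev_add E.ev_mult E.ev_z E.ev_w)
qed

lemma gplus_commute:
  assumes "fps_tdeg_ge 1 A" "fps_tdeg_ge 1 B" shows "A \<boxplus> B = B \<boxplus> A"
proof (intro fps_ext)
  fix j i :: nat
  interpret E: fps_fps_hom A B by unfold_locales (use assms in simp_all)
  interpret E': fps_fps_hom B A by unfold_locales (use assms in simp_all)
  show "(A \<boxplus> B) $ j $ i = (B \<boxplus> A) $ j $ i"
    unfolding E.ev_nth[OF order_refl] E'.ev_nth[OF order_refl]
    by (rule sum.reindex_bij_witness[of _ prod.swap prod.swap]) (auto simp: fgl_commute mult.commute)
qed

text \<open>Both sides are sums over A^m B^k C^l, and their coefficients agree by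
  \<open>assoc_coeffs\<close>. Only m + k + l <= T contributes, which guarantees the two bounds
  required there.\<close>

lemma gplus_assoc:
  assumes "fps_tdeg_ge 1 A" "fps_tdeg_ge 1 B" "fps_tdeg_ge 1 C"
  shows "A \<boxplus> (B \<boxplus> C) = (A \<boxplus> B) \<boxplus> C"
proof (intro fps_ext)
  fix j i :: nat
  define T where "T = i + j"
  define N where "N = {..T}"
  define X where "X m k l = (A ^ m * (B ^ k * C ^ l)) $ j $ i" for m k l
  interpret BC: fps_fps_hom B C by unfold_locales (use assms in simp_all)
  interpret AB: fps_fps_hom A B by unfold_locales (use assms in simp_all)
  interpret L: fps_fps_hom A "B \<boxplus> C" by unfold_locales (use assms gplus_tdeg in simp_all)
  interpret R: fps_fps_hom "A \<boxplus> B" C by unfold_locales (use assms gplus_tdeg in simp_all)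
  have X0: "X m k l = 0" if "T < m + k + l" for m k l
  proof -
    have "fps_tdeg_ge (m + (k + l)) (A ^ m * (B ^ k * C ^ l))"
      by (intro fps_tdeg_ge_mult fps_tdeg_ge_power assms)
    then show ?thesis unfolding X_def by (rule fps_tdeg_geD) (use that in \<open>simp add: T_def\<close>)
  qed
  have "(A \<boxplus> (B \<boxplus> C)) $ j $ i =
      (\<Sum>(m,n)\<in>N\<times>N. \<Sum>(k,l)\<in>N\<times>N. F $ n $ m * (F ^ n) $ l $ k * X m k l)"
    unfolding L.ev_nth[OF order_refl] BC.ev_power[symmetric] BC.mult_ev_nth
    by (simp add: N_def T_def X_def sum_distrib_left case_prod_unfold mult.assoc)
  also have "\<dots> = (\<Sum>((m,n),(k,l))\<in>(N\<times>N)\<times>(N\<times>N). F $ n $ m * (F ^ n) $ l $ k * X m k l)"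
    by (simp add: sum.cartesian_product case_prod_unfold)
  also have "\<dots> = (\<Sum>((m,k,l),n)\<in>(N\<times>N\<times>N)\<times>N. F $ n $ m * (F ^ n) $ l $ k * X m k l)"
    by (rule sum.reindex_bij_witness[of _ "\<lambda>((m,k,l),n). ((m,n),(k,l))" "\<lambda>((m,n),(k,l)). ((m,k,l),n)"]) auto
  also have "\<dots> = (\<Sum>(m,k,l)\<in>N\<times>N\<times>N. (\<Sum>n\<in>N. F $ n $ m * (F ^ n) $ l $ k) * X m k l)"
    by (simp add: sum.cartesian_product' sum_distrib_right)
  also have "\<dots> = (\<Sum>(m,k,l)\<in>N\<times>N\<times>N. (\<Sum>n\<in>N. F $ l $ n * (F ^ n) $ k $ m) * X m k l)"
  proof (rule sum.cong, rule refl, clarify)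
    fix m k l
    show "(\<Sum>n\<in>N. F $ n $ m * (F ^ n) $ l $ k) * X m k l = (\<Sum>n\<in>N. F $ l $ n * (F ^ n) $ k $ m) * X m k l"
      using X0[of m k l] assoc_coeffs[of k l T m] by (cases "T < m + k + l") (auto simp: N_def)
  qed
  also have "\<dots> = (\<Sum>((m,k,l),n)\<in>(N\<times>N\<times>N)\<times>N. F $ l $ n * (F ^ n) $ k $ m * X m k l)"
    by (simp add: sum.cartesian_product' sum_distrib_right)
  also have "\<dots> = (\<Sum>((n,l),(m,k))\<in>(N\<times>N)\<times>(N\<times>N). F $ l $ n * (F ^ n) $ k $ m * X m k l)"
    by (rule sum.reindex_bij_witness[of _ "\<lambda>((n,l),(m,k)). ((m,k,l),n)" "\<lambda>((m,k,l),n). ((n,l),(m,k))"]) auto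
  also have "\<dots> = (\<Sum>(n,l)\<in>N\<times>N. \<Sum>(m,k)\<in>N\<times>N. F $ l $ n * (F ^ n) $ k $ m * X m k l)"
    by (simp add: sum.cartesian_product case_prod_unfold)
  also have "\<dots> = ((A \<boxplus> B) \<boxplus> C) $ j $ i"
  proof -
    have "(AB.ev F ^ n * C ^ l) $ j $ i = (\<Sum>(m,k)\<in>N\<times>N. (F ^ n) $ k $ m * X m k l)" for n l
      unfolding AB.ev_power[symmetric] mult.commute[of _ "C ^ l"] AB.mult_ev_nth
      by (simp add: N_def T_def X_def mult_ac)
    then show ?thesis unfolding R.ev_nth[OF order_refl]
      by (simp add: N_def T_def sum_distrib_left case_prod_unfold mult.assoc)
  qed
  finally show "(A \<boxplus> (B \<boxplus> C)) $ j $ i = ((A \<boxplus> B) \<boxplus> C) $ j $ i" .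
qed

section \<open>The inverse series and its composite with F\<close>

definition \<iota> :: "'r fps" where
  "\<iota> = fgl_inverse F"

lemma iota: "\<iota> $ 0 = 0" "\<iota> $ 1 = - 1" "fps_const fps_X \<boxplus> fps_const \<iota> = 0"
proof -
  obtain G where G: "F = fps_const fps_X + fps_X + fps_const fps_X * fps_X * G" by (rule F_decomp)
  have tdeg: "fps_tdeg_ge 1 (fps_const g)" if "g $ 0 = 0" for g :: "'r fps"
    using that by (simp add: fps_tdeg_ge_def)
  have unique: "g = h" if g: "g $ 0 = 0" "fps_subst1 F fps_X g = 0" and h: "h $ 0 = 0" "fps_subst1 F fps_X h = 0" for g h
  proof -
    let ?z = "fps_const fps_X" and ?g = "fps_const g" and ?h = "fps_const h"
    note [simp] = tdeg[OF g(1), unfolded One_nat_def] tdeg[OF h(1), unfolded One_nat_def]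
    have zg: "?z \<boxplus> ?g = 0" "?z \<boxplus> ?h = 0" using g h by (simp_all add: fps_subst1_const)
    have "?g = (?h \<boxplus> ?z) \<boxplus> ?g" using zg gplus_commute[of ?h ?z] gplus_0_left[of ?g] by simp
    also have "\<dots> = ?h \<boxplus> (?z \<boxplus> ?g)" by (rule gplus_assoc[symmetric]) simp_all
    also have "\<dots> = ?h" using zg gplus_commute[of ?h 0] gplus_0_left[of ?h] by simp
    finally show "g = h" by (metis fps_nth_fps_const)
  qed
  \<comment> \<open>F(z,g) = 0 reads g = -z - z g G(z,g). The factor z in front makes the right side
    a contraction.\<close>
  have "fps_agree (Suc k) (- fps_X - fps_X * (g * fps_subst1 G fps_X g)) (- fps_X - fps_X * (h * fps_subst1 G fps_X h))"
    if "fps_agree k g h" for k g h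
    using fps_agree_mult[OF that fps_agree_subst1[OF that, of G fps_X]]
    by (auto simp: fps_agree_def fps_X_mult_nth)
  then obtain g where g: "- fps_X - fps_X * (g * fps_subst1 G fps_X g) = g"
    by (rule fps_contraction_fixpoint)
  have "(- fps_X - fps_X * (g * fps_subst1 G fps_X g)) $ 0 = 0" by simp
  then have g0: "g $ 0 = 0" unfolding g .
  have "(- fps_X - fps_X * (g * fps_subst1 G fps_X g)) $ 1 = - 1" by (simp add: g0)
  then have g1: "g $ 1 = - 1" unfolding g .
  have "fps_subst1 F fps_X g = 0"
  proof -
    interpret E: fps_fps_hom "fps_const fps_X" "fps_const g" by unfold_locales (simp_all add: tdeg[OF g0, unfolded One_nat_def])
    have "E.ev F = fps_const fps_X + fps_const g + fps_const fps_X * fps_const g * E.ev G"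
      by (subst G) (simp add: E.ev_add E.ev_mult E.ev_z E.ev_w)
    also have "\<dots> = fps_const (g - (- fps_X - fps_X * (g * fps_subst1 G fps_X g)))"
      by (simp add: fps_subst1_const algebra_simps)
    also have "\<dots> = 0" unfolding g by simp
    finally show ?thesis by (simp add: fps_subst1_const)
  qed
  then have "\<iota> = g" unfolding \<iota>_def fgl_inverse_def using g0 g1 unique by (intro the_equality) blast+
  with g0 g1 \<open>fps_subst1 F fps_X g = 0\<close>
  show "\<iota> $ 0 = 0" "\<iota> $ 1 = - 1" "fps_const fps_X \<boxplus> fps_const \<iota> = 0"
    by (simp_all add: fps_subst1_const)
qed

lemma tdeg_iota: "fps_tdeg_ge 1 (fps_const \<iota>)"
  by (simp add: fps_tdeg_ge_def iota)

definition iotaF :: "'r fps fps" where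
  "iotaF = fps_fps_subst F fps_X (fps_const \<iota>)"

lemma iotaF_nth: "i + j \<le> T \<Longrightarrow> iotaF $ j $ i = (\<Sum>m\<le>T. \<iota> $ m * (F ^ m) $ j $ i)"
  unfolding iotaF_def by (intro fps_fps_hom.ev_const_nth fps_fps_hom.intro tdeg_F fps_tdeg_ge_w)

lemma tdeg_iotaF: "fps_tdeg_ge 1 iotaF"
  unfolding iotaF_def by (intro fps_fps_hom.ev_tdeg fps_fps_hom.intro tdeg_F fps_tdeg_ge_w tdeg_iota)

lemma transpose_iotaF: "fps_transpose iotaF = iotaF"
  by (intro fps_ext) (simp add: iotaF_nth[OF order_refl] F_power_commute[of _ j i for j i] add.commute)

text \<open>In group notation, -(z + w) + w = -z. This identity makes z a coordinate at the third
  pole: for y = \<iota>(F(z,w)) it says F(y,w) = \<iota>(z).\<close>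

lemma iotaF_gplus: "iotaF \<boxplus> fps_X = fps_const \<iota>"
proof -
  let ?z = "fps_const fps_X" and ?i = "fps_const \<iota>"
  note [simp] = tdeg_iota[unfolded One_nat_def] tdeg_iotaF[unfolded One_nat_def] tdeg_F[unfolded One_nat_def]
  interpret E: fps_fps_hom F fps_X by unfold_locales simp_all
  have "F \<boxplus> iotaF = E.ev (?z \<boxplus> ?i)"
    unfolding iotaF_def by (simp add: E.ev_comp E.ev_z)
  then have 1: "F \<boxplus> iotaF = 0" by (simp add: iota E.ev_0)
  have F: "?z \<boxplus> fps_X = F" by (rule fps_fps_hom.ev_z_w) (simp_all add: fps_fps_hom_def)
  have X: "fps_tdeg_ge 1 (iotaF \<boxplus> fps_X)" by (intro gplus_tdeg tdeg_iotaF fps_tdeg_ge_w)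
  have "?z \<boxplus> (iotaF \<boxplus> fps_X) = ?z \<boxplus> (fps_X \<boxplus> iotaF)" using gplus_commute[of iotaF fps_X] by simp
  also have "\<dots> = (?z \<boxplus> fps_X) \<boxplus> iotaF" by (rule gplus_assoc) simp_all
  finally have 2: "?z \<boxplus> (iotaF \<boxplus> fps_X) = 0" by (simp add: F 1)
  have "iotaF \<boxplus> fps_X = (?i \<boxplus> ?z) \<boxplus> (iotaF \<boxplus> fps_X)"
    using gplus_commute[of ?i ?z] gplus_0_left[OF X] by (simp add: iota)
  also have "\<dots> = ?i \<boxplus> (?z \<boxplus> (iotaF \<boxplus> fps_X))" by (rule gplus_assoc[symmetric]) (use X in simp_all)
  also have "\<dots> = ?i" unfolding 2 using gplus_commute[of ?i 0] gplus_0_left[of ?i] by simp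
  finally show ?thesis .
qed

section \<open>Invariance of the differential p_F dz\<close>

lemma F_power_nth_0: "(F ^ n) $ 0 = fps_X ^ n"
  by (simp add: fps_power_nth_0 F_0)

lemma F_power_nth_1: "(F ^ n) $ 1 $ j = (if n = 0 \<or> j < n - 1 then 0 else of_nat n * F $ 1 $ (j - (n - 1)))"
proof -
  have "(F ^ n) $ 1 = fps_deriv (F ^ n) $ 0" by simp
  also have "\<dots> = of_nat n * (fps_X ^ (n - 1) * F $ 1)"
    by (simp add: fps_deriv_power F_power_nth_0 mult_ac)
  finally have "(F ^ n) $ 1 $ j = of_nat n * (fps_X ^ (n - 1) * F $ 1) $ j" by simp
  then show ?thesis by (simp add: fps_X_power_mult_nth)
qed

text \<open>The chain rule for f(F(z,w)), differentiated in w at w = 0; \<open>F $ 1\<close> is the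
  derivative of F in w at w = 0.\<close>

lemma sum_F_power_nth_1:
  assumes "j + 1 \<le> T"
  shows "(\<Sum>n\<le>T. f $ n * (F ^ n) $ 1 $ j) = (fps_deriv f * F $ 1) $ j"
proof -
  have "(\<Sum>n\<le>T. f $ n * (F ^ n) $ 1 $ j) = (\<Sum>n\<le>Suc j. f $ n * (F ^ n) $ 1 $ j)"
    using assms by (intro sum.mono_neutral_right) (auto simp: F_power_nth_1[unfolded One_nat_def])
  also have "\<dots> = (\<Sum>n\<le>j. f $ Suc n * (F ^ Suc n) $ 1 $ j)"
    by (subst sum.atMost_Suc_shift) (simp del: power_Suc)
  also have "\<dots> = (\<Sum>n\<le>j. fps_deriv f $ n * F $ 1 $ (j - n))"
    by (intro sum.cong refl) (subst F_power_nth_1, auto simp: mult_ac)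
  finally show ?thesis by (simp add: fps_mult_nth atMost_atLeast0)
qed

text \<open>Differentiate the associativity law in its third variable at 0 and exchange z and w by
  commutativity. Since p_F is the inverse of \<open>F $ 1\<close>, this is the invariance of p_F dz
  under z -> F(z,w).\<close>

lemma invariance_F:
  "fps_fps_subst F fps_X (fps_const (F $ 1)) = fps_const (F $ 1) * Abs_fps (\<lambda>n. fps_deriv (F $ n))"
proof (intro fps_ext)
  fix j i :: nat
  interpret E: fps_fps_hom F fps_X by unfold_locales (rule tdeg_F fps_tdeg_ge_w)+
  define T where "T = i + j + 1"
  have "E.ev (fps_const (F $ 1)) $ j $ i = (\<Sum>m\<le>T. F $ 1 $ m * (F ^ m) $ j $ i)"
    by (rule E.ev_const_nth) (simp add: T_def)
  also have "\<dots> = (\<Sum>m\<le>T. F $ 1 $ m * (F ^ m) $ i $ j)" by (subst F_power_commute) (rule refl)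
  also have "\<dots> = (\<Sum>n\<le>T. F $ n $ j * (F ^ n) $ 1 $ i)"
    by (rule assoc_coeffs[symmetric]) (simp_all add: T_def)
  also have "\<dots> = (\<Sum>n\<le>T. F $ j $ n * (F ^ n) $ 1 $ i)"
    by (intro sum.cong refl arg_cong2[of _ _ _ _ "(*)"] fgl_commute)
  also have "\<dots> = (fps_deriv (F $ j) * F $ 1) $ i"
    by (rule sum_F_power_nth_1) (simp add: T_def)
  finally show "E.ev (fps_const (F $ 1)) $ j $ i =
      (fps_const (F $ 1) * Abs_fps (\<lambda>n. fps_deriv (F $ n))) $ j $ i"
    by (simp add: mult.commute)
qed

lemma iotaF_0: "iotaF $ 0 = \<iota>"
proof (rule fps_ext)
  fix i
  have "iotaF $ 0 $ i = (\<Sum>m\<le>i. \<iota> $ m * (F ^ m) $ 0 $ i)" by (rule iotaF_nth) simp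
  also have "\<dots> = (\<Sum>m\<le>i. if m = i then \<iota> $ m else 0)"
    by (intro sum.cong) (auto simp: F_power_nth_0)
  finally show "iotaF $ 0 $ i = \<iota> $ i" by simp
qed

lemma invariance_iota:
  "fps_fps_subst (fps_const \<iota>) fps_X (fps_const (F $ 1)) = fps_const (- (fps_deriv \<iota> * F $ 1))"
proof (intro fps_ext)
  fix j i :: nat
  interpret E: fps_fps_hom "fps_const \<iota>" fps_X by unfold_locales (rule tdeg_iota fps_tdeg_ge_w)+
  interpret P: fps_fps_hom iotaF fps_X by unfold_locales (rule tdeg_iotaF fps_tdeg_ge_w)+
  show "E.ev (fps_const (F $ 1)) $ j $ i = fps_const (- (fps_deriv \<iota> * F $ 1)) $ j $ i"
  proof (cases "j = 0")
    case False
    then show ?thesis by (simp add: E.ev_const_nth[OF order_refl])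
  next
    case True
    define T where "T = i + 1"
    have 1: "iotaF $ 1 $ i = (fps_deriv \<iota> * F $ 1) $ i"
      using iotaF_nth[of i 1 T] sum_F_power_nth_1[of i T \<iota>] by (simp add: T_def)
    have c: "(iotaF ^ m * fps_X ^ n) $ 1 $ i =
        (if n = 0 then (iotaF ^ m) $ 1 $ i else if n = 1 then (\<iota> ^ m) $ i else 0)" for m n
      unfolding fps_X_power_mult_right_nth by (auto simp: fps_power_nth_0 iotaF_0)
    \<comment> \<open>The coefficient of w in F(\<iota>(F(z,w)), w) = \<iota>(z), whose right side
      does not contain w. On the left, the powers w^0 and w^1 of the second argument contribute
      \<iota>'(z) F_1(z) and F_1(\<iota>(z)), where F_1 is \<open>F $ 1\<close>.\<close>
    have "0 = (iotaF \<boxplus> fps_X) $ 1 $ i" unfolding iotaF_gplus by simp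
    also have "\<dots> = (\<Sum>(m,n)\<in>{..T}\<times>{..T}. F $ n $ m * (iotaF ^ m * fps_X ^ n) $ 1 $ i)"
      by (rule P.ev_nth) (simp add: T_def)
    also have "\<dots> = (\<Sum>m\<le>T. \<Sum>n\<le>T. F $ n $ m * (iotaF ^ m * fps_X ^ n) $ 1 $ i)"
      by (simp only: sum.cartesian_product' prod.case)
    also have "\<dots> = (\<Sum>m\<le>T. \<Sum>n\<in>{0, 1}. F $ n $ m * (iotaF ^ m * fps_X ^ n) $ 1 $ i)"
      unfolding c by (intro sum.cong refl sum.mono_neutral_right) (auto simp: T_def)
    also have "\<dots> = (\<Sum>m\<le>T. F $ 0 $ m * (iotaF ^ m) $ 1 $ i) + (\<Sum>m\<le>T. F $ 1 $ m * (\<iota> ^ m) $ i)"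
      unfolding c by (simp add: sum.distrib)
    also have "(\<Sum>m\<le>T. F $ 0 $ m * (iotaF ^ m) $ 1 $ i) = (\<Sum>m\<le>T. if m = 1 then iotaF $ 1 $ i else 0)"
      by (rule sum.cong) (auto simp: F_0)
    also have "\<dots> = iotaF $ 1 $ i" by (simp add: T_def)
    also have "(\<Sum>m\<le>T. F $ 1 $ m * (\<iota> ^ m) $ i) = E.ev (fps_const (F $ 1)) $ 0 $ i"
      by (subst E.ev_const_nth[of _ _ T]) (simp_all add: T_def)
    finally show ?thesis using True by (simp add: 1[unfolded One_nat_def] eq_neg_iff_add_eq_0 add.commute)
  qed
qed

end

section \<open>Iterated residues\<close>

lemma ring_zpow_hom:
  assumes "h 1 = 1" "\<And>x y. h (x * y) = h x * h y" "x * y = 1"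
  shows "h (ring_zpow x m) = ring_zpow (h x) m"
proof -
  have pow: "h (a ^ n) = h a ^ n" for a n by (induction n) (simp_all add: assms)
  have "h x * h y = 1" using assms by metis
  then show ?thesis
    using assms(3) by (cases "0 \<le> m") (simp_all add: ring_zpow_nonneg ring_zpow_neg pow)
qed

lemma sum_int_atLeastAtMost: "(\<Sum>i\<in>{0..int n}. f i) = (\<Sum>i\<le>n. f (int i))"
  by (rule sum.reindex_bij_witness[of _ int nat]) auto

context fps_change
begin

lemma laurent_substitution: "fls_substitution (*) P"
  by (intro fls_substitution.intro laurent_module_mult fps_change_axioms)

lemma subst_mult: "fls_subst (*) P (f * g) = fls_subst (*) P f * fls_subst (*) P g"
  using fls_substitution.sub_smult2[OF laurent_substitution, of f g] by (simp add: fls_smult_times)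

lemma subst_add: "fls_subst (*) P (f + g) = fls_subst (*) P f + fls_subst (*) P g"
  by (rule fls_substitution.sub_add[OF laurent_substitution])

lemma subst_monom: "fls_subst (*) P (fls_monom r m n) = emb_zpow m * fls_monom r 0 n"
  using fls_substitution.sub_monom[OF laurent_substitution, of r m n]
  by (simp add: fls_smult_times mult.assoc fls_monom_mult_monom)

lemma subst_1: "fls_subst (*) P 1 = 1"
  using subst_monom[of 1 0 0] by (simp add: fls_monom_1)

end

context module
begin

lemma fls_smult_const_nth: "fls_smult scale (fls_const c) h $$ n = scale c (h $$ n)"
proof -
  have "fls_smult scale (fls_const c) h $$ n =
      (\<Sum>i\<in>{min 0 (n - fls_subdegree h)..max 0 (n - fls_subdegree h)}. scale (fls_const c $$ i) (h $$ (n - i)))"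
    by (rule fls_smult_nth) auto
  also have "\<dots> = (\<Sum>i\<in>{0}. scale (fls_const c $$ i) (h $$ (n - i)))"
    by (rule sum.mono_neutral_right) auto
  finally show ?thesis by simp
qed

end

text \<open>A relation and not an operation: the exchanged coefficient array of a series in
  V((z))((w)) need not lie in V((w))((z)), as the z-orders of its rows may be unbounded
  below.\<close>

definition fls_transposed :: "'v::zero fls fls \<Rightarrow> 'v fls fls \<Rightarrow> bool" where
  "fls_transposed A B \<longleftrightarrow> (\<forall>p q. coeff2 A p q = coeff2 B q p)"

lemma fls_nonneg_outer_ge: "fls_nonneg H \<Longrightarrow> outer_ge 0 H"
  by (auto simp: fls_nonneg_def outer_ge_def intro!: fls_eqI)

lemma fls_transposed_nonneg: "fls_transposed A B \<Longrightarrow> fls_nonneg A \<longleftrightarrow> fls_nonneg B"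
  by (auto simp: fls_nonneg_def fls_transposed_def)

lemma fls_nonneg_transpose_exists:
  assumes "fls_nonneg A" obtains B where "fls_transposed A B"
proof -
  obtain P where "A = emb P" using assms by (rule fls_nonneg_imp_emb)
  then have "fls_transposed A (emb (fps_transpose P))" by (simp add: fls_transposed_def)
  then show thesis by (rule that)
qed

context laurent_module
begin

text \<open>The w-order of A bounds the exponents within the rows of B and conversely, so both
  convolutions run over one finite rectangle.\<close>

lemma transposed_emb_smult2:
  assumes "fls_transposed A B"
  shows "fls_transposed (emb P \<odot> A) (emb (fps_transpose P) \<odot> B)"
  unfolding fls_transposed_def
proof (intro allI)
  fix p q
  obtain L where L: "outer_ge L A" by (rule outer_geE)
  obtain K where K: "outer_ge K B" by (rule outer_geE)
  have "coeff2 (emb P \<odot> A) p q = (\<Sum>j\<in>{0..q - L}. \<Sum>i\<in>{0..p - K}.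
      scale (coeff2 (emb P) i j) (coeff2 A (p - i) (q - j)))"
    by (rule coeff2_smult2) (use L K assms in \<open>auto simp: outer_ge_def fls_transposed_def\<close>)
  also have "\<dots> = (\<Sum>i\<in>{0..p - K}. \<Sum>j\<in>{0..q - L}. scale (coeff2 (emb P) i j) (coeff2 A (p - i) (q - j)))"
    by (rule sum.swap)
  also have "\<dots> = (\<Sum>i\<in>{0..p - K}. \<Sum>j\<in>{0..q - L}.
      scale (coeff2 (emb (fps_transpose P)) j i) (coeff2 B (q - j) (p - i)))"
    using assms by (simp add: fls_transposed_def)
  also have "\<dots> = coeff2 (emb (fps_transpose P) \<odot> B) q p"
  proof (rule coeff2_smult2[symmetric])
    show "coeff2 B i j = 0" if "j \<le> p - 0" "i < L" for i j
    proof -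
      have "coeff2 A j i = 0" using L that by (simp add: outer_ge_def)
      then show ?thesis using assms by (simp add: fls_transposed_def)
    qed
  qed (use K in \<open>auto simp: outer_ge_def\<close>)
  finally show "coeff2 (emb P \<odot> A) p q = coeff2 (emb (fps_transpose P) \<odot> B) q p" .
qed

lemma transposed_monom_smult2:
  "fls_transposed A B \<Longrightarrow> fls_transposed (fls_monom r m n \<odot> A) (fls_monom r n m \<odot> B)"
  by (simp add: fls_transposed_def coeff2_monom_smult2)

lemma bilateral_mult_coeff2: "bilateral_mult scale P (\<lambda>p q. coeff2 H p q) p q = coeff2 (emb P \<odot> H) p q"
proof -
  obtain L where L: "outer_ge L H" by (rule outer_geE)
  obtain K where K: "\<And>i j. j \<le> q \<Longrightarrow> i < K \<Longrightarrow> coeff2 H i j = 0" using fls_rows_bounded[of q H] by blast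
  define I where "I = {..nat (p - K)}"
  define J where "J = {..nat (q - L)}"
  have "bilateral_mult scale P (\<lambda>p q. coeff2 H p q) p q =
    (\<Sum>(i,j)\<in>I\<times>J. scale (P $ j $ i) (coeff2 H (p - int i) (q - int j)))"
    unfolding bilateral_mult_def
  proof (rule Sum_any.expand_superset)
    show "{x. (case x of (i, j) \<Rightarrow> scale (P $ j $ i) (coeff2 H (p - int i) (q - int j))) \<noteq> 0} \<subseteq> I \<times> J"
    proof (rule subsetI)
      fix x assume "x \<in> {x. (case x of (i, j) \<Rightarrow> scale (P $ j $ i) (coeff2 H (p - int i) (q - int j))) \<noteq> 0}"
      then obtain i j where x: "x = (i, j)" and "scale (P $ j $ i) (coeff2 H (p - int i) (q - int j)) \<noteq> 0"
        by (cases x) simp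
      then have "coeff2 H (p - int i) (q - int j) \<noteq> 0" by auto
      then have "L \<le> q - int j" "K \<le> p - int i" using L K[of "q - int j" "p - int i"]
        by (auto simp: outer_ge_def not_less[symmetric])
      then have "i \<le> nat (p - K)" "j \<le> nat (q - L)" by linarith+
      then show "x \<in> I \<times> J" by (simp add: x I_def J_def)
    qed
  qed (simp add: I_def J_def)
  also have "\<dots> = (\<Sum>j\<in>J. \<Sum>i\<in>I. scale (P $ j $ i) (coeff2 H (p - int i) (q - int j)))"
    by (simp add: sum.cartesian_product' sum.swap[of _ I])
  also have "\<dots> = (\<Sum>j\<in>{0..int (nat (q - L))}. \<Sum>i\<in>{0..int (nat (p - K))}.
      scale (coeff2 (emb P) i j) (coeff2 H (p - i) (q - j)))"
    by (simp add: sum_int_atLeastAtMost I_def J_def del: int_nat_eq)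
  also have "\<dots> = coeff2 (emb P \<odot> H) p q"
  proof -
    have "coeff2 (emb P \<odot> H) p q = (\<Sum>j\<in>{0..q - (q - int (nat (q - L)))}. \<Sum>i\<in>{0..p - (p - int (nat (p - K)))}.
      scale (coeff2 (emb P) i j) (coeff2 H (p - i) (q - j)))"
      by (rule coeff2_smult2) (use L K in \<open>auto simp: outer_ge_def split: if_splits\<close>)
    then show ?thesis by simp
  qed
  finally show ?thesis .
qed

end

context formal_group_law
begin

lemma change_F: "fps_change F"
  by unfold_locales (simp_all add: F_0)

lemma change_iota: "fps_change (fps_const \<iota>)"
  using iota by unfold_locales simp_all

lemma change_iotaF: "fps_change iotaF"
  using iota by unfold_locales (simp_all add: iotaF_0)

sublocale CF: fps_change F by (rule change_F)
sublocale CI: fps_change "fps_const \<iota>" by (rule change_iota)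
sublocale CJ: fps_change iotaF by (rule change_iotaF)

section \<open>The weight p_F and powers of F and \<iota> under substitution\<close>

abbreviation pF :: "'r fps" where
  "pF \<equiv> fgl_p F"

lemma p_mult: "pF * F $ 1 = 1"
proof -
  have "(F $ 1) $ 0 * 1 = 1" by (simp add: F_n_0)
  then obtain v where "F $ 1 * v = 1" using fps_right_inverse by blast
  moreover have "fps_deriv F $ 0 = F $ 1" by simp
  ultimately show ?thesis by (metis fgl_p_def mult.commute ring_inverse_eqI)
qed

text \<open>The reciprocal of \<open>invariance_F\<close>, in the form required by
  \<open>residue_sub_weighted\<close> with s = 1; \<open>weight_iota\<close> is the analogue with s
  = -1.\<close>

lemma weight_F: "emb (fps_const pF) = fls_monom 1 0 0 * (CF.emb_deriv * fls_subst (*) F (emb (fps_const pF)))"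
proof -
  interpret E: fps_fps_hom F fps_X by unfold_locales (rule tdeg_F fps_tdeg_ge_w)+
  define dF where "dF = Abs_fps (\<lambda>n. fps_deriv (F $ n))"
  have "E.ev (fps_const pF) * (fps_const (F $ 1) * dF) = E.ev (fps_const (pF * F $ 1))"
    unfolding dF_def invariance_F[symmetric] E.ev_mult[symmetric] by simp
  then have "E.ev (fps_const pF) * (fps_const (F $ 1) * dF) = 1" by (simp only: p_mult E.ev_1 fps_const_1_eq_1)
  then have "fps_const pF = fps_const pF * (E.ev (fps_const pF) * (fps_const (F $ 1) * dF))" by simp
  also have "\<dots> = fps_const (pF * F $ 1) * (dF * E.ev (fps_const pF))"
    unfolding fps_const_mult[symmetric] by (simp only: mult_ac)
  finally have "fps_const pF = dF * E.ev (fps_const pF)" by (simp only: p_mult fps_const_1_eq_1 mult_1)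
  then have "emb (fps_const pF) = emb dF * emb (E.ev (fps_const pF))" by (metis emb_mult)
  then show ?thesis unfolding fls_monom_1 CF.emb_deriv_def dF_def[symmetric] CF.subst_emb mult_1 .
qed

lemma weight_iota:
  "emb (fps_const pF) = fls_monom (- 1) 0 0 * (CI.emb_deriv * fls_subst (*) (fps_const \<iota>) (emb (fps_const pF)))"
proof -
  interpret E: fps_fps_hom "fps_const \<iota>" fps_X by unfold_locales (rule tdeg_iota fps_tdeg_ge_w)+
  define d where "d = fps_deriv \<iota>"
  have "E.ev (fps_const pF) * fps_const (- (d * F $ 1)) = E.ev (fps_const (pF * F $ 1))"
    unfolding d_def invariance_iota[symmetric] E.ev_mult[symmetric] by simp
  then have "E.ev (fps_const pF) * fps_const (- (d * F $ 1)) = 1"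
    by (simp only: p_mult E.ev_1 fps_const_1_eq_1)
  then have "fps_const pF = fps_const pF * (E.ev (fps_const pF) * fps_const (- (d * F $ 1)))" by simp
  also have "\<dots> = E.ev (fps_const pF) * fps_const (- (d * (pF * F $ 1)))"
  proof -
    have "pF * - (d * F $ 1) = - (d * (pF * F $ 1))" by (simp add: mult_ac)
    then show ?thesis by (simp only: mult.left_commute[of "fps_const pF"] fps_const_mult)
  qed
  finally have "fps_const pF = E.ev (fps_const pF) * fps_const (- d)" by (simp only: p_mult mult_1_right)
  also have "\<dots> = fps_monom (- 1) 0 0 * (fps_const d * E.ev (fps_const pF))"
  proof -
    have "fps_const (- d) = fps_monom (- 1) 0 0 * fps_const d"
      by (simp add: fps_monom_def flip: fps_const_neg)
    then show ?thesis by (simp only: mult_ac)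
  qed
  finally have "emb (fps_const pF) = emb (fps_monom (- 1) 0 0) * (emb (fps_const d) * emb (E.ev (fps_const pF)))"
    by (metis emb_mult)
  moreover have "fps_const d = Abs_fps (\<lambda>n. fps_deriv (fps_const \<iota> $ n))"
    by (rule fps_ext) (simp add: d_def)
  ultimately show ?thesis unfolding CI.emb_deriv_def CI.subst_emb emb_monom of_nat_0 by (simp only:)
qed

text \<open>By \<open>iotaF_gplus\<close> for c = 1; inverses follow because the substitution is a
  ring homomorphism.\<close>

lemma subst_iotaF_F: "fls_subst (*) iotaF (CF.emb_zpow c) = CI.emb_zpow c"
proof -
  obtain \<psi> where "emb F * \<psi> = 1" by (rule CF.emb_inverse)
  then show ?thesis unfolding CF.emb_zpow_def CI.emb_zpow_def
    by (subst ring_zpow_hom[where h = "fls_subst (*) iotaF"])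
      (simp_all add: CJ.subst_1 CJ.subst_mult CJ.subst_emb iotaF_gplus)
qed

lemma subst_F_iota: "fls_subst (*) F (CI.emb_zpow c) = CJ.emb_zpow c"
proof -
  obtain \<psi> where "emb (fps_const \<iota>) * \<psi> = 1" by (rule CI.emb_inverse)
  then show ?thesis unfolding CJ.emb_zpow_def CI.emb_zpow_def
    by (subst ring_zpow_hom[where h = "fls_subst (*) F"])
      (simp_all add: CF.subst_1 CF.subst_mult CF.subst_emb flip: iotaF_def)
qed

text \<open>\<open>\<iota>(w)\<^sup>c\<close> in the outer variable \<open>w\<close>\<close>

definition iota_zpow :: "int \<Rightarrow> 'r fls fls" where
  "iota_zpow c = ring_zpow (emb (fps_transpose (fps_const \<iota>))) c"

lemma iota_inverses:
  obtains v where "emb (fps_const \<iota>) * (fls_monom 1 (- 1) 0 * emb (fps_const v)) = 1"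
    and "emb (fps_transpose (fps_const \<iota>)) * (fls_monom 1 0 (- 1) * emb (fps_transpose (fps_const v))) = 1"
proof -
  obtain v where v: "fps_shift 1 \<iota> * v = 1" using CI.inverse_row_0 by auto
  define u where "u = fps_shift 1 \<iota>"
  have uv: "u * v = 1" using v by (simp add: u_def)
  have "\<iota> = fps_X * u" by (rule fps_ext) (auto simp: u_def iota)
  then have i: "fps_const \<iota> = fps_monom 1 1 0 * fps_const u" by (simp add: fps_monom_def)
  have "fps_transpose (fps_monom 1 1 0) = fps_monom (1::'r) 0 1" by (intro fps_ext) auto
  then have i': "fps_transpose (fps_const \<iota>) = fps_monom 1 0 1 * fps_transpose (fps_const u)"
    unfolding i fps_transpose_mult by simp
  have cancel: "fls_monom 1 m n * a * (fls_monom 1 (- m) (- n) * b) = a * b" for m n and a b :: "'r fls fls"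
  proof -
    have "fls_monom 1 m n * a * (fls_monom 1 (- m) (- n) * b) =
        (fls_monom 1 m n * fls_monom 1 (- m) (- n)) * (a * b)" by (simp only: mult_ac)
    then show ?thesis by (simp add: fls_monom_mult_monom fls_monom_1)
  qed
  show thesis
  proof (rule that[of v])
    have "emb (fps_const u) * emb (fps_const v) = 1" by (simp add: uv flip: emb_mult)
    then show "emb (fps_const \<iota>) * (fls_monom 1 (- 1) 0 * emb (fps_const v)) = 1"
      unfolding i emb_mult emb_monom using cancel[of 1 0] by simp
    have "emb (fps_transpose (fps_const u)) * emb (fps_transpose (fps_const v)) = 1"
      by (simp add: uv flip: emb_mult fps_transpose_mult)
    then show "emb (fps_transpose (fps_const \<iota>)) * (fls_monom 1 0 (- 1) * emb (fps_transpose (fps_const v))) = 1"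
      unfolding i' emb_mult emb_monom using cancel[of 0 1] by simp
  qed
qed

lemma iota_zpow_add: "iota_zpow (m + n) = iota_zpow m * iota_zpow n"
  unfolding iota_zpow_def using iota_inverses ring_zpow_add by metis

lemma iota_zpow_1 [simp]: "iota_zpow 1 = emb (fps_transpose (fps_const \<iota>))"
  by (simp add: iota_zpow_def)

lemma iota_zpow_0 [simp]: "iota_zpow 0 = 1"
  by (simp add: iota_zpow_def)

end

locale fgl_module = laurent_module scale + formal_group_law F
  for scale :: "'r::comm_ring_1 \<Rightarrow> 'v::ab_group_add \<Rightarrow> 'v" and F :: "'r fps fps"
begin

sublocale SF: fls_substitution scale F ..
sublocale SI: fls_substitution scale "fps_const \<iota>" ..
sublocale SJ: fls_substitution scale iotaF ..

text \<open>Negative powers of \<iota> pass through the exchange of variables because they are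
  products of monomials and power series.\<close>

lemma transposed_emb_zpow:
  assumes "fls_transposed A B"
  shows "fls_transposed (CI.emb_zpow c \<odot> A) (iota_zpow c \<odot> B)"
proof -
  obtain v where v: "emb (fps_const \<iota>) * (fls_monom 1 (- 1) 0 * emb (fps_const v)) = 1"
    "emb (fps_transpose (fps_const \<iota>)) * (fls_monom 1 0 (- 1) * emb (fps_transpose (fps_const v))) = 1"
    by (rule iota_inverses)
  show ?thesis
  proof (cases "0 \<le> c")
    case True
    have "fls_transposed (emb (fps_const \<iota>) ^ n \<odot> A) (emb (fps_transpose (fps_const \<iota>)) ^ n \<odot> B)" for n
      using transposed_emb_smult2[OF assms, of "fps_const \<iota> ^ n"]
      by (simp only: fps_transpose_power emb_power)
    then show ?thesis using True by (simp add: CI.emb_zpow_def iota_zpow_def ring_zpow_nonneg)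
  next
    case False
    have "fls_transposed ((fls_monom 1 (- 1) 0 * emb (fps_const v)) ^ n \<odot> A)
        ((fls_monom 1 0 (- 1) * emb (fps_transpose (fps_const v))) ^ n \<odot> B)" for n
    proof (induction n)
      case (Suc n)
      then show ?case
        unfolding power_Suc M2.scale_scale[symmetric]
        by (intro transposed_monom_smult2 transposed_emb_smult2)
    qed (use assms in simp)
    then show ?thesis
      using False by (simp add: CI.emb_zpow_def iota_zpow_def ring_zpow_neg[OF v(1)] ring_zpow_neg[OF v(2)])
  qed
qed

lemma sub_F_iota: "SF.sub (SI.sub H) = SJ.sub H"
proof (rule fls_fls_cont_ext[where \<Phi> = "\<lambda>H. SF.sub (SI.sub H)" and \<Psi> = SJ.sub])
  fix v m n
  have v0: "SF.sub (fls_monom v 0 0) = fls_monom v 0 0"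
    using SF.sub_monom[of v 0 0] by (simp add: fls_monom_1)
  have "SF.sub (SI.sub (fls_monom v m n)) =
      fls_subst (*) F (CI.emb_zpow m * fls_monom 1 0 n) \<odot> SF.sub (fls_monom v 0 0)"
    unfolding SI.sub_monom by (rule SF.sub_smult2)
  also have "\<dots> = SJ.sub (fls_monom v m n)"
    unfolding SJ.sub_monom CF.subst_mult CF.subst_monom subst_F_iota v0 by simp
  finally show "SF.sub (SI.sub (fls_monom v m n)) = SJ.sub (fls_monom v m n)" .
qed (simp_all add: SF.sub_add SI.sub_add SJ.sub_add SJ.cont_sub fls_fls_cont_compose[OF SF.cont_sub SI.cont_sub])

text \<open>The iterated F-residue. Its weight p_F(z) p_F(w) is symmetric, so the residue does not
  depend on the order of the variables when both orders make sense.\<close>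

definition res2 :: "'v fls fls \<Rightarrow> 'v" where
  "res2 H = coeff2 (emb (Abs_fps (\<lambda>n. fps_const (pF $ n) * pF)) \<odot> H) (- 1) (- 1)"

lemma res2_weights: "res2 H = coeff2 (emb (fps_const pF) \<odot> (emb (Abs_fps (\<lambda>n. fps_const (pF $ n))) \<odot> H)) (- 1) (- 1)"
proof -
  have "Abs_fps (\<lambda>n. fps_const (pF $ n) * pF) = fps_const pF * Abs_fps (\<lambda>n. fps_const (pF $ n))"
    by (rule fps_ext) (simp add: mult.commute)
  then show ?thesis by (simp add: res2_def emb_mult)
qed

lemma res2_diff: "res2 (A - B) = res2 A - res2 B"
  by (simp add: res2_def M2.scale_right_diff_distrib)

lemma res2_transposed: "fls_transposed A B \<Longrightarrow> res2 A = res2 B"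
proof -
  assume AB: "fls_transposed A B"
  have "fps_transpose (Abs_fps (\<lambda>n. fps_const (pF $ n) * pF)) = Abs_fps (\<lambda>n. fps_const (pF $ n) * pF)"
    by (intro fps_ext) (simp add: mult.commute)
  then show ?thesis using transposed_emb_smult2[OF AB, of "Abs_fps (\<lambda>n. fps_const (pF $ n) * pF)"]
    by (simp add: res2_def fls_transposed_def)
qed

lemma res2_eq_0: "outer_ge 0 H \<Longrightarrow> res2 H = 0"
  unfolding res2_def by (rule coeff2_smult2_eq_0) (auto simp: outer_ge_def)

text \<open>A substitution for z leaves p_F(w) alone, so the assumed behaviour of residues with
  weight p_F(z) decides.\<close>

lemma res2_sub:
  assumes "fls_substitution scale P"
    and "\<And>H n. coeff2 (emb (fps_const pF) \<odot> fls_subst scale P H) (- 1) n = scale s (coeff2 (emb (fps_const pF) \<odot> H) (- 1) n)"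
  shows "res2 (fls_subst scale P H) = scale s (res2 H)"
proof -
  interpret S: fls_substitution scale P by fact
  define w where "w = Abs_fps (\<lambda>n. fps_const (pF $ n))"
  have "fps_fps_subst P fps_X w = w"
  proof -
    interpret E: fps_fps_hom P fps_X by unfold_locales (rule S.tdeg_P fps_tdeg_ge_w)+
    show ?thesis
    proof (intro fps_ext)
      fix j i :: nat
      define T where "T = i + j"
      have "E.ev w $ j $ i = (\<Sum>(m,n)\<in>{..T}\<times>{..T}. w $ n $ m * (P ^ m * fps_X ^ n) $ j $ i)"
        by (rule E.ev_nth) (simp add: T_def)
      also have "\<dots> = (\<Sum>x\<in>{..T}\<times>{..T}. if x = (0, j) then w $ j $ i else 0)"
        by (rule sum.cong) (auto simp: w_def split: if_splits)
      finally show "E.ev w $ j $ i = w $ j $ i" by (simp add: T_def)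
    qed
  qed
  then have "fls_subst (*) P (emb w) = emb w" by (simp add: S.subst_emb)
  then have "emb w \<odot> S.sub H = S.sub (emb w \<odot> H)" by (simp add: S.sub_smult2)
  then show ?thesis unfolding res2_weights w_def[symmetric] by (simp only: assms(2))
qed

lemma res2_sub_F: "res2 (SF.sub H) = res2 H"
  using res2_sub[OF SF.fls_substitution_axioms SF.residue_sub_weighted[OF weight_F]] by simp

lemma res2_sub_iota: "res2 (SI.sub H) = - res2 H"
  using res2_sub[OF SI.fls_substitution_axioms SI.residue_sub_weighted[OF weight_iota]] by simp

lemma res2_sub_iotaF: "res2 (SJ.sub H) = - res2 H"
  unfolding sub_F_iota[symmetric] by (simp add: res2_sub_F res2_sub_iota)

end

section \<open>The residue theorem for three expansions\<close>

lemma outer_ge_0_monom: "0 \<le> n \<Longrightarrow> outer_ge 0 (fls_monom r m n)"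
  by (auto simp: outer_ge_def intro!: fls_eqI)

context fgl_module
begin

lemma outer_ge_0_smult2: "outer_ge 0 f \<Longrightarrow> outer_ge 0 H \<Longrightarrow> outer_ge 0 (f \<odot> H)"
  using outer_ge_smult2[of 0 f 0 H] by simp

text \<open>
  The sum of the residues at \<open>y = 0\<close>, \<open>F(w,y) = 0\<close> and \<open>w = 0\<close> of \<open>w\<^sup>i y\<^sup>j F(w,y)\<^sup>c A(w,y)\<close>, where the
  coordinate \<open>z\<close> around \<open>F(w,y) = 0\<close> is given by \<open>y = \<iota>(F(z,w))\<close>, i.e. \<open>F(w,y) = \<iota>(z)\<close>. Writing
  \<open>w = F(w,y) - y\<alpha>(w,y)\<close> reduces the orders of the poles until \<open>j\<close> or \<open>c\<close> is nonnegative.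
\<close>

lemma residue_theorem:
  assumes "fls_transposed A B" and "fls_nonneg A" and "fls_transposed (SJ.sub B) C"
  shows "res2 ((fls_monom 1 i j * CF.emb_zpow c) \<odot> A) - res2 ((fls_monom 1 j i * CF.emb_zpow c) \<odot> B) =
    res2 ((fls_monom 1 i 0 * CJ.emb_zpow j * iota_zpow c) \<odot> C)"
  using assms
proof (induction "nat (- j) + nat (- c)" arbitrary: i j c A B C rule: less_induct)
  case less
  note AB = less.prems(1) and A = less.prems(2) and BC = less.prems(3)
  have B: "fls_nonneg B" using A fls_transposed_nonneg[OF AB] by simp
  then have "fls_nonneg (SJ.sub B)" by (rule SJ.fls_nonneg_sub)
  then have C: "fls_nonneg C" using fls_transposed_nonneg[OF BC] by simp
  consider "0 \<le> c" | "0 \<le> j" | "j < 0" "c < 0" by linarith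
  then show ?case
  proof cases
    case 1
    \<comment> \<open>Without a pole at F(w,y) = 0 the first two expansions coincide, and the third
      has no pole at z = 0.\<close>
    have "fls_transposed ((fls_monom 1 i j * CF.emb_zpow c) \<odot> A) ((fls_monom 1 j i * CF.emb_zpow c) \<odot> B)"
      using transposed_monom_smult2[OF transposed_emb_smult2[OF AB, of "F ^ nat c"], of 1 i j]
      using 1 by (simp add: fps_transpose_power transpose_F CF.emb_zpow_def ring_zpow_nonneg emb_power)
    moreover have "res2 ((fls_monom 1 i 0 * CJ.emb_zpow j * iota_zpow c) \<odot> C) = 0"
    proof (intro res2_eq_0 outer_ge_0_smult2 outer_ge_0_mult)
      show "outer_ge 0 (iota_zpow c)"
        using 1 by (simp add: iota_zpow_def ring_zpow_nonneg fls_nonneg_outer_ge flip: emb_power)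
    qed (simp_all add: outer_ge_0_monom CJ.outer_ge_emb_zpow fls_nonneg_outer_ge C)
    ultimately show ?thesis using res2_transposed by simp
  next
    case 2
    \<comment> \<open>Without a pole at y = 0 the first residue is 0. The substitution y =
      \<iota>(F(z,w)) carries the second expansion to the third and reverses the sign of the
      residue.\<close>
    have "res2 ((fls_monom 1 i j * CF.emb_zpow c) \<odot> A) = 0"
      by (intro res2_eq_0 outer_ge_0_smult2 outer_ge_0_mult)
        (simp_all add: outer_ge_0_monom CF.outer_ge_emb_zpow fls_nonneg_outer_ge A 2)
    moreover have "fls_transposed (fls_monom 1 0 i \<odot> CJ.emb_zpow j \<odot> CI.emb_zpow c \<odot> SJ.sub B)
      (fls_monom 1 i 0 \<odot> CJ.emb_zpow j \<odot> iota_zpow c \<odot> C)"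
    proof -
      have "CJ.emb_zpow j = emb (iotaF ^ nat j)" using 2 by (simp add: CJ.emb_zpow_def ring_zpow_nonneg emb_power)
      moreover have "fps_transpose (iotaF ^ nat j) = iotaF ^ nat j"
        by (simp add: fps_transpose_power transpose_iotaF)
      ultimately show ?thesis
        using transposed_emb_smult2[OF transposed_emb_zpow[OF BC, of c], of "iotaF ^ nat j"]
        by (intro transposed_monom_smult2) simp
    qed
    then have "res2 ((fls_monom 1 i 0 * CJ.emb_zpow j * iota_zpow c) \<odot> C) =
        res2 ((fls_monom 1 0 i * CJ.emb_zpow j * CI.emb_zpow c) \<odot> SJ.sub B)"
      using res2_transposed by (simp add: mult.assoc)
    moreover have "SJ.sub ((fls_monom 1 j i * CF.emb_zpow c) \<odot> B) =
        (fls_monom 1 0 i * CJ.emb_zpow j * CI.emb_zpow c) \<odot> SJ.sub B"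
      unfolding SJ.sub_smult2 CJ.subst_mult CJ.subst_monom subst_iotaF_F
      by (simp only: mult_ac)
    ultimately show ?thesis using res2_sub_iotaF[of "(fls_monom 1 j i * CF.emb_zpow c) \<odot> B"] by simp
  next
    case 3
    obtain G where G: "F = fps_const fps_X + fps_X + fps_const fps_X * fps_X * G" by (rule F_decomp)
    define \<alpha> where "\<alpha> = 1 + fps_const fps_X * G"
    \<comment> \<open>The value of \<alpha> at the third pole: putting y = \<iota>(F(z,w)) into F =
      w + y \<alpha> yields \<iota>(z) = w + \<iota>(F(z,w)) \<beta>.\<close>
    define \<beta> where "\<beta> = fps_fps_subst iotaF fps_X (fps_transpose \<alpha>)"
    have X: "emb (fps_const fps_X) = fls_monom (1::'r) 1 0" "emb fps_X = fls_monom (1::'r) 0 1"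
      using emb_monom[of "1::'r" 1 0] emb_monom[of "1::'r" 0 1] by (simp_all add: fps_monom_def)
    have trX: "fps_transpose (fps_const fps_X) = (fps_X :: 'r fps fps)"
      "fps_transpose fps_X = (fps_const fps_X :: 'r fps fps)"
      by (intro fps_ext, auto)+
    have tr_add: "fps_transpose (f + g) = fps_transpose f + fps_transpose g" for f g :: "'r fps fps"
      by (intro fps_ext) simp
    have F: "F = fps_const fps_X + fps_X * \<alpha>" by (subst G) (simp add: \<alpha>_def algebra_simps)
    have "fps_transpose F = fps_transpose (fps_const fps_X + fps_X * \<alpha>)" using F by simp
    then have F': "F = fps_X + fps_const fps_X * fps_transpose \<alpha>"
      unfolding transpose_F by (simp add: tr_add fps_transpose_mult trX)
    have x1: "fls_monom 1 1 0 = CF.emb_zpow 1 - fls_monom 1 0 1 * emb \<alpha>"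
      using arg_cong[OF F, of emb] by (simp add: emb_add emb_mult X)
    have x2: "fls_monom 1 0 1 = CF.emb_zpow 1 - fls_monom 1 1 0 * emb (fps_transpose \<alpha>)"
      using arg_cong[OF F', of emb] by (simp add: emb_add emb_mult X)
    have "fls_subst (*) iotaF (emb F) = fls_subst (*) iotaF (fls_monom 1 0 1 + fls_monom 1 1 0 * emb (fps_transpose \<alpha>))"
      using arg_cong[OF F', of emb] by (simp add: emb_add emb_mult X)
    then have "emb (fps_const \<iota>) = emb (fps_X + iotaF * \<beta>)"
      using subst_iotaF_F[of 1]
      by (simp add: CJ.subst_add CJ.subst_mult CJ.subst_monom CJ.subst_emb \<beta>_def fls_monom_1 emb_add emb_mult X)
    then have "fps_const \<iota> = fps_X + iotaF * \<beta>" by (simp only: emb_eq_iff)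
    then have "fps_transpose (fps_const \<iota>) = fps_const fps_X + iotaF * fps_transpose \<beta>"
      by (simp add: tr_add fps_transpose_mult trX transpose_iotaF)
    then have x3: "fls_monom 1 1 0 = iota_zpow 1 - CJ.emb_zpow 1 * emb (fps_transpose \<beta>)"
      by (simp add: emb_add emb_mult X)
    \<comment> \<open>The factors \<alpha> and \<beta> are absorbed into the power series, so the
      induction has to range over arbitrary A, B, C. Of the two resulting terms one has c raised by
      1, the other j.\<close>
    define A' where "A' = emb \<alpha> \<odot> A"
    define B' where "B' = emb (fps_transpose \<alpha>) \<odot> B"
    define C' where "C' = emb (fps_transpose \<beta>) \<odot> C"
    have AB': "fls_transposed A' B'" unfolding A'_def B'_def by (rule transposed_emb_smult2[OF AB])
    have BC': "fls_transposed (SJ.sub B') C'"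
      unfolding B'_def C'_def SJ.sub_smult2 CJ.subst_emb \<beta>_def by (rule transposed_emb_smult2[OF BC])
    have A': "fls_nonneg A'"
      unfolding fls_nonneg_def A'_def
    proof (intro allI impI coeff2_smult2_eq_0)
      fix p q k l :: int assume "p < 0 \<or> q < 0"
      then show "coeff2 (emb \<alpha>) k l = 0 \<or> coeff2 A (p - k) (q - l) = 0"
        using A fls_nonneg_emb[of \<alpha>] by (cases "k < 0 \<or> l < 0") (auto simp: fls_nonneg_def)
    qed
    have split: "fls_monom 1 (i - 1) 0 * (fls_monom 1 1 0 :: 'r fls fls) = fls_monom 1 i 0"
      by (simp add: fls_monom_mult_monom)
    have e1: "fls_monom 1 i j * CF.emb_zpow c = fls_monom 1 (i - 1) j * CF.emb_zpow (c + 1) -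
        fls_monom 1 (i - 1) (j + 1) * CF.emb_zpow c * emb \<alpha>"
    proof -
      have "fls_monom 1 i j * CF.emb_zpow c = fls_monom 1 (i - 1) j * CF.emb_zpow c * fls_monom 1 1 0"
        by (simp add: mult.commute[of _ "fls_monom 1 1 0"] fls_monom_mult_monom flip: mult.assoc)
      also have "\<dots> = fls_monom 1 (i - 1) j * CF.emb_zpow c * CF.emb_zpow 1 -
          fls_monom 1 (i - 1) j * fls_monom 1 0 1 * CF.emb_zpow c * emb \<alpha>"
        by (subst x1) (simp only: right_diff_distrib mult_ac)
      also have "\<dots> = fls_monom 1 (i - 1) j * CF.emb_zpow (c + 1) - fls_monom 1 (i - 1) (j + 1) * CF.emb_zpow c * emb \<alpha>"
        by (simp only: CF.emb_zpow_add mult.assoc fls_monom_mult_monom mult_1 add_0_right flip: mult.assoc)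
      finally show ?thesis .
    qed
    have e2: "fls_monom 1 j i * CF.emb_zpow c = fls_monom 1 j (i - 1) * CF.emb_zpow (c + 1) -
        fls_monom 1 (j + 1) (i - 1) * CF.emb_zpow c * emb (fps_transpose \<alpha>)"
    proof -
      have "fls_monom 1 j i * CF.emb_zpow c = fls_monom 1 j (i - 1) * CF.emb_zpow c * fls_monom 1 0 1"
        by (simp add: mult.commute[of _ "fls_monom 1 0 1"] fls_monom_mult_monom flip: mult.assoc)
      also have "\<dots> = fls_monom 1 j (i - 1) * CF.emb_zpow c * CF.emb_zpow 1 -
          fls_monom 1 j (i - 1) * fls_monom 1 1 0 * CF.emb_zpow c * emb (fps_transpose \<alpha>)"
        by (subst x2) (simp only: right_diff_distrib mult_ac)
      also have "\<dots> = fls_monom 1 j (i - 1) * CF.emb_zpow (c + 1) -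
          fls_monom 1 (j + 1) (i - 1) * CF.emb_zpow c * emb (fps_transpose \<alpha>)"
        by (simp only: CF.emb_zpow_add mult.assoc fls_monom_mult_monom mult_1 add_0_right flip: mult.assoc)
      finally show ?thesis .
    qed
    have e3: "fls_monom 1 i 0 * CJ.emb_zpow j * iota_zpow c = fls_monom 1 (i - 1) 0 * CJ.emb_zpow j * iota_zpow (c + 1) -
        fls_monom 1 (i - 1) 0 * CJ.emb_zpow (j + 1) * iota_zpow c * emb (fps_transpose \<beta>)"
    proof -
      have "fls_monom 1 i 0 * CJ.emb_zpow j * iota_zpow c = fls_monom 1 (i - 1) 0 * CJ.emb_zpow j * iota_zpow c * fls_monom 1 1 0"
        unfolding split[symmetric] by (simp only: mult_ac)
      also have "\<dots> = fls_monom 1 (i - 1) 0 * CJ.emb_zpow j * (iota_zpow c * iota_zpow 1) -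
          fls_monom 1 (i - 1) 0 * (CJ.emb_zpow j * CJ.emb_zpow 1) * iota_zpow c * emb (fps_transpose \<beta>)"
        by (subst x3) (simp only: right_diff_distrib mult_ac)
      finally show ?thesis by (simp only: CJ.emb_zpow_add iota_zpow_add)
    qed
    have "nat (- j) + nat (- (c + 1)) < nat (- j) + nat (- c)"
      "nat (- (j + 1)) + nat (- c) < nat (- j) + nat (- c)" using 3 by auto
    note IH1 = less.hyps[OF this(1) AB A BC, of "i - 1"] and IH2 = less.hyps[OF this(2) AB' A' BC', of "i - 1"]
    show ?thesis
      unfolding e1 e2 e3 M2.scale_left_diff_distrib res2_diff IH1[symmetric]
      using IH2 unfolding A'_def B'_def C'_def M2.scale_scale by (simp add: algebra_simps)
  qed
qed

section \<open>Iterated residues row by row\<close>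

lemma emb_const_smult2_row: "(emb (fps_const f) \<odot> H) $$ q = fls_smult scale (fps_to_fls f) (H $$ q)"
proof -
  have "fps_fls (fps_const f) = fps_const (fps_to_fls f)" by (rule fps_ext) simp
  then show ?thesis by (simp add: M1.fls_smult_const_nth)
qed

lemma F_residue_sum:
  assumes "\<And>n. n < K \<Longrightarrow> f $$ n = 0" and "nat (- K) \<le> N"
  shows "F_residue scale F f = (\<Sum>i\<le>N. scale (pF $ i) (f $$ (- 1 - int i)))"
  unfolding F_residue_def
proof (rule Sum_any.expand_superset)
  show "{i. scale (pF $ i) (f $$ (- 1 - int i)) \<noteq> 0} \<subseteq> {..N}"
  proof (rule subsetI)
    fix i assume "i \<in> {i. scale (pF $ i) (f $$ (- 1 - int i)) \<noteq> 0}"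
    then have "f $$ (- 1 - int i) \<noteq> 0" by auto
    then have "K \<le> - 1 - int i" using assms(1) not_less by blast
    then show "i \<in> {..N}" using assms(2) by simp
  qed
qed simp

lemma F_residue_conv: "F_residue scale F f = fls_smult scale (fps_to_fls pF) f $$ (- 1)"
proof -
  define N where "N = nat (- fls_subdegree f)"
  have "fls_smult scale (fps_to_fls pF) f $$ (- 1) =
      (\<Sum>i\<in>{0..int N}. scale (fps_to_fls pF $$ i) (f $$ (- 1 - i)))"
    by (rule fls_smult_nth) (auto simp: N_def split: if_splits)
  also have "\<dots> = F_residue scale F f"
    by (subst F_residue_sum[of "fls_subdegree f" f N]) (simp_all add: sum_int_atLeastAtMost N_def del: int_nat_eq)
  finally show ?thesis by simp
qed

lemma F_residue_add: "F_residue scale F (f + g) = F_residue scale F f + F_residue scale F g"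
  by (simp add: F_residue_conv M1.scale_right_distrib)

lemma F_residue_zero: "F_residue scale F 0 = 0"
  by (simp add: F_residue_conv)

lemma F_residue_scale:
  assumes "\<And>n. g $$ n = scale r (f $$ n)"
  shows "F_residue scale F g = scale r (F_residue scale F f)"
proof -
  have "g = fls_smult scale (fls_const r) f" by (rule fls_eqI) (simp add: assms fls_smult_const_nth)
  then have "F_residue scale F g = fls_smult scale (fls_const r) (fls_smult scale (fps_to_fls pF) f) $$ (- 1)"
    by (simp only: F_residue_conv M1.scale_left_commute)
  then show ?thesis by (simp only: fls_smult_const_nth F_residue_conv)
qed

lemma coeff2_weight: "coeff2 (emb (fps_const pF) \<odot> H) (- 1) q = F_residue scale F (H $$ q)"
  by (simp only: emb_const_smult2_row F_residue_conv)

text \<open>The inner residue is taken in every row and the outer one over the rows; N has to reach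
  the finitely many rows that contribute.\<close>

lemma res2_rows:
  assumes "outer_ge L H" and "nat (- L) \<le> N"
  shows "res2 H = (\<Sum>j\<le>N. scale (pF $ j) (F_residue scale F (H $$ (- 1 - int j))))"
proof -
  define w where "w = Abs_fps (\<lambda>n. fps_const (pF $ n))"
  define G where "G = emb (fps_const pF) \<odot> H"
  have "res2 H = coeff2 (emb w \<odot> G) (- 1) (- 1)"
    unfolding res2_weights w_def G_def by (simp add: mult.commute)
  also have "(emb w \<odot> G) $$ (- 1) = (\<Sum>j\<in>{0..int N}. fls_smult scale (emb w $$ j) (G $$ (- 1 - j)))"
  proof (rule M1.fls_smult_nth)
    fix j assume "int N < j"
    then have "- 1 - j < L" using assms(2) by linarith
    then have "H $$ (- 1 - j) = 0" using assms(1) by (simp add: outer_ge_def)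
    then show "G $$ (- 1 - j) = 0" unfolding G_def emb_const_smult2_row by simp
  qed simp
  also have "\<dots> = (\<Sum>j\<le>N. fls_smult scale (fls_const (pF $ j)) (G $$ (- 1 - int j)))"
    by (simp add: sum_int_atLeastAtMost w_def)
  finally have "res2 H = (\<Sum>j\<le>N. scale (pF $ j) (coeff2 G (- 1) (- 1 - int j)))"
    by (simp add: fls_nth_sum fls_smult_const_nth)
  then show ?thesis by (simp only: G_def coeff2_weight)
qed

text \<open>Serves to identify iterated residues of products of fields with iterated
  brackets.\<close>

lemma res2_hom:
  assumes f: "module_hom scale scale f" and H: "\<And>q. F_residue scale F (H $$ q) = f (x $$ q)"
  shows "res2 H = f (F_residue scale F x)"
proof -
  interpret f: module_hom scale scale f by fact
  obtain L where L: "outer_ge L H" by (rule outer_geE)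
  define N where "N = max (nat (- L)) (nat (- fls_subdegree x))"
  have "res2 H = (\<Sum>j\<le>N. scale (pF $ j) (f (x $$ (- 1 - int j))))"
    using res2_rows[OF L, of N] by (simp add: H N_def)
  also have "\<dots> = f (\<Sum>j\<le>N. scale (pF $ j) (x $$ (- 1 - int j)))"
    by (simp add: f.sum f.scale)
  also have "(\<Sum>j\<le>N. scale (pF $ j) (x $$ (- 1 - int j))) = F_residue scale F x"
    by (rule F_residue_sum[symmetric, of "fls_subdegree x"]) (simp_all add: N_def)
  finally show ?thesis .
qed

lemma F_residue_sub_F: "F_residue scale F (SF.sub H $$ q) = F_residue scale F (H $$ q)"
  using SF.residue_sub_weighted[OF weight_F, of H q] by (simp add: coeff2_weight)

lemma F_residue_sub_iota: "F_residue scale F (SI.sub H $$ q) = - F_residue scale F (H $$ q)"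
  using SI.residue_sub_weighted[OF weight_iota, of H q] by (simp add: coeff2_weight)

lemma subst_F_coeff2: "subst_F scale F (\<lambda>m n. coeff2 H m n) p q = coeff2 (SF.sub H) p q"
  unfolding SF.coeff2_sub subst_F_def fgl_expand_pow_def CF.emb_zpow_def fps_fls_def ..

lemma coeff2_sub_iota: "coeff2 (SI.sub H) p q = subst_inverse scale F (H $$ q) p"
proof -
  obtain L0 where "outer_ge L0 H" by (rule outer_geE)
  \<comment> \<open>L is lowered to at most q so that n = q belongs to the range of
    summation.\<close>
  then obtain L where L: "outer_ge L H" "L \<le> q"
    by (metis (full_types) linorder_linear order_less_le_trans outer_ge_def)
  obtain K where K: "\<And>m n. n \<le> q \<Longrightarrow> m < K \<Longrightarrow> coeff2 H m n = 0" using fls_rows_bounded[of q H] by blast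
  obtain y where y: "fps_to_fls \<iota> * y = 1" using CI.inverse_row_0 by auto
  have "emb (fps_const \<iota>) = fls_const (fps_to_fls \<iota>)"
  proof -
    have "fps_fls (fps_const \<iota>) = fps_const (fps_to_fls \<iota>)" by (rule fps_ext) simp
    then show ?thesis by simp
  qed
  then have emb_zpow: "CI.emb_zpow m = fls_const (ring_zpow (fps_to_fls \<iota>) m)" for m
    unfolding CI.emb_zpow_def by (subst ring_zpow_hom[where h = fls_const, OF _ _ y]) simp_all
  have "coeff2 (SI.sub H) p q = (\<Sum>(m,n)\<in>{K..p + q - L} \<times> {L..q}. scale (coeff2 (CI.emb_zpow m) p (q - n)) (coeff2 H m n))"
    by (rule SI.coeff2_sub_sum[OF L(1) K])
  also have "\<dots> = (\<Sum>m\<in>{K..p + q - L}. \<Sum>n\<in>{L..q}. if n = q then scale (ring_zpow (fps_to_fls \<iota>) m $$ p) (coeff2 H m q) else 0)"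
    unfolding sum.cartesian_product' by (intro sum.cong refl) (auto simp: emb_zpow)
  also have "\<dots> = (\<Sum>m\<in>{K..p + q - L}. scale (ring_zpow (fps_to_fls \<iota>) m $$ p) (coeff2 H m q))"
    using L(2) by simp
  also have "\<dots> = Sum_any (\<lambda>m. scale (ring_zpow (fps_to_fls \<iota>) m $$ p) (coeff2 H m q))"
  proof (rule Sum_any.expand_superset[symmetric])
    show "{m. scale (ring_zpow (fps_to_fls \<iota>) m $$ p) (coeff2 H m q) \<noteq> 0} \<subseteq> {K..p + q - L}"
    proof (rule subsetI)
      fix m assume "m \<in> {m. scale (ring_zpow (fps_to_fls \<iota>) m $$ p) (coeff2 H m q) \<noteq> 0}"
      then have "coeff2 (CI.emb_zpow m) p 0 \<noteq> 0" "coeff2 H m q \<noteq> 0" by (auto simp: emb_zpow)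
      then have "m \<le> p" "K \<le> m" using CI.coeff2_emb_zpow_eq_0[of 0 p m] K[of q m] by (auto simp: not_less[symmetric])
      then show "m \<in> {K..p + q - L}" using L(2) by simp
    qed
  qed simp
  finally show ?thesis by (simp add: subst_inverse_def \<iota>_def)
qed

end

lemma bilateral_mult_swap:
  "bilateral_mult scale P (\<lambda>p q. h q p) p q = bilateral_mult scale (fps_transpose P) h q p"
  unfolding bilateral_mult_def
  by (rule Sum_any.reindex_cong[of prod.swap]) (auto simp: fun_eq_iff)

definition fls_map :: "('a::zero \<Rightarrow> 'b::zero) \<Rightarrow> 'a fls \<Rightarrow> 'b fls" where
  "fls_map g x = Abs_fls (\<lambda>n. g (x $$ n))"

lemma fls_map_nth: "g 0 = 0 \<Longrightarrow> fls_map g x $$ n = g (x $$ n)"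
  unfolding fls_map_def by (rule nth_Abs_fls_lower_bound[of "fls_subdegree x"]) simp

section \<open>Working modulo a submodule, coefficient by coefficient\<close>

lemma (in module) fls_smult_mem:
  assumes "subspace D" "\<And>n. h $$ n \<in> D"
  shows "fls_smult scale f h $$ n \<in> D"
proof -
  have "fls_smult scale f h $$ n =
      (\<Sum>i\<in>{fls_subdegree f..n - fls_subdegree h}. scale (f $$ i) (h $$ (n - i)))"
    by (rule fls_smult_nth) auto
  then show ?thesis using assms by (simp add: subspace_sum subspace_scale)
qed

context laurent_module
begin

lemma smult2_mem:
  assumes D: "subspace D" and H: "\<And>p q. coeff2 H p q \<in> D"
  shows "coeff2 (f \<odot> H) p q \<in> D"
proof -
  \<comment> \<open>The series with all coefficients in D form a submodule of V((z)), to which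
    \<open>fls_smult_mem\<close> applies once more.\<close>
  have "M1.subspace {h. \<forall>n. h $$ n \<in> D}"
    by (rule M1.subspaceI) (auto simp: D subspace_0 subspace_add fls_smult_mem)
  then have "(f \<odot> H) $$ q \<in> {h. \<forall>n. h $$ n \<in> D}"
    by (rule M1.fls_smult_mem) (use H in simp)
  then show ?thesis by simp
qed

end

lemma (in fls_substitution) sub_mem:
  assumes "subspace D" and H: "\<And>p q. coeff2 H p q \<in> D"
  shows "coeff2 (sub H) p q \<in> D"
proof -
  obtain L where L: "outer_ge L H" by (rule outer_geE)
  obtain K where "\<And>m n. n \<le> q \<Longrightarrow> m < K \<Longrightarrow> coeff2 H m n = 0" using fls_rows_bounded[of q H] by blast
  from coeff2_sub_sum[OF L this] show ?thesis
    using assms by (simp add: case_prod_unfold subspace_sum subspace_scale)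
qed

section \<open>Vertex F-algebras\<close>

lemma fls_transposed_diff:
  "fls_transposed A B \<Longrightarrow> fls_transposed A' B' \<Longrightarrow> fls_transposed (A - A') (B - B')"
  for A :: "'v::ab_group_add fls fls"
  by (simp add: fls_transposed_def)

lemma (in fgl_module) F_residue_mem:
  "subspace D \<Longrightarrow> (\<And>n. f $$ n \<in> D) \<Longrightarrow> F_residue scale F f \<in> D"
  unfolding F_residue_conv by (rule fls_smult_mem)

lemma (in fgl_module) res2_mem:
  "subspace D \<Longrightarrow> (\<And>p q. coeff2 H p q \<in> D) \<Longrightarrow> res2 H \<in> D"
  unfolding res2_def by (rule smult2_mem)

sublocale vertex_F_algebra \<subseteq> fgl_module scale F ..

context vertex_F_algebra
begin

abbreviation bracket :: "'v \<Rightarrow> 'v \<Rightarrow> 'v" where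
  "bracket a b \<equiv> F_residue scale F (Y a b)"

abbreviation D :: "'v set" where
  "D \<equiv> translation_submodule scale S"

lemma subspace_D: "subspace D"
  unfolding translation_submodule_def by (rule subspace_span)

lemma S_in_D: "n \<ge> 1 \<Longrightarrow> S a $ n \<in> D"
  unfolding translation_submodule_def by (rule span_base) auto

lemma Y_add_left: "Y (a + a') b = Y a b + Y a' b"
  by (rule fls_eqI) (simp add: module_hom.add[OF Y_linear_left])

lemma Y_add_right: "Y a (b + b') = Y a b + Y a b'"
  by (rule fls_eqI) (simp add: module_hom.add[OF Y_linear_right])

lemma Y_0_left: "Y 0 b = 0"
  by (rule fls_eqI) (simp add: module_hom.zero[OF Y_linear_left])

lemma Y_0_right: "Y a 0 = 0"
  by (rule fls_eqI) (simp add: module_hom.zero[OF Y_linear_right])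

lemma bracket_hom_left: "module_hom scale scale (\<lambda>a. bracket a b)"
  by unfold_locales
    (simp_all add: Y_add_left F_residue_add F_residue_scale module_hom.scale[OF Y_linear_left])

lemma bracket_hom_right: "module_hom scale scale (\<lambda>b. bracket a b)"
  by unfold_locales
    (simp_all add: Y_add_right F_residue_add F_residue_scale module_hom.scale[OF Y_linear_right])

text \<open>The series Y(S^(n) a, z) b is the coefficient of w^n in Y(a, F(z,w)) b. By invariance
  its residue is the coefficient of w^n in the residue of Y(a,z) b, which is constant in w.\<close>

lemma bracket_S_left: "n \<ge> 1 \<Longrightarrow> bracket (S a $ n) b = 0"
proof -
  assume n: "n \<ge> 1"
  define H where "H = fls_const (Y a b)"
  have "Y (S a $ n) b $$ p = coeff2 (SF.sub H) p (int n)" for p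
  proof -
    have "(\<lambda>m n. coeff2 H m n) = (\<lambda>m n. if n = 0 then Y a b $$ m else 0)"
      by (auto simp: H_def fun_eq_iff)
    then have "(\<lambda>p q. Y (fps_to_fls (S a) $$ q) b $$ p) = subst_F scale F (\<lambda>m n. coeff2 H m n)"
      using translation_covariance[of a b] by simp
    from fun_cong[OF fun_cong[OF this, of p], of "int n"] show ?thesis by (simp add: subst_F_coeff2)
  qed
  then have "Y (S a $ n) b = SF.sub H $$ int n" by (rule fls_eqI)
  then have "bracket (S a $ n) b = F_residue scale F (H $$ int n)" by (simp add: F_residue_sub_F)
  then show ?thesis using n by (simp add: H_def F_residue_zero)
qed

lemma bracket_D_left: "d \<in> D \<Longrightarrow> bracket d b = 0"
proof -
  assume "d \<in> D"
  interpret hom: module_hom scale scale "\<lambda>a. bracket a b" by (rule bracket_hom_left)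
  have "subspace {a. bracket a b = 0}"
    by (rule subspaceI) (simp_all add: hom.add hom.scale hom.zero)
  then have "D \<subseteq> {a. bracket a b = 0}"
    unfolding translation_submodule_def by (intro span_minimal) (auto simp: bracket_S_left)
  then show ?thesis using \<open>d \<in> D\<close> by auto
qed

text \<open>All terms of S(z) beyond n = 0 lie in D. H may have other rows, because the lemma is
  applied to each row of Y(Y(b,w)c, y)a.\<close>

lemma skew_symmetry_mod_D:
  assumes "H $$ q = Y b a"
  shows "Y a b $$ p - coeff2 (SI.sub H) p q \<in> D"
proof -
  define h where "h = SI.sub H $$ q"
  have h: "subst_inverse scale F (Y b a) = (\<lambda>p. h $$ p)"
    by (simp add: h_def coeff2_sub_iota assms)
  have S0: "S 0 $ n = 0" for n using module_hom.zero[OF S_linear[of n]] .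
  define N where "N = nat (p - fls_subdegree h)"
  have "Y a b $$ p = Sum_any (\<lambda>n. S (h $$ (p - int n)) $ n)"
    using skew_symmetry[of a b p] by (simp add: h)
  also have "\<dots> = (\<Sum>n\<le>N. S (h $$ (p - int n)) $ n)"
  proof (rule Sum_any.expand_superset)
    show "{n. S (h $$ (p - int n)) $ n \<noteq> 0} \<subseteq> {..N}"
    proof (rule subsetI)
      fix n assume "n \<in> {n. S (h $$ (p - int n)) $ n \<noteq> 0}"
      then have "h $$ (p - int n) \<noteq> 0" using S0 by auto
      then have "fls_subdegree h \<le> p - int n" using fls_subdegree_leI by blast
      then show "n \<in> {..N}" unfolding N_def by simp
    qed
  qed simp
  also have "\<dots> = h $$ p + (\<Sum>n\<in>{1..N}. S (h $$ (p - int n)) $ n)"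
  proof -
    have "{..N} = insert 0 {1..N}" by auto
    then show ?thesis by (simp add: S_0)
  qed
  finally have "Y a b $$ p - coeff2 (SI.sub H) p q = (\<Sum>n\<in>{1..N}. S (h $$ (p - int n)) $ n)"
    by (simp add: h_def)
  also have "\<dots> \<in> D" by (rule subspace_sum[OF subspace_D]) (simp add: S_in_D)
  finally show ?thesis .
qed

lemma bracket_skew: "bracket a b + bracket b a \<in> D"
proof -
  define H where "H = fls_const (Y b a)"
  have "(Y a b - SI.sub H $$ 0) $$ p \<in> D" for p
    using skew_symmetry_mod_D[of H 0 b a p] by (simp add: H_def)
  then have "F_residue scale F (Y a b - SI.sub H $$ 0) \<in> D" by (rule F_residue_mem[OF subspace_D])
  moreover have "F_residue scale F (Y a b - SI.sub H $$ 0) = bracket a b + bracket b a"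
  proof -
    have "F_residue scale F (SI.sub H $$ 0) = - bracket b a" by (simp add: F_residue_sub_iota H_def)
    moreover have "bracket a b = F_residue scale F (Y a b - SI.sub H $$ 0) + F_residue scale F (SI.sub H $$ 0)"
      by (simp flip: F_residue_add)
    ultimately show ?thesis by simp
  qed
  ultimately show ?thesis by simp
qed

definition YY_right :: "'v \<Rightarrow> 'v \<Rightarrow> 'v \<Rightarrow> 'v fls fls" where
  "YY_right a b c = fls_map (\<lambda>x. Y a x) (Y b c)"

text \<open>For Y(Y(a,z)b, w)c the outer variable is z: each coefficient of Y(a,z)b gives a series
  in w, so the whole lies in V((w))((z)).\<close>

definition YY_left :: "'v \<Rightarrow> 'v \<Rightarrow> 'v \<Rightarrow> 'v fls fls" where
  "YY_left a b c = fls_map (\<lambda>x. Y x c) (Y a b)"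

lemma YY_right_nth: "YY_right a b c $$ q = Y a (Y b c $$ q)"
  by (simp add: YY_right_def fls_map_nth Y_0_right)

lemma YY_left_nth: "YY_left a b c $$ q = Y (Y a b $$ q) c"
  by (simp add: YY_left_def fls_map_nth Y_0_left)

lemma res2_YY_right: "res2 (YY_right a b c) = bracket a (bracket b c)"
  by (rule res2_hom[OF bracket_hom_right]) (simp add: YY_right_nth)

lemma res2_YY_left: "res2 (YY_left a b c) = bracket (bracket a b) c"
  by (rule res2_hom[OF bracket_hom_left[of c]]) (simp add: YY_left_nth)

text \<open>The two sides of weak associativity have their variables in opposite orders, so the
  equality of bilateral series becomes a transposition.\<close>

lemma weak_associativity_transposed:
  "\<exists>N. fls_transposed (emb (F ^ N) \<odot> SF.sub (YY_right a b c)) (emb (F ^ N) \<odot> YY_left a b c)"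
proof -
  obtain N where N: "bilateral_mult scale (F ^ N) (\<lambda>p q. Y (Y a b $$ p) c $$ q) =
    bilateral_mult scale (F ^ N) (subst_F scale F (\<lambda>m n. Y a (Y b c $$ n) $$ m))"
    using weak_associativity[of a b c] by blast
  have "coeff2 (emb (F ^ N) \<odot> SF.sub (YY_right a b c)) p q = coeff2 (emb (F ^ N) \<odot> YY_left a b c) q p" for p q
  proof -
    have "subst_F scale F (\<lambda>m n. Y a (Y b c $$ n) $$ m) = (\<lambda>p q. coeff2 (SF.sub (YY_right a b c)) p q)"
      by (intro ext) (simp add: YY_right_nth flip: subst_F_coeff2)
    then have "coeff2 (emb (F ^ N) \<odot> SF.sub (YY_right a b c)) p q =
        bilateral_mult scale (F ^ N) (subst_F scale F (\<lambda>m n. Y a (Y b c $$ n) $$ m)) p q"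
      by (simp add: bilateral_mult_coeff2)
    also have "\<dots> = bilateral_mult scale (F ^ N) (\<lambda>p q. coeff2 (YY_left a b c) q p) p q"
      by (simp add: YY_left_nth flip: N)
    also have "\<dots> = bilateral_mult scale (F ^ N) (\<lambda>p q. coeff2 (YY_left a b c) p q) q p"
      by (subst bilateral_mult_swap) (simp add: fps_transpose_power transpose_F)
    finally show ?thesis by (simp add: bilateral_mult_coeff2)
  qed
  then show ?thesis unfolding fls_transposed_def by blast
qed

text \<open>The three brackets are the residues at y = 0, w = 0 and F(w,y) = 0, in this order; the
  last one is identified only modulo D.\<close>

lemma jacobi_associator:
  "bracket b (bracket c a) - bracket (bracket b c) a - bracket (bracket a b) c \<in> D"
proof -
  define m where "m = YY_right b c a"
  define l where "l = YY_left b c a"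
  define g where "g = YY_right a b c"
  define k where "k = YY_left a b c"
  obtain N1 where N1: "fls_transposed (emb (F ^ N1) \<odot> SF.sub m) (emb (F ^ N1) \<odot> l)"
    unfolding m_def l_def using weak_associativity_transposed by blast
  obtain N2 where N2: "fls_transposed (emb (F ^ N2) \<odot> SF.sub g) (emb (F ^ N2) \<odot> k)"
    unfolding g_def k_def using weak_associativity_transposed by blast
  obtain L1 where L1: "outer_ge L1 (emb (F ^ N1) \<odot> SF.sub m)" by (rule outer_geE)
  obtain L2 where L2: "outer_ge L2 (emb (F ^ N1) \<odot> l)" by (rule outer_geE)
  \<comment> \<open>L1 bounds the order in y and L2 that in w, so w^M y^M removes both poles and A
    becomes a power series. That M >= 0 is used below for the power series
    \<iota>(F(z,w))^M.\<close>
  define M where "M = max 0 (max (- L1) (- L2))"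
  define A where "A = fls_monom 1 M M \<odot> emb (F ^ N1) \<odot> SF.sub m"
  define B where "B = fls_monom 1 M M \<odot> emb (F ^ N1) \<odot> l"
  have AB: "fls_transposed A B"
    unfolding A_def B_def by (rule transposed_monom_smult2[OF N1])
  have A: "fls_nonneg A"
    unfolding fls_nonneg_def
  proof (intro allI impI)
    fix p q :: int assume "p < 0 \<or> q < 0"
    then show "coeff2 A p q = 0"
    proof
      assume "q < 0"
      then have "q - M < L1" by (simp add: M_def)
      then show ?thesis using L1 unfolding A_def coeff2_monom_smult2 by (simp add: outer_ge_def)
    next
      assume "p < 0"
      then have "p - M < L2" by (simp add: M_def)
      then have "coeff2 B q p = 0" using L2 unfolding B_def coeff2_monom_smult2 by (simp add: outer_ge_def)
      then show ?thesis using AB by (simp add: fls_transposed_def)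
    qed
  qed
  have "fls_nonneg (SJ.sub B)" using A fls_transposed_nonneg[OF AB] by (simp add: SJ.fls_nonneg_sub)
  then obtain C where BC: "fls_transposed (SJ.sub B) C" by (rule fls_nonneg_transpose_exists)
  define c1 where "c1 = - int N1"
  \<comment> \<open>The value of w^-M y^-M F(w,y)^-N1 at y = \<iota>(F(z,w)); thus
    \<open>K \<odot> C\<close> is the function expanded at the third pole.\<close>
  define K where "K = fls_monom 1 (- M) 0 * CJ.emb_zpow (- M) * iota_zpow c1"
  have F_inv: "CF.emb_zpow (- int N) * emb (F ^ N) = 1" for N
    using CF.emb_zpow_add[of "- int N" "int N"] by (simp add: CF.emb_zpow_of_nat emb_power)
  have cancel: "(fls_monom 1 (- M) (- M) * CF.emb_zpow c1) \<odot> fls_monom 1 M M \<odot> emb (F ^ N1) \<odot> H = H" for H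
  proof -
    have "fls_monom 1 (- M) (- M) * CF.emb_zpow c1 * (fls_monom 1 M M * emb (F ^ N1)) =
        (fls_monom 1 (- M) (- M) * fls_monom 1 M M) * (CF.emb_zpow c1 * emb (F ^ N1))"
      by (simp only: mult_ac)
    also have "\<dots> = 1" unfolding c1_def F_inv by (simp add: fls_monom_mult_monom fls_monom_1)
    finally show ?thesis by simp
  qed
  have "res2 m - res2 l = res2 (K \<odot> C)"
    using residue_theorem[OF AB A BC, of "- M" "- M" c1] res2_sub_F[of m]
    unfolding A_def B_def cancel K_def by simp
  moreover have "res2 (K \<odot> C - k) \<in> D"
  proof (rule res2_mem[OF subspace_D])
    \<comment> \<open>By skew symmetry in every row, l with y replaced by \<iota>(y) agrees with g
      modulo D; E is the error.\<close>
    define E where "E = SI.sub l - g"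
    \<comment> \<open>U and U' are w^M y^M F(w,y)^N1 at y = \<iota>(F(z,w)), in the two orders of
      expansion.\<close>
    define U where "U = CJ.emb_zpow M * fls_monom 1 0 M * CI.emb_zpow (int N1)"
    define U' where "U' = CJ.emb_zpow M * fls_monom 1 M 0 * iota_zpow (int N1)"
    have E: "coeff2 E p q \<in> D" for p q
    proof -
      have "coeff2 g p q - coeff2 (SI.sub l) p q \<in> D"
        using skew_symmetry_mod_D[of l q _ a p] by (simp add: g_def l_def YY_right_nth YY_left_nth)
      then show ?thesis using subspace_neg[OF subspace_D] by (fastforce simp: E_def)
    qed
    have subB: "SJ.sub B = U \<odot> SJ.sub l"
      unfolding B_def M2.scale_scale SJ.sub_smult2 CJ.subst_mult CJ.subst_monom CF.emb_zpow_of_nat[symmetric]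
        emb_power subst_iotaF_F U_def ..
    \<comment> \<open>Replacing y by \<iota>(F(z,w)) is \<iota> followed by F. Hence l becomes
      Y(a,F(z,w))Y(b,w)c modulo D, the right side of weak associativity, whose left side is
      k.\<close>
    have "SJ.sub l = SF.sub (E + g)" by (simp add: E_def sub_F_iota)
    then have "SJ.sub l = SF.sub E + SF.sub g" by (simp only: SF.sub_add)
    then have "emb (F ^ N2) \<odot> SJ.sub B = emb (F ^ N2) \<odot> U \<odot> SF.sub E + U \<odot> emb (F ^ N2) \<odot> SF.sub g"
      unfolding subB by (simp add: M2.scale_right_distrib mult.commute)
    moreover have "coeff2 (emb (F ^ N2) \<odot> U \<odot> SF.sub E) p q \<in> D" for p q
      by (intro smult2_mem SF.sub_mem subspace_D E)
    ultimately have 1: "coeff2 (emb (F ^ N2) \<odot> SJ.sub B - U \<odot> emb (F ^ N2) \<odot> SF.sub g) p q \<in> D" for p q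
      by simp
    have "fls_transposed (U \<odot> emb (F ^ N2) \<odot> SF.sub g) (U' \<odot> emb (F ^ N2) \<odot> k)"
    proof -
      have zpJ: "CJ.emb_zpow M = emb (iotaF ^ nat M)"
        by (simp add: CJ.emb_zpow_def ring_zpow_nonneg M_def emb_power)
      have tr: "fps_transpose (iotaF ^ nat M) = iotaF ^ nat M"
        by (simp add: fps_transpose_power transpose_iotaF)
      show ?thesis
        using transposed_emb_smult2[OF transposed_monom_smult2[OF transposed_emb_zpow[OF N2, of "int N1"], of 1 0 M],
            of "iotaF ^ nat M"]
        unfolding U_def U'_def zpJ tr by (simp add: mult.assoc)
    qed
    moreover have "fls_transposed (emb (F ^ N2) \<odot> SJ.sub B) (emb (F ^ N2) \<odot> C)"
      using transposed_emb_smult2[OF BC, of "F ^ N2"] by (simp add: fps_transpose_power transpose_F)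
    ultimately have "fls_transposed (emb (F ^ N2) \<odot> SJ.sub B - U \<odot> emb (F ^ N2) \<odot> SF.sub g)
        (emb (F ^ N2) \<odot> C - U' \<odot> emb (F ^ N2) \<odot> k)" by (intro fls_transposed_diff)
    then have 2: "coeff2 (emb (F ^ N2) \<odot> C - U' \<odot> emb (F ^ N2) \<odot> k) p q \<in> D" for p q
      using 1 unfolding fls_transposed_def by metis
    have KU: "K * U' = 1"
    proof -
      have "K * U' = (fls_monom 1 (- M) 0 * fls_monom 1 M 0) * (CJ.emb_zpow (- M) * CJ.emb_zpow M) * (iota_zpow c1 * iota_zpow (int N1))"
        unfolding K_def U'_def by (simp only: mult_ac)
      then show ?thesis
        by (simp add: c1_def fls_monom_mult_monom fls_monom_1 flip: CJ.emb_zpow_add iota_zpow_add)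
    qed
    \<comment> \<open>Undoes, in V((w))((z)), the multiplication by F^N2 together with the factor
      U'.\<close>
    define W where "W = CF.emb_zpow (- int N2) * K"
    have "W * emb (F ^ N2) = K"
    proof -
      have "W * emb (F ^ N2) = (CF.emb_zpow (- int N2) * emb (F ^ N2)) * K" unfolding W_def by (simp only: mult_ac)
      then show ?thesis by (simp add: F_inv)
    qed
    moreover have "W * (U' * emb (F ^ N2)) = 1"
    proof -
      have "W * (U' * emb (F ^ N2)) = (CF.emb_zpow (- int N2) * emb (F ^ N2)) * (K * U')"
        unfolding W_def by (simp only: mult_ac)
      then show ?thesis by (simp add: F_inv KU)
    qed
    ultimately have "K \<odot> C - k = W \<odot> (emb (F ^ N2) \<odot> C - U' \<odot> emb (F ^ N2) \<odot> k)"
      by (simp add: M2.scale_right_diff_distrib)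
    then show "coeff2 (K \<odot> C - k) p q \<in> D" for p q
      using smult2_mem[OF subspace_D 2, of W q p] by simp
  qed
  ultimately have "res2 m - res2 l - res2 k \<in> D" by (simp add: res2_diff)
  then show ?thesis unfolding m_def l_def k_def res2_YY_right res2_YY_left .
qed

text \<open>Skew symmetry turns [[b,c],a] and [[a,b],c] into -[a,[b,c]] and -[c,[a,b]] modulo
  D.\<close>

lemma bracket_jacobi:
  "bracket a (bracket b c) + (bracket b (bracket c a) + bracket c (bracket a b)) \<in> D"
proof -
  have "(bracket b (bracket c a) - bracket (bracket b c) a - bracket (bracket a b) c) +
      ((bracket (bracket b c) a + bracket a (bracket b c)) + (bracket (bracket a b) c + bracket c (bracket a b))) \<in> D"
    by (intro subspace_add[OF subspace_D] jacobi_associator bracket_skew)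
  then show ?thesis by (simp add: algebra_simps)
qed

lemma bracket_D_right: "d \<in> D \<Longrightarrow> bracket a d \<in> D"
  using bracket_skew[of a d] bracket_D_left[of d a] by simp

section \<open>The quotient by the translation submodule\<close>

lemma coset_eq_iff: "a +o D = b +o D \<longleftrightarrow> a - b \<in> D"
proof
  assume "a +o D = b +o D"
  moreover have "a \<in> a +o D" using subspace_0[OF subspace_D] by (auto simp: elt_set_plus_def)
  ultimately obtain d where "d \<in> D" "a = b + d" by (auto simp: elt_set_plus_def)
  then show "a - b \<in> D" by simp
next
  assume ab: "a - b \<in> D"
  have "a + d \<in> b +o D" if "d \<in> D" for d
    using subspace_add[OF subspace_D ab that] by (auto simp: elt_set_plus_def intro!: bexI[of _ "a - b + d"])
  moreover have "b + d \<in> a +o D" if "d \<in> D" for d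
    using subspace_diff[OF subspace_D that ab] by (auto simp: elt_set_plus_def intro!: bexI[of _ "d - (a - b)"])
  ultimately show "a +o D = b +o D" by (auto simp: elt_set_plus_def)
qed

lemma coset_add: "(a +o D) + (b +o D) = (a + b) +o D"
proof (rule set_eqI, rule iffI)
  fix x assume "x \<in> (a +o D) + (b +o D)"
  then obtain d e where "d \<in> D" "e \<in> D" "x = (a + d) + (b + e)"
    by (auto simp: elt_set_plus_def elim!: set_plus_elim)
  then show "x \<in> (a + b) +o D"
    using subspace_add[OF subspace_D] by (auto simp: elt_set_plus_def algebra_simps intro!: bexI[of _ "d + e"])
next
  fix x assume "x \<in> (a + b) +o D"
  then obtain d where "d \<in> D" "x = (a + d) + (b + 0)" by (auto simp: elt_set_plus_def algebra_simps)
  moreover have "a + d \<in> a +o D" "b + 0 \<in> b +o D"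
    using \<open>d \<in> D\<close> subspace_0[OF subspace_D] unfolding elt_set_plus_def by blast+
  ultimately show "x \<in> (a +o D) + (b +o D)" by (metis set_plus_intro)
qed

lemma coset_scale: "quotient_smult scale D r (a +o D) = scale r a +o D"
proof (rule set_eqI, rule iffI)
  fix x assume "x \<in> quotient_smult scale D r (a +o D)"
  then obtain d e where "d \<in> D" "e \<in> D" "x = scale r (a + d) + e"
    by (auto simp: quotient_smult_def elt_set_plus_def elim!: set_plus_elim)
  then have "x = scale r a + (scale r d + e)" "scale r d + e \<in> D"
    using subspace_D by (auto simp: scale_right_distrib add.assoc intro: subspace_add subspace_scale)
  then show "x \<in> scale r a +o D" by (auto simp: elt_set_plus_def)
next
  fix x assume "x \<in> scale r a +o D"
  then obtain d where "d \<in> D" "x = scale r (a + 0) + d" by (auto simp: elt_set_plus_def)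
  moreover have "a + 0 \<in> a +o D" using subspace_0[OF subspace_D] unfolding elt_set_plus_def by blast
  ultimately show "x \<in> quotient_smult scale D r (a +o D)"
    unfolding quotient_smult_def by (metis imageI set_plus_intro)
qed

theorem bracket_on_quotient:
  "\<exists>br. (\<forall>a b. br (a +o D) (b +o D) = bracket a b +o D) \<and> lie_bracket_on_quotient scale D br"
proof -
  define rep where "rep X = (SOME a. X = a +o D)" for X :: "'v set"
  define br where "br X Y' = bracket (rep X) (rep Y') +o D" for X Y'
  have rep: "a - rep (a +o D) \<in> D" for a
  proof -
    have "a +o D = rep (a +o D) +o D" unfolding rep_def by (rule someI) (rule refl)
    then show ?thesis by (simp add: coset_eq_iff)
  qed
  have br: "br (a +o D) (b +o D) = bracket a b +o D" for a b
  proof -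
    define a' b' where "a' = rep (a +o D)" and "b' = rep (b +o D)"
    interpret left: module_hom scale scale "\<lambda>a. bracket a b" by (rule bracket_hom_left)
    interpret right: module_hom scale scale "\<lambda>b. bracket a' b" by (rule bracket_hom_right)
    \<comment> \<open>An element of D in the first argument gives 0, in the second only an element
      of D, which is enough for the coset.\<close>
    have "bracket a b - bracket a' b = 0"
      using bracket_D_left[OF rep[of a], of b] left.diff[of a a'] by (simp add: a'_def)
    moreover have "bracket a' b - bracket a' b' \<in> D"
      using bracket_D_right[OF rep[of b], of a'] right.diff[of b b'] by (simp add: b'_def)
    ultimately have "bracket a b - bracket a' b' \<in> D" by simp
    then show ?thesis by (simp add: br_def a'_def b'_def coset_eq_iff[symmetric])
  qed
  have zero: "D = 0 +o D" by (simp add: elt_set_plus_def)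
  have "lie_bracket_on_quotient scale D br"
    unfolding lie_bracket_on_quotient_def lie_bracket_on_def quotient_carrier_def ball_simps
  proof (intro conjI allI)
    fix a b c r
    show "br (a +o D) (b +o D) \<in> range (\<lambda>a. a +o D)" by (simp add: br)
    show "br (a +o D + (b +o D)) (c +o D) = br (a +o D) (c +o D) + br (b +o D) (c +o D)"
      by (simp add: br coset_add Y_add_left F_residue_add)
    show "br (a +o D) (b +o D + (c +o D)) = br (a +o D) (b +o D) + br (a +o D) (c +o D)"
      by (simp add: br coset_add Y_add_right F_residue_add)
    show "br (quotient_smult scale D r (a +o D)) (b +o D) = quotient_smult scale D r (br (a +o D) (b +o D))"
      by (simp add: br coset_scale module_hom.scale[OF bracket_hom_left])
    show "br (a +o D) (quotient_smult scale D r (b +o D)) = quotient_smult scale D r (br (a +o D) (b +o D))"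
      by (simp add: br coset_scale module_hom.scale[OF bracket_hom_right])
    have "(bracket a b + bracket b a) +o D = 0 +o D"
      unfolding coset_eq_iff by (simp add: bracket_skew)
    then show "br (a +o D) (b +o D) + br (b +o D) (a +o D) = D"
      using zero by (simp add: br coset_add)
    have "(bracket a (bracket b c) + (bracket b (bracket c a) + bracket c (bracket a b))) +o D = 0 +o D"
      unfolding coset_eq_iff by (simp add: bracket_jacobi)
    then show "br (a +o D) (br (b +o D) (c +o D)) + (br (b +o D) (br (c +o D) (a +o D)) +
        br (c +o D) (br (a +o D) (b +o D))) = D"
      using zero by (simp add: br coset_add)
  qed
  then show ?thesis using br by blast
qed

end

theorem theorem4p9:
  fixes scale :: "'r::comm_ring_1 \<Rightarrow> 'v::ab_group_add \<Rightarrow> 'v"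
    and F :: "'r fps fps"
    and vac :: 'v
    and S :: "'v \<Rightarrow> 'v fps"
    and Y :: "'v \<Rightarrow> 'v \<Rightarrow> 'v fls"
  assumes "formal_group_law F"
    and "vertex_F_algebra scale F vac S Y"
  shows "\<exists>br. (\<forall>a b. br (a +o translation_submodule scale S) (b +o translation_submodule scale S) =
                 F_residue scale F (Y a b) +o translation_submodule scale S) \<and>
              lie_bracket_on_quotient scale (translation_submodule scale S) br"
  using assms(2) by (rule vertex_F_algebra.bracket_on_quotient)

end
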